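(* Let $k\ge 2$ and let $\mathcal M(R,F)$ be a quantum matrix algebra of type $Sp(2k)$ (so $\mu=-q^{-1-2k}$), with matrix of generators $M$, 2-contraction $g$ and elements $a_i\in\mathcal C(R,F)$, $0\le i\le k$. Put $\epsilon_0:=1$ and $$\epsilon_i:=\sum_{j=0}^{[i/2]}a_{i-2j}\,g^j,\qquad \epsilon_{k+i}:=\epsilon_{k-i}\,g^i\qquad (i=1,2,\dots,k).$$ Then $M$ satisfies the Cayley–Hamilton identity $$\sum_{i=0}^{2k}(-q)^i\,M^{\overline{2k-i}}\,\epsilon_i=0 .$$
   Context: Operators. $V$ is a complex vector space of finite dimension $N$ with a fixed basis (operators on $V^{\otimes n}$ are matrices), $I$ the identity, $P$ the flip on $V\otimes V$. For $X\in\mathrm{End}(V^{\otimes 2})$, $X_{mr}$ is $X$ acting in the tensor factors $m,r$ and trivially elsewhere, $X_m:=X_{m\,m+1}$; for an $N\times N$ matrix $Y$, $Y_m$ is $Y$ in factor $m$. $\mathrm{Tr}_{(i)}$ is the trace over the $i$-th factor. $X$ is skew invertible if there is $\Psi_X\in\mathrm{End}(V^{\otimes2})$ with $\mathrm{Tr}_{(2)}X_{12}(\Psi_X)_{23}=\mathrm{Tr}_{(2)}(\Psi_X)_{12}X_{23}=P_{13}$; then $C_X:=\mathrm{Tr}_{(1)}(\Psi_X)_{12}$, $D_X:=\mathrm{Tr}_{(2)}(\Psi_X)_{12}$, and $X$ is strict skew invertible if $C_X$ or $D_X$ is invertible. An R-matrix is an invertible $R\in\mathrm{End}(V^{\otimes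 2})$ with $R_1R_2R_1=R_2R_1R_2$; it gives representations $\rho_R$ of the braid groups $\mathcal B_n$ (generators $\sigma_1,\dots,\sigma_{n-1}$) and of $\mathbb C\mathcal B_n$ on $V^{\otimes n}$, $\sigma_i\mapsto R_i$. A pair $\{R,F\}$ is compatible if $R_1F_2F_1=F_2F_1R_2$ and $R_2F_1F_2=F_1F_2R_1$. For skew invertible $R$ the R-trace over spaces $i_1,\dots,i_s$ is $\mathrm{Tr}_{R(i_1,\dots,i_s)}X:=\mathrm{Tr}_{(i_1,\dots,i_s)}\big((D_R)_{i_1}\cdots(D_R)_{i_s}X\big)$. BMW-type. Let $q\in\mathbb C\setminus\{0,\pm1\}$, $\mu\in\mathbb C\setminus\{0,q,-q^{-1}\}$, $i_q:=(q^i-q^{-i})/(q-q^{-1})$, $\eta:=\frac{(q-\mu)(q^{-1}+\mu)}{\mu(q-q^{-1})}$. An R-matrix $R$ is of BMW-type if its minimal polynomial relation is $(qI-R)(q^{-1}I+R)(\mu I-R)=0$ and $K:=\mu^{-1}(q-q^{-1})^{-1}(qI-R)(q^{-1}I+R)$ satisfies $K_2K_1=R_1^{\pm1}R_2^{\pm1}K_1$ and $K_1K_2K_1=K_1$. Put $\kappa_i:=\frac{(q-\sigma_i)(q^{-1}+\sigma_i)}{\mu(q-q^{-1})}$ (so $\rho_R(\kappa_i)=K_i$), $\sigma_i^-(x):=1+\frac{x-1}{q-q^{-1}}\sigma_i+\frac{x-1}{q\mu^{-1}x+1}\kappa_i$. Antisymmetrizers: $a^{(1)}:=1$, $a^{(i+1)}:=\frac{q^i}{(i+1)_q}a^{(i)}\sigma^-_i(q^{-2i})a^{(i)}$.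 For $\alpha\in\mathbb C\mathcal B_n$, $\alpha^{\uparrow m}\in\mathbb C\mathcal B_{n+m}$ is its image under $\sigma_i\mapsto\sigma_{i+m}$. Type $Sp(2k)$. A skew invertible BMW-type R-matrix is of type $Sp(2k)$, $k\ge2$, if $i_q\ne0$ for $i=2,\dots,k$, $\mu=-q^{-1-2k}$, $\rho_R(a^{(i)})\neq0$ for $i=2,\dots,k$, and $\rho_R\big(a^{(k)\uparrow1}\sigma_1^-(q^{-2k})a^{(k)\uparrow1}\big)=0$. Quantum matrix algebra. Let $\{R,F\}$ be a compatible pair of strict skew invertible R-matrices. For an $N\times N$ matrix $M$ put $M_{\overline1}:=M_1$, $M_{\overline i}:=F_{i-1}M_{\overline{i-1}}F_{i-1}^{-1}$. $\mathcal M(R,F)$ is the unital associative $\mathbb C$-algebra generated by the entries $M_a^b$ of $M$ with relations $R_1M_{\overline1}M_{\overline2}=M_{\overline1}M_{\overline2}R_1$; it is of type $Sp(2k)$ if $R$ is. For $\alpha\in\mathbb C\mathcal B_n$ put $ch(\alpha):=\mathrm{Tr}_{R(1,\dots,n)}(M_{\overline1}\cdots M_{\overline n}\,\rho_R(\alpha))$; these elements and $1$ span a commutative subalgebra $\mathcal C(R,F)$. Set $a_0:=1$, $a_i:=ch(a^{(i)})$, $g:=\eta^{-1}ch(\kappa_1)$. Matrix powers. $M^{\overline0}:=I$, $M^{\overline1}:=M$, $(M^{\overline n})_1:=\mathrm{Tr}_{R(2,\dots,n)}\big(M_{\overline1}\cdots M_{\overline n}\,R_{n-1}\cdots R_2R_1\big)$;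 equivalently $M^{\overline{n+1}}=M\cdot\phi(M^{\overline n})$ with $\phi(N)_1:=\mathrm{Tr}_{R(2)}(F_{12}N_1F_{12}^{-1}R_{12})$. Elements of $\mathcal C(R,F)$ multiply matrices entrywise from the right. $[x]$ is the integer part. *)

theory Defs
  imports
    "HOL-Analysis.Analysis"
    "HOL-Computational_Algebra.Polynomial"
    "HOL-Library.Poly_Mapping"
begin

section \<open>Free associative algebras over the complex numbers\<close>

text \<open>
  Lists carry no additive monoid structure in the library, so the free monoid gets its own type;
  its monoid operation (concatenation) is written additively because the library's convolution
  product on finitely supported functions requires that.
\<close>

datatype 'g word = Word (letters: "'g list")

instantiation word :: (type) monoid_add
begin

definition zero_word :: "'a word" where
  "zero_word = Word []"

definition plus_word :: "'a word \<Rightarrow> 'a word \<Rightarrow> 'a word" where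
  "plus_word u v = Word (letters u @ letters v)"

instance
  by standard (simp_all add: zero_word_def plus_word_def)

end

text \<open>The free unital algebra on the letters \<open>'g\<close>, with its (noncommutative) library product.\<close>

type_synonym 'g free_alg = "'g word \<Rightarrow>\<^sub>0 complex"

definition scalar :: "complex \<Rightarrow> 'g free_alg" where
  "scalar c = Poly_Mapping.single 0 c"

definition gen :: "'g \<Rightarrow> 'g free_alg" where
  "gen x = Poly_Mapping.single (Word [x]) 1"

inductive_set two_sided_ideal :: "'a::ring_1 set \<Rightarrow> 'a set" for S :: "'a set" where
  zero: "0 \<in> two_sided_ideal S"
| generator: "s \<in> S \<Longrightarrow> a * s * b \<in> two_sided_ideal S"
| add: "x \<in> two_sided_ideal S \<Longrightarrow> y \<in> two_sided_ideal S \<Longrightarrow> x + y \<in> two_sided_ideal S"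


section \<open>Operators on tensor powers\<close>

text \<open>
  The basis of \<open>V\<close> is indexed by the finite type \<open>'n\<close>, that of the \<open>n\<close>-th tensor power by the lists
  over \<open>'n\<close> of length \<open>n\<close>. An operator on the \<open>n\<close>-th tensor power, possibly with entries in a
  noncommutative algebra \<open>'a\<close>, is given by its matrix (row index first); only its entries at lists
  of length \<open>n\<close> are meaningful. As on paper, tensor factors are numbered from 1.
\<close>

type_synonym ('n, 'a) op = "'n list \<Rightarrow> 'n list \<Rightarrow> 'a"

definition basis_words :: "nat \<Rightarrow> 'n list set" where
  "basis_words n = {u. length u = n}"

definition op_eq :: "nat \<Rightarrow> ('n, 'a) op \<Rightarrow> ('n, 'a) op \<Rightarrow> bool" where
  "op_eq n A B \<longleftrightarrow> (\<forall>u\<in>basis_words n. \<forall>v\<in>basis_words n. A u v = B u v)"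

definition op_zero :: "('n, 'a::zero) op" where
  "op_zero u v = 0"

definition op_id :: "('n, 'a::zero_neq_one) op" where
  "op_id u v = (if u = v then 1 else 0)"

definition op_mult :: "nat \<Rightarrow> ('n, 'a::semiring_0) op \<Rightarrow> ('n, 'a) op \<Rightarrow> ('n, 'a) op" where
  "op_mult n A B u v = (\<Sum>w\<in>basis_words n. A u w * B w v)"

definition op_prod :: "nat \<Rightarrow> ('n, 'a::semiring_1) op list \<Rightarrow> ('n, 'a) op" where
  "op_prod n As = foldr (op_mult n) As op_id"

definition scalar_op :: "('n, complex) op \<Rightarrow> ('n, 'g free_alg) op" where
  "scalar_op A u v = scalar (A u v)"

text \<open>\<open>at1 Y m\<close> is \<open>Y\<^sub>m\<close> and \<open>at2 X m r\<close> is \<open>X\<^sub>m\<^sub>r\<close>.\<close>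

definition at1 :: "'a::zero^'n::finite^'n \<Rightarrow> nat \<Rightarrow> ('n, 'a) op" where
  "at1 Y m u v =
     (if \<forall>i<length u. i \<noteq> m - 1 \<longrightarrow> u ! i = v ! i
      then Y $ (u ! (m - 1)) $ (v ! (m - 1)) else 0)"

definition at2 :: "'a::zero^('n::finite \<times> 'n)^('n \<times> 'n) \<Rightarrow> nat \<Rightarrow> nat \<Rightarrow> ('n, 'a) op" where
  "at2 X m r u v =
     (if \<forall>i<length u. i \<noteq> m - 1 \<and> i \<noteq> r - 1 \<longrightarrow> u ! i = v ! i
      then X $ (u ! (m - 1), u ! (r - 1)) $ (v ! (m - 1), v ! (r - 1)) else 0)"

definition flip :: "complex^('n::finite \<times> 'n)^('n \<times> 'n)" where
  "flip = (\<chi> s t. if fst s = snd t \<and> snd s = fst t then 1 else 0)"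

text \<open>
  Trace over the \<open>i\<close>-th factor. The remaining factors are renumbered consecutively, so the trace
  over the factors \<open>i, \<dots>, i + s - 1\<close> is the \<open>s\<close>-fold iterate of \<open>ptrace i\<close>.
\<close>

definition insert_at :: "nat \<Rightarrow> 'n \<Rightarrow> 'n list \<Rightarrow> 'n list" where
  "insert_at i c u = take (i - 1) u @ c # drop (i - 1) u"

definition ptrace :: "nat \<Rightarrow> ('n::finite, 'a::comm_monoid_add) op \<Rightarrow> ('n, 'a) op" where
  "ptrace i X u v = (\<Sum>c\<in>UNIV. X (insert_at i c u) (insert_at i c v))"


section \<open>R-matrices\<close>

text \<open>
  After the trace over the second of three factors, the factors 1 and 3 are numbered 1 and 2;
  hence \<open>P\<^sub>1\<^sub>3\<close> appears as \<open>at2 flip 1 2\<close>.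
\<close>

definition is_skew_inverse ::
  "complex^('n::finite \<times> 'n)^('n \<times> 'n) \<Rightarrow> complex^('n \<times> 'n)^('n \<times> 'n) \<Rightarrow> bool" where
  "is_skew_inverse X \<Psi> \<longleftrightarrow>
     op_eq 2 (ptrace 2 (op_mult 3 (at2 X 1 2) (at2 \<Psi> 2 3))) (at2 flip 1 2) \<and>
     op_eq 2 (ptrace 2 (op_mult 3 (at2 \<Psi> 1 2) (at2 X 2 3))) (at2 flip 1 2)"

definition skew_invertible :: "complex^('n::finite \<times> 'n)^('n \<times> 'n) \<Rightarrow> bool" where
  "skew_invertible X \<longleftrightarrow> (\<exists>\<Psi>. is_skew_inverse X \<Psi>)"

text \<open>A skew inverse is unique if it exists.\<close>

definition skew_inv ::
  "complex^('n::finite \<times> 'n)^('n \<times> 'n) \<Rightarrow> complex^('n \<times> 'n)^('n \<times> 'n)" where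
  "skew_inv X = (SOME \<Psi>. is_skew_inverse X \<Psi>)"

definition C_mat :: "complex^('n::finite \<times> 'n)^('n \<times> 'n) \<Rightarrow> complex^'n^'n" where
  "C_mat X = (\<chi> a b. ptrace 1 (at2 (skew_inv X) 1 2) [a] [b])"

definition D_mat :: "complex^('n::finite \<times> 'n)^('n \<times> 'n) \<Rightarrow> complex^'n^'n" where
  "D_mat X = (\<chi> a b. ptrace 2 (at2 (skew_inv X) 1 2) [a] [b])"

definition strict_skew_invertible :: "complex^('n::finite \<times> 'n)^('n \<times> 'n) \<Rightarrow> bool" where
  "strict_skew_invertible X \<longleftrightarrow>
     skew_invertible X \<and> (invertible (C_mat X) \<or> invertible (D_mat X))"

definition R_matrix :: "complex^('n::finite \<times> 'n)^('n \<times> 'n) \<Rightarrow> bool" where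
  "R_matrix R \<longleftrightarrow> invertible R \<and>
     op_eq 3 (op_prod 3 [at2 R 1 2, at2 R 2 3, at2 R 1 2])
             (op_prod 3 [at2 R 2 3, at2 R 1 2, at2 R 2 3])"

definition compatible_pair ::
  "complex^('n::finite \<times> 'n)^('n \<times> 'n) \<Rightarrow> complex^('n \<times> 'n)^('n \<times> 'n) \<Rightarrow> bool" where
  "compatible_pair R F \<longleftrightarrow>
     op_eq 3 (op_prod 3 [at2 R 1 2, at2 F 2 3, at2 F 1 2])
             (op_prod 3 [at2 F 2 3, at2 F 1 2, at2 R 2 3]) \<and>
     op_eq 3 (op_prod 3 [at2 R 2 3, at2 F 1 2, at2 F 2 3])
             (op_prod 3 [at2 F 1 2, at2 F 2 3, at2 R 1 2])"

text \<open>
  \<open>Rtrace R n i s X\<close> is the R-trace of an operator \<open>X\<close> on the \<open>n\<close>-th tensor power over the spaces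
  \<open>i, \<dots>, i + s - 1\<close>.
\<close>

definition Rtrace :: "complex^('n::finite \<times> 'n)^('n \<times> 'n) \<Rightarrow> nat \<Rightarrow> nat \<Rightarrow> nat \<Rightarrow>
    ('n, 'g free_alg) op \<Rightarrow> ('n, 'g free_alg) op" where
  "Rtrace R n i s X =
     (ptrace i ^^ s) (op_prod n (map (\<lambda>j. scalar_op (at1 (D_mat R) j)) [i..<i + s] @ [X]))"


section \<open>Braid group algebras and antisymmetrizers\<close>

text \<open>
  An element of the group algebra of the braid group on \<open>n\<close> strands is represented by a
  noncommutative polynomial in the letters \<open>\<sigma>\<^sub>i\<close> and their inverses, \<open>0 < i < n\<close>. For an R-matrix
  \<open>R\<close> the operator \<open>rho R n \<alpha>\<close> depends only on the represented element.
\<close>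

datatype braid_letter = Sigma nat | Sigma_inv nat

type_synonym braid_alg = "braid_letter free_alg"

fun shift_letter :: "nat \<Rightarrow> braid_letter \<Rightarrow> braid_letter" where
  "shift_letter m (Sigma i) = Sigma (i + m)"
| "shift_letter m (Sigma_inv i) = Sigma_inv (i + m)"

definition braid_shift :: "nat \<Rightarrow> braid_alg \<Rightarrow> braid_alg" where
  "braid_shift m \<alpha> =
     (\<Sum>w\<in>Poly_Mapping.keys \<alpha>.
        Poly_Mapping.single (Word (map (shift_letter m) (letters w))) (Poly_Mapping.lookup \<alpha> w))"

fun rho_letter ::
  "complex^('n::finite \<times> 'n)^('n \<times> 'n) \<Rightarrow> braid_letter \<Rightarrow> ('n, complex) op" where
  "rho_letter R (Sigma i) = at2 R i (i + 1)"
| "rho_letter R (Sigma_inv i) = at2 (matrix_inv R) i (i + 1)"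

definition rho ::
  "complex^('n::finite \<times> 'n)^('n \<times> 'n) \<Rightarrow> nat \<Rightarrow> braid_alg \<Rightarrow> ('n, complex) op" where
  "rho R n \<alpha> u v =
     (\<Sum>w\<in>Poly_Mapping.keys \<alpha>.
        Poly_Mapping.lookup \<alpha> w * op_prod n (map (rho_letter R) (letters w)) u v)"

definition qnum :: "complex \<Rightarrow> nat \<Rightarrow> complex" where
  "qnum q i = (q ^ i - inverse q ^ i) / (q - inverse q)"

definition sigma :: "nat \<Rightarrow> braid_alg" where
  "sigma i = gen (Sigma i)"

definition kappa :: "complex \<Rightarrow> complex \<Rightarrow> nat \<Rightarrow> braid_alg" where
  "kappa q \<mu> i =
     scalar (1 / (\<mu> * (q - inverse q))) * ((scalar q - sigma i) * (scalar (inverse q) + sigma i))"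

definition sigma_minus :: "complex \<Rightarrow> complex \<Rightarrow> nat \<Rightarrow> complex \<Rightarrow> braid_alg" where
  "sigma_minus q \<mu> i x =
     1 + scalar ((x - 1) / (q - inverse q)) * sigma i
       + scalar ((x - 1) / (q * inverse \<mu> * x + 1)) * kappa q \<mu> i"

text \<open>The value of \<open>antisym\<close> at 0 has no counterpart on paper.\<close>

fun antisym :: "complex \<Rightarrow> complex \<Rightarrow> nat \<Rightarrow> braid_alg" where
  "antisym q \<mu> 0 = 1"
| "antisym q \<mu> (Suc 0) = 1"
| "antisym q \<mu> (Suc (Suc j)) =
     (let i = Suc j in
      scalar (q ^ i / qnum q (i + 1)) *
        (antisym q \<mu> i * sigma_minus q \<mu> i (q powi (- 2 * int i)) * antisym q \<mu> i))"


section \<open>R-matrices of BMW-type and of symplectic type\<close>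

definition poly_mat :: "complex poly \<Rightarrow> complex^'m^'m \<Rightarrow> complex^'m::finite^'m" where
  "poly_mat p A = (\<Sum>i\<le>degree p. mat (coeff p i) ** ((\<lambda>B. A ** B) ^^ i) (mat 1))"

text \<open>A minimal polynomial, not required to be monic.\<close>

definition is_minimal_poly :: "complex poly \<Rightarrow> complex^'m::finite^'m \<Rightarrow> bool" where
  "is_minimal_poly p A \<longleftrightarrow>
     p \<noteq> 0 \<and> poly_mat p A = 0 \<and> (\<forall>r. r \<noteq> 0 \<and> poly_mat r A = 0 \<longrightarrow> degree p \<le> degree r)"

definition K_mat :: "complex \<Rightarrow> complex \<Rightarrow> complex^('n::finite \<times> 'n)^('n \<times> 'n) \<Rightarrow>
    complex^('n \<times> 'n)^('n \<times> 'n)" where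
  "K_mat q \<mu> R =
     mat (inverse \<mu> * inverse (q - inverse q)) ** ((mat q - R) ** (mat (inverse q) + R))"

definition BMW_type ::
  "complex \<Rightarrow> complex \<Rightarrow> complex^('n::finite \<times> 'n)^('n \<times> 'n) \<Rightarrow> bool" where
  "BMW_type q \<mu> R \<longleftrightarrow>
     q \<notin> {0, 1, -1} \<and> \<mu> \<notin> {0, q, - inverse q} \<and> R_matrix R \<and>
     is_minimal_poly ([:q, -1:] * [:inverse q, 1:] * [:\<mu>, -1:]) R \<and>
     (let K = K_mat q \<mu> R; R' = matrix_inv R in
       op_eq 3 (op_prod 3 [at2 K 2 3, at2 K 1 2])
               (op_prod 3 [at2 R 1 2, at2 R 2 3, at2 K 1 2]) \<and>
       op_eq 3 (op_prod 3 [at2 K 2 3, at2 K 1 2])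
               (op_prod 3 [at2 R' 1 2, at2 R' 2 3, at2 K 1 2]) \<and>
       op_eq 3 (op_prod 3 [at2 K 1 2, at2 K 2 3, at2 K 1 2]) (at2 K 1 2))"

definition Sp_type ::
  "complex \<Rightarrow> complex \<Rightarrow> nat \<Rightarrow> complex^('n::finite \<times> 'n)^('n \<times> 'n) \<Rightarrow> bool" where
  "Sp_type q \<mu> k R \<longleftrightarrow>
     BMW_type q \<mu> R \<and> skew_invertible R \<and> k \<ge> 2 \<and>
     (\<forall>i\<in>{2..k}. qnum q i \<noteq> 0) \<and>
     \<mu> = - (q powi (- 1 - 2 * int k)) \<and>
     (\<forall>i\<in>{2..k}. \<not> op_eq i (rho R i (antisym q \<mu> i)) op_zero) \<and>
     op_eq (k + 1)
       (rho R (k + 1)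
         (braid_shift 1 (antisym q \<mu> k) * sigma_minus q \<mu> 1 (q powi (- 2 * int k))
            * braid_shift 1 (antisym q \<mu> k)))
       op_zero"


section \<open>The quantum matrix algebra\<close>

text \<open>
  The algebra is the quotient of the free algebra on the letters \<open>(a, b)\<close>, standing for the entries
  of \<open>M\<close> in row \<open>a\<close> and column \<open>b\<close>, by the two-sided ideal of the defining relations. Its elements
  are represented in the free algebra, and \<open>qma_eq R F\<close> is equality in the quotient.
\<close>

type_synonym 'n qma_free = "('n \<times> 'n) free_alg"

definition gen_mat :: "'n qma_free^'n^'n" where
  "gen_mat = (\<chi> a b. gen (a, b))"

text \<open>\<open>Mbar F n i\<close> is the copy of \<open>M\<close> with barred index \<open>i \<ge> 1\<close>, acting on the \<open>n\<close>-th tensor power.\<close>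

fun Mbar ::
  "complex^('n::finite \<times> 'n)^('n \<times> 'n) \<Rightarrow> nat \<Rightarrow> nat \<Rightarrow> ('n, 'n qma_free) op" where
  "Mbar F n 0 = op_zero"
| "Mbar F n (Suc 0) = at1 gen_mat 1"
| "Mbar F n (Suc (Suc i)) =
     op_prod n [scalar_op (at2 F (Suc i) (Suc (Suc i))), Mbar F n (Suc i),
                scalar_op (at2 (matrix_inv F) (Suc i) (Suc (Suc i)))]"

definition qma_relations ::
  "complex^('n::finite \<times> 'n)^('n \<times> 'n) \<Rightarrow> complex^('n \<times> 'n)^('n \<times> 'n) \<Rightarrow> 'n qma_free set" where
  "qma_relations R F =
     {op_prod 2 [scalar_op (at2 R 1 2), Mbar F 2 1, Mbar F 2 2] u v
        - op_prod 2 [Mbar F 2 1, Mbar F 2 2, scalar_op (at2 R 1 2)] u v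
      | u v. u \<in> basis_words 2 \<and> v \<in> basis_words 2}"

definition qma_eq ::
  "complex^('n::finite \<times> 'n)^('n \<times> 'n) \<Rightarrow> complex^('n \<times> 'n)^('n \<times> 'n) \<Rightarrow>
    'n qma_free \<Rightarrow> 'n qma_free \<Rightarrow> bool" where
  "qma_eq R F x y \<longleftrightarrow> x - y \<in> two_sided_ideal (qma_relations R F)"

text \<open>\<open>ch R F n \<alpha>\<close>, for \<open>\<alpha>\<close> in the group algebra of the braid group on \<open>n\<close> strands.\<close>

definition ch :: "complex^('n::finite \<times> 'n)^('n \<times> 'n) \<Rightarrow> complex^('n \<times> 'n)^('n \<times> 'n) \<Rightarrow>
    nat \<Rightarrow> braid_alg \<Rightarrow> 'n qma_free" where
  "ch R F n \<alpha> =
     Rtrace R n 1 n (op_prod n (map (Mbar F n) [1..<n + 1] @ [scalar_op (rho R n \<alpha>)])) [] []"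

definition a_elem :: "complex^('n::finite \<times> 'n)^('n \<times> 'n) \<Rightarrow> complex^('n \<times> 'n)^('n \<times> 'n) \<Rightarrow>
    complex \<Rightarrow> complex \<Rightarrow> nat \<Rightarrow> 'n qma_free" where
  "a_elem R F q \<mu> i = (if i = 0 then 1 else ch R F i (antisym q \<mu> i))"

definition BMW_eta :: "complex \<Rightarrow> complex \<Rightarrow> complex" where
  "BMW_eta q \<mu> = (q - \<mu>) * (inverse q + \<mu>) / (\<mu> * (q - inverse q))"

definition contraction :: "complex^('n::finite \<times> 'n)^('n \<times> 'n) \<Rightarrow> complex^('n \<times> 'n)^('n \<times> 'n) \<Rightarrow>
    complex \<Rightarrow> complex \<Rightarrow> 'n qma_free" where
  "contraction R F q \<mu> = scalar (inverse (BMW_eta q \<mu>)) * ch R F 2 (kappa q \<mu> 1)"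

text \<open>The general formula gives \<open>M\<close> itself for exponent 1, where the trace and the braid are empty.\<close>

definition M_power :: "complex^('n::finite \<times> 'n)^('n \<times> 'n) \<Rightarrow> complex^('n \<times> 'n)^('n \<times> 'n) \<Rightarrow>
    nat \<Rightarrow> 'n qma_free^'n^'n" where
  "M_power R F n =
     (if n = 0 then mat 1
      else \<chi> a b.
        Rtrace R n 2 (n - 1)
          (op_prod n (map (Mbar F n) [1..<n + 1]
                      @ map (\<lambda>i. scalar_op (at2 R i (i + 1))) (rev [1..<n]))) [a] [b])"

text \<open>The coefficients \<open>\<epsilon>\<^sub>i\<close> for \<open>0 \<le> i \<le> 2k\<close>.\<close>

definition eps_low :: "complex^('n::finite \<times> 'n)^('n \<times> 'n) \<Rightarrow> complex^('n \<times> 'n)^('n \<times> 'n) \<Rightarrow>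
    complex \<Rightarrow> complex \<Rightarrow> nat \<Rightarrow> 'n qma_free" where
  "eps_low R F q \<mu> i =
     (if i = 0 then 1
      else \<Sum>j\<le>i div 2. a_elem R F q \<mu> (i - 2 * j) * contraction R F q \<mu> ^ j)"

definition eps :: "complex^('n::finite \<times> 'n)^('n \<times> 'n) \<Rightarrow> complex^('n \<times> 'n)^('n \<times> 'n) \<Rightarrow>
    complex \<Rightarrow> complex \<Rightarrow> nat \<Rightarrow> nat \<Rightarrow> 'n qma_free" where
  "eps R F q \<mu> k i =
     (if i \<le> k then eps_low R F q \<mu> i
      else eps_low R F q \<mu> (2 * k - i) * contraction R F q \<mu> ^ (i - k))"

end

theory Submission
  imports Defs
begin

text \<open>
  Let \<open>A(m, i)\<close> and \<open>B(m, i)\<close> be the R-traces over all strands but the first of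
  \<open>M\<^sub>1 \<dots> M\<^sub>n a\<^sup>(\<^sup>i\<^sup>) \<sigma>\<^sub>m \<dots> \<sigma>\<^sub>1\<close>, without and with an additional \<open>\<kappa>\<close> linking the antisymmetrizer on
  the last \<open>i\<close> strands to the braid, scaled by \<open>i\<^sub>q\<close>. The recursive definition of the
  antisymmetrizers (an anti-eigenvector of every \<open>\<sigma>\<^sub>j\<close>, by fusion) expresses \<open>A(m, i + 1)\<close> through the
  product of the power \<open>m + 1\<close> of \<open>M\<close> with \<open>a\<^sub>i\<close> and through \<open>A(m + 1, i)\<close> and \<open>B(m, i)\<close>. Moving a pair of
  strands joined by \<open>\<kappa>\<close> past the remaining ones turns two copies of \<open>M\<close> into the 2-contraction \<open>g\<close>, which
  gives a companion recursion for \<open>B(m + 1, i + 1)\<close>. In type \<open>Sp(2k)\<close> the left-hand side of the first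
  recursion vanishes for \<open>i = k\<close>; eliminating \<open>A\<close> and \<open>B\<close> downwards from there leaves the identity.

  These steps only use relations between generators, so they are carried out in an abstract algebra.
  The hypotheses on the R-trace are consequences of skew invertibility; the existence of \<open>g\<close> with
  \<open>M\<^sub>1 M\<^sub>2 K = \<mu>\<^sup>-\<^sup>2 K g\<close> follows because \<open>K\<close> has rank one, and \<open>K\<close> has rank one because
  contracting \<open>K\<^sub>1 = \<mu> K\<^sub>1 R\<^sub>2 K\<^sub>1\<close> with the skew inverse yields the invertible matrix \<open>C\<^sub>R\<close>.
\<close>

section \<open>Antisymmetrizers in BMW algebras\<close>

text \<open>The entries of \<open>M\<close> do not commute. Hence a trace is not cyclic in general,
  and operators on disjoint strands need not commute; both hold only when one of the two operators
  is numerical, that is, built from \<open>R\<close>, \<open>F\<close> and \<open>D\<close>. Every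
  manipulation below moves numerical operators only, and the other factors keep the order: power of
  \<open>M\<close>, then \<open>ach i\<close>, then powers of \<open>g\<close>. The value
  \<open>\<mu> = - inverse q ^ (2 * k + 1)\<close> enters the elimination in two places. The
  denominators \<open>q * inverse \<mu> * xq i + 1\<close> become 1 minus a power of
  \<open>q * q\<close>, and the factor \<open>inverse \<mu> * inverse q ^ i\<close> in the companion
  recursion becomes minus a power of \<open>q\<close>. With these values the elimination has closed
  coefficients (\<open>al\<close>, \<open>bp\<close>), and the rational functions of
  \<open>q\<close> add up to a plain power in front of each product of \<open>pw\<close>,
  \<open>ach\<close> and powers of \<open>g\<close>. The 2-contraction first appears as the element
  that a rank-one \<open>K\<close> leaves behind when two copies of \<open>M\<close> are multiplied
  by it; it is identified with the normalized trace of \<open>\<kappa>\<close> only afterwards, by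
  closing the two strands.\<close>

class calgebra = ring_1 +
  fixes cs :: "complex \<Rightarrow> 'a \<Rightarrow> 'a" (infixr "*\<^sub>C" 75)
  assumes cs_add_right: "c *\<^sub>C (x + y) = c *\<^sub>C x + c *\<^sub>C y"
    and cs_add_left: "(c + d) *\<^sub>C x = c *\<^sub>C x + d *\<^sub>C x"
    and cs_cs [simp]: "c *\<^sub>C d *\<^sub>C x = (c * d) *\<^sub>C x"
    and cs_one [simp]: "1 *\<^sub>C x = x"
    and mult_cs_left [simp]: "(c *\<^sub>C x) * y = c *\<^sub>C (x * y)"
    and mult_cs_right [simp]: "x * (c *\<^sub>C y) = c *\<^sub>C (x * y)"

interpretation cs: module "cs :: complex \<Rightarrow> 'a \<Rightarrow> 'a::calgebra"
  by standard (simp_all add: cs_add_right cs_add_left)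

lemmas cs_zero_right [simp] = cs.scale_zero_right

lemma cs_cancel:
  fixes x y :: "'a::calgebra"
  assumes "c *\<^sub>C x = c *\<^sub>C y" "c \<noteq> 0"
  shows "x = y"
proof -
  have "inverse c *\<^sub>C c *\<^sub>C x = inverse c *\<^sub>C c *\<^sub>C y" using assms(1) by simp
  then show ?thesis using assms(2) by simp
qed

text \<open>\<open>K_eq\<close> is the linear form of the contractor, obtained from the factored
  quadratic expression by means of the cubic relation for \<open>R\<close>. In this form whatever
  intertwines \<open>R\<close> also intertwines \<open>K\<close>. The index runs over all of
  \<open>nat\<close>, so one algebra serves every number of strands.\<close>

locale bmw_algebra =
  fixes q \<mu> :: complex and R Ri K :: "nat \<Rightarrow> 'e::calgebra"
  assumes q0: "q \<noteq> 0" and q_sq: "q * q \<noteq> 1" and mu0: "\<mu> \<noteq> 0"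
    and R_Ri [simp]: "R i * Ri i = 1" and Ri_R [simp]: "Ri i * R i = 1"
    and braid_Suc: "R i * R (Suc i) * R i = R (Suc i) * R i * R (Suc i)"
    and R_far_less: "Suc i < j \<Longrightarrow> R i * R j = R j * R i"
    and K_eq: "K i = 1 - inverse (q - inverse q) *\<^sub>C (R i - Ri i)"
    and K_R: "K i * R i = \<mu> *\<^sub>C K i"
    and KK_Suc: "K (Suc i) * K i = R i * R (Suc i) * K i"
    and KK_Suc': "K (Suc i) * K i = Ri i * Ri (Suc i) * K i"
    and KKK_Suc: "K i * K (Suc i) * K i = K i"
begin

definition lam :: complex where "lam = q - inverse q"

lemma lam0: "lam \<noteq> 0"
  using q0 q_sq by (simp add: lam_def field_simps)

lemma K_lam: "K i = 1 - inverse lam *\<^sub>C (R i - Ri i)"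
  by (simp add: K_eq lam_def)

lemma R_Ri_left [simp]: "R i * (Ri i * x) = x" "Ri i * (R i * x) = x"
  by (simp_all flip: mult.assoc)

lemma R_cancel_left: "R i * x = R i * y \<Longrightarrow> x = y" "Ri i * x = Ri i * y \<Longrightarrow> x = y"
  by (metis R_Ri_left)+

text \<open>\<open>K\<close> is a linear combination of 1, \<open>R\<close> and its inverse, so an
  operator that carries \<open>R a\<close> to \<open>R b\<close> carries the other two along. Later
  shift and commutation rules can therefore be checked on \<open>R\<close> alone.\<close>

lemma intertwine:
  assumes "w * R a = R b * w"
  shows intertwine_Ri: "w * Ri a = Ri b * w" and intertwine_K: "w * K a = K b * w"
proof -
  have "R b * (w * Ri a) = (w * R a) * Ri a" by (simp add: assms mult.assoc)
  also have "\<dots> = R b * (Ri b * w)" by (simp add: mult.assoc)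
  finally show 1: "w * Ri a = Ri b * w" by (rule R_cancel_left)
  show "w * K a = K b * w" by (simp add: K_eq algebra_simps assms 1)
qed

lemma K_R_comm: "R i * K i = \<mu> *\<^sub>C K i"
  using intertwine_K[of "R i" i i] K_R by simp

lemma Ri_K: "Ri i * K i = inverse \<mu> *\<^sub>C K i" and K_Ri: "K i * Ri i = inverse \<mu> *\<^sub>C K i"
proof -
  show 1: "Ri i * K i = inverse \<mu> *\<^sub>C K i"
    by (rule R_cancel_left(1)[of i]) (simp add: K_R_comm mu0)
  show "K i * Ri i = inverse \<mu> *\<^sub>C K i"
    using intertwine_K[of "Ri i" i i] 1 by simp
qed

lemma Ri_eq: "Ri i = R i - lam *\<^sub>C 1 + lam *\<^sub>C K i"
  using lam0 by (simp add: K_lam cs.scale_right_diff_distrib)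

lemma R_sq: "R i * R i = 1 + lam *\<^sub>C R i - (lam * \<mu>) *\<^sub>C K i"
proof -
  have "R i * Ri i = R i * (R i - lam *\<^sub>C 1 + lam *\<^sub>C K i)" by (subst Ri_eq) simp
  then show ?thesis by (simp add: algebra_simps K_R_comm)
qed

definition adj :: "nat \<Rightarrow> nat \<Rightarrow> bool" where "adj a b \<longleftrightarrow> a = Suc b \<or> b = Suc a"

lemma braid: "adj a b \<Longrightarrow> R a * (R b * R a) = R b * (R a * R b)"
  using braid_Suc by (auto simp: adj_def mult.assoc)

lemma R_far: "Suc i < j \<or> Suc j < i \<Longrightarrow> R i * R j = R j * R i"
  using R_far_less by auto

lemma adj_K_conj:
  assumes "adj a b"
  shows "R a * (R b * K a) = K b * (R a * R b)" "Ri a * (Ri b * K a) = K b * (Ri a * Ri b)"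
proof -
  have adj': "adj b a" using assms by (auto simp: adj_def)
  show "R a * (R b * K a) = K b * (R a * R b)"
    using intertwine_K[of "R a * R b" a b] braid[OF assms] by (simp add: mult.assoc)
  have "R b * R a * K b = K a * (R b * R a)"
    using intertwine_K[of "R b * R a" b a] braid[OF adj'] by (simp add: mult.assoc)
  then have "Ri a * Ri b * (R b * R a * K b) * (Ri a * Ri b) = Ri a * Ri b * (K a * (R b * R a)) * (Ri a * Ri b)"
    by simp
  then show "Ri a * (Ri b * K a) = K b * (Ri a * Ri b)" by (simp add: mult.assoc)
qed

text \<open>The axioms treat only the order \<open>K (Suc i) * K i\<close>. The opposite order
  follows by inserting \<open>K i = K i * K (Suc i) * K i\<close> and applying the right-hand forms
  that \<open>adj_K_conj\<close> supplies; after that both neighbours play symmetric roles.\<close>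

lemma adj_KK:
  assumes "adj a b"
  shows KK_RRK: "K b * K a = R a * (R b * K a)" and KK_KRR: "K b * K a = K b * (R a * R b)"
    and KK_RiRiK: "K b * K a = Ri a * (Ri b * K a)" and KK_KRiRi: "K b * K a = K b * (Ri a * Ri b)"
    and KKK: "K a * (K b * K a) = K a"
proof -
  have up: "K (Suc i) * K i = R i * (R (Suc i) * K i)" "K (Suc i) * K i = Ri i * (Ri (Suc i) * K i)"
    "K i * (K (Suc i) * K i) = K i"
    "K (Suc i) * K i = K (Suc i) * (R i * R (Suc i))" "K (Suc i) * K i = K (Suc i) * (Ri i * Ri (Suc i))" for i
  proof -
    have adj: "adj i (Suc i)" by (simp add: adj_def)
    show 1: "K (Suc i) * K i = R i * (R (Suc i) * K i)" using KK_Suc[of i] by (simp only: mult.assoc)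
    show 2: "K (Suc i) * K i = Ri i * (Ri (Suc i) * K i)" using KK_Suc'[of i] by (simp only: mult.assoc)
    show "K i * (K (Suc i) * K i) = K i" using KKK_Suc[of i] by (simp only: mult.assoc)
    show "K (Suc i) * K i = K (Suc i) * (R i * R (Suc i))" using 1 adj_K_conj(1)[OF adj] by (rule trans)
    show "K (Suc i) * K i = K (Suc i) * (Ri i * Ri (Suc i))" using 2 adj_K_conj(2)[OF adj] by (rule trans)
  qed
  have down: "K i * K (Suc i) = K i * (R (Suc i) * R i)" "K i * K (Suc i) = K i * (Ri (Suc i) * Ri i)"
    "K (Suc i) * (K i * K (Suc i)) = K (Suc i)" for i
  proof -
    have "K i * (R (Suc i) * R i) = K i * (K (Suc i) * K i) * (R (Suc i) * R i)" using up(3)[of i] by simp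
    also have "\<dots> = K i * K (Suc i)" by (subst up(5)) (simp add: mult.assoc)
    finally show 1: "K i * K (Suc i) = K i * (R (Suc i) * R i)" by simp
    have "K i * (Ri (Suc i) * Ri i) = K i * (K (Suc i) * K i) * (Ri (Suc i) * Ri i)" using up(3)[of i] by simp
    also have "\<dots> = K i * K (Suc i)" by (subst up(4)) (simp add: mult.assoc)
    finally show "K i * K (Suc i) = K i * (Ri (Suc i) * Ri i)" by simp
    have "K (Suc i) * (K i * K (Suc i)) = (K (Suc i) * K i) * (R (Suc i) * R i)"
      by (simp add: 1 mult.assoc)
    also have "\<dots> = K (Suc i)" by (subst up(5)) (simp add: mult.assoc)
    finally show "K (Suc i) * (K i * K (Suc i)) = K (Suc i)" .
  qed
  consider i where "a = i" "b = Suc i" | i where "a = Suc i" "b = i" using assms by (auto simp: adj_def)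
  then have *: "K b * K a = K b * (R a * R b)" "K b * K a = K b * (Ri a * Ri b)" "K a * (K b * K a) = K a"
    using up down by (cases; blast)+
  show "K b * K a = R a * (R b * K a)" "K b * K a = Ri a * (Ri b * K a)"
    using * adj_K_conj[OF assms] by simp_all
  show "K b * K a = K b * (R a * R b)" "K b * K a = K b * (Ri a * Ri b)" "K a * (K b * K a) = K a"
    using * by blast+
qed

section \<open>Baxterized elements and fusion\<close>

definition Sm :: "nat \<Rightarrow> complex \<Rightarrow> 'e" where
  "Sm i x = 1 + ((x - 1) / lam) *\<^sub>C R i + ((x - 1) / (q * inverse \<mu> * x + 1)) *\<^sub>C K i"

lemma intertwine_Sm: "w * R a = R b * w \<Longrightarrow> w * Sm a x = Sm b x * w"
  by (simp add: Sm_def algebra_simps intertwine_K)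

text \<open>On the eigenvalue \<open>- inverse q\<close> the difference of \<open>R\<close> and its
  inverse acts as \<open>lam\<close>, so the two terms of \<open>K\<close> cancel.\<close>

lemma K_anti:
  assumes "R j * z = (- inverse q) *\<^sub>C z" shows "K j * z = 0"
proof -
  have "Ri j * z = Ri j * ((- q) *\<^sub>C (R j * z))" using assms q0 by simp
  then have "Ri j * z = (- q) *\<^sub>C z" by simp
  then have *: "K j * z = z - inverse lam *\<^sub>C (lam *\<^sub>C z)"
    by (simp add: K_lam algebra_simps assms lam_def del: cs_cs)
  show ?thesis using lam0 unfolding * by simp
qed

lemma K_anti_right:
  assumes "z * R j = (- inverse q) *\<^sub>C z" shows "z * K j = 0"
proof -
  have "z * Ri j = ((- q) *\<^sub>C (z * R j)) * Ri j" using assms q0 by simp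
  then have "z * Ri j = (- q) *\<^sub>C z" by (simp add: mult.assoc)
  then have *: "z * K j = z - inverse lam *\<^sub>C (lam *\<^sub>C z)"
    by (simp add: K_lam algebra_simps assms lam_def del: cs_cs)
  show ?thesis using lam0 unfolding * by simp
qed

text \<open>Each identity compares the coefficients of one vector in the expansion used for
  \<open>fusion_left\<close>, on the two sides of the eigenvector equation with eigenvalue
  \<open>t\<close>. The combination \<open>a' / t + b'\<close> appears because on \<open>P\<close>
  the product \<open>K s * R r\<close> is \<open>K s * K r\<close> divided by
  \<open>t\<close>.\<close>

lemma fusion_coeffs:
  fixes x :: complex
  defines "t \<equiv> - inverse q" and "y \<equiv> x / (q * q)"
  defines "a \<equiv> (x - 1) / lam" and "a' \<equiv> (y - 1) / lam"
    and "b \<equiv> (x - 1) / (q * inverse \<mu> * x + 1)" and "b' \<equiv> (y - 1) / (q * inverse \<mu> * y + 1)"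
  assumes "q * inverse \<mu> * x + 1 \<noteq> 0" "q * inverse \<mu> * y + 1 \<noteq> 0"
  shows "a' = t * (1 + a * t)" "(1 + a * t) + lam * a' = t * a'"
    "b * (a' / t + b') = t * (a * b')"
    "\<mu> * b' - lam * \<mu> * a' - lam * (b * (a' / t + b')) = t * b'"
    "a * b' + lam * (b * (a' / t + b')) = t * (b * (a' / t + b'))"
proof -
  have l: "lam = (q * q - 1) / q" using q0 by (simp add: lam_def field_simps)
  have q1: "q * q - 1 \<noteq> 0" using q_sq by simp
  have nx: "q * x + \<mu> \<noteq> 0" using assms(7) mu0 by (simp add: field_simps)
  have ny: "x + q * \<mu> \<noteq> 0" using assms(8) mu0 q0 by (simp add: y_def field_simps)
  have b: "b = (x - 1) * \<mu> / (q * x + \<mu>)" using mu0 nx assms(7) by (simp add: b_def field_simps)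
  have b': "b' = (x - q * q) * \<mu> / (q * (x + q * \<mu>))"
  proof -
    have "q * inverse \<mu> * y + 1 = (x + q * \<mu>) / (q * \<mu>)" "y - 1 = (x - q * q) / (q * q)"
      using mu0 q0 by (simp_all add: y_def field_simps)
    then show ?thesis unfolding b'_def using mu0 q0 ny by simp
  qed
  have a: "a = (x - 1) * q / (q * q - 1)" unfolding a_def l using q0 q1 by (simp add: field_simps)
  have a': "a' = (x - q * q) / (q * (q * q - 1))"
    unfolding a'_def l y_def using q0 q1 by (simp add: divide_simps)
  have qt: "q * t = -1" using q0 by (simp add: t_def)
  have la: "lam * a = x - 1" "lam * a' = y - 1" using lam0 by (simp_all add: a_def a'_def)
  have tl: "t * lam = t * t - 1" using q0 by (simp add: lam_def t_def algebra_simps)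
  have y: "y = x * (t * t)" by (simp add: y_def t_def divide_inverse)
  have "lam * (t * (1 + a * t)) = t * lam + (lam * a) * (t * t)" by (simp only: distrib_left mult_ac mult_1_right mult_1_left)
  also have "\<dots> = lam * a'" unfolding la tl y by (simp add: algebra_simps)
  finally show 1: "a' = t * (1 + a * t)" using lam0 by simp
  have "lam * ((1 + a * t) + lam * a') = lam + (lam * a) * t + lam * (lam * a')" by (simp only: distrib_left mult_ac mult_1_right mult_1_left)
  also have "\<dots> = t * (lam * a') + ((lam - t) * y + x * t)" unfolding la by (simp add: algebra_simps)
  also have "(lam - t) * y + x * t = x * t * (1 + q * t)" by (simp add: y t_def lam_def algebra_simps)
  finally have "lam * ((1 + a * t) + lam * a') = lam * (t * a')" by (simp add: qt mult_ac)
  then show 2: "(1 + a * t) + lam * a' = t * a'" using lam0 by simp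
  have 0: "a' / t = - (x - q * q) / (q * q - 1)" unfolding a' t_def using q0 q1 by (simp add: field_simps)
  have 00: "a' / t + b' = - (x - q * q) * (q * x + \<mu>) / (q * (q * q - 1) * (x + q * \<mu>))"
    unfolding 0 b' using q0 q1 ny by (simp add: divide_simps) (simp add: algebra_simps)
  show 3: "b * (a' / t + b') = t * (a * b')"
    unfolding 00 unfolding a b b' t_def using q0 q1 nx ny by (simp add: divide_simps) (simp add: algebra_simps)
  show 4: "\<mu> * b' - lam * \<mu> * a' - lam * (b * (a' / t + b')) = t * b'"
    unfolding 3 unfolding a a' b' t_def l using q0 q1 ny by (simp add: divide_simps) (simp add: algebra_simps)
  have 5: "lam - t = q" by (simp add: lam_def t_def)
  have "a * b' + lam * (t * (a * b')) - t * (t * (a * b')) = a * b' * (1 + t * (lam - t))"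
    by (simp add: algebra_simps)
  also have "\<dots> = 0" unfolding 5 using q0 by (simp add: t_def)
  finally show "a * b' + lam * (b * (a' / t + b')) = t * (b * (a' / t + b'))" unfolding 3 by simp
qed

lemma comb_eqI:
  fixes v1 v2 v3 v4 v5 v6 :: 'e
  assumes "c1 = d1" "c2 = d2" "c3 = d3" "c4 = d4" "c5 = d5" "c6 = d6"
  shows "c1 *\<^sub>C v1 + c2 *\<^sub>C v2 + c3 *\<^sub>C v3 + c4 *\<^sub>C v4 + c5 *\<^sub>C v5 + c6 *\<^sub>C v6
    = d1 *\<^sub>C v1 + d2 *\<^sub>C v2 + d3 *\<^sub>C v3 + d4 *\<^sub>C v4 + d5 *\<^sub>C v5 + d6 *\<^sub>C v6"
  using assms by simp

text \<open>The six vectors in the expansion of \<open>X\<close> below span a space that is stable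
  under \<open>R r\<close>: the braid and tangle relations reduce every further product. The claim
  thus becomes a comparison of coefficients, which succeeds because the two parameters have ratio
  \<open>q * q\<close>.\<close>

lemma fusion_left:
  assumes adj: "adj r s" and P: "R s * P = (- inverse q) *\<^sub>C P"
    and nz: "q * inverse \<mu> * x + 1 \<noteq> 0" "q * inverse \<mu> * (x / (q * q)) + 1 \<noteq> 0"
  shows "R r * (Sm s x * (Sm r (x / (q * q)) * P)) = (- inverse q) *\<^sub>C (Sm s x * (Sm r (x / (q * q)) * P))"
proof -
  define t where "t = - inverse q"
  define a where "a = (x - 1) / lam"
  define a' where "a' = (x / (q * q) - 1) / lam"
  define b where "b = (x - 1) / (q * inverse \<mu> * x + 1)"
  define b' where "b' = (x / (q * q) - 1) / (q * inverse \<mu> * (x / (q * q)) + 1)"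
  define w where "w = a' / t + b'"
  note co = fusion_coeffs[OF nz, folded t_def a_def a'_def b_def b'_def, folded w_def]
  have t0: "t \<noteq> 0" using q0 by (simp add: t_def)
  have adj': "adj s r" using adj by (auto simp: adj_def)
  have P1: "R s * P = t *\<^sub>C P" using P by (simp add: t_def)
  have P2: "K s * P = 0" using K_anti[OF P] .
  have e1: "R r * (R r * P) = P + lam *\<^sub>C (R r * P) - (lam * \<mu>) *\<^sub>C (K r * P)"
    using arg_cong[OF R_sq[of r], of "\<lambda>z. z * P"] by (simp add: distrib_right left_diff_distrib mult.assoc)
  have e2: "R r * (K r * P) = \<mu> *\<^sub>C (K r * P)" by (simp add: K_R_comm flip: mult.assoc)
  have e3: "R r * (R s * (R r * P)) = t *\<^sub>C (R s * (R r * P))"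
    using arg_cong[OF braid[OF adj], of "\<lambda>z. z * P"] by (simp add: mult.assoc P1)
  have e4: "R r * (R s * (K r * P)) = K s * (K r * P)"
    using arg_cong[OF KK_RRK[OF adj], of "\<lambda>z. z * P"] by (simp add: mult.assoc)
  have "K s * (K r * P) = t *\<^sub>C (K s * (R r * P))"
    using arg_cong[OF KK_KRR[OF adj], of "\<lambda>z. z * P"] by (simp add: mult.assoc P1)
  then have e5: "K s * (R r * P) = inverse t *\<^sub>C (K s * (K r * P))" using t0 by simp
  have "R r * (K s * (K r * P)) = Ri s * (K r * P)"
    using arg_cong[OF KK_RiRiK[OF adj], of "\<lambda>z. R r * (z * P)"] by (simp add: mult.assoc)
  then have e6: "R r * (K s * (K r * P)) = R s * (K r * P) - lam *\<^sub>C (K r * P) + lam *\<^sub>C (K s * (K r * P))"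
    by (simp add: Ri_eq[of s] algebra_simps)
  define X where "X = Sm s x * (Sm r (x / (q * q)) * P)"
  have X: "X = (1 + a * t) *\<^sub>C P + a' *\<^sub>C (R r * P) + (a * a') *\<^sub>C (R s * (R r * P))
      + b' *\<^sub>C (K r * P) + (b * w) *\<^sub>C (K s * (K r * P)) + (a * b') *\<^sub>C (R s * (K r * P))"
    unfolding X_def Sm_def a_def[symmetric] b_def[symmetric] a'_def[symmetric] b'_def[symmetric]
    by (simp add: distrib_left distrib_right P1 P2 e5 cs_add_left cs_add_right divide_inverse w_def)
      (simp add: algebra_simps)
  have RX: "R r * X = a' *\<^sub>C P + ((1 + a * t) + lam * a') *\<^sub>C (R r * P) + (a * a' * t) *\<^sub>C (R s * (R r * P))
      + (\<mu> * b' - lam * \<mu> * a' - lam * (b * w)) *\<^sub>C (K r * P)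
      + (a * b' + lam * (b * w)) *\<^sub>C (K s * (K r * P)) + (b * w) *\<^sub>C (R s * (K r * P))"
    unfolding X by (simp add: distrib_left e1 e2 e3 e4 e6)
      (simp add: cs_add_left cs_add_right cs.scale_left_diff_distrib cs.scale_right_diff_distrib mult_ac add_ac)
  have tX: "t *\<^sub>C X = (t * (1 + a * t)) *\<^sub>C P + (t * a') *\<^sub>C (R r * P) + (t * (a * a')) *\<^sub>C (R s * (R r * P))
      + (t * b') *\<^sub>C (K r * P) + (t * (b * w)) *\<^sub>C (K s * (K r * P)) + (t * (a * b')) *\<^sub>C (R s * (K r * P))"
    unfolding X by (simp add: cs_add_right)
  have "R r * X = t *\<^sub>C X" unfolding RX tX by (rule comb_eqI) (use co in \<open>auto simp: mult_ac\<close>)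
  then show ?thesis by (simp add: X_def t_def)
qed

text \<open>Mirror image of \<open>fusion_left\<close>. An arbitrary algebra need not admit a
  reversal of products, so the computation is carried out again with \<open>P\<close> on the left;
  the coefficients are the same.\<close>

lemma fusion_right:
  assumes adj: "adj r s" and P: "P * R s = (- inverse q) *\<^sub>C P"
    and nz: "q * inverse \<mu> * x + 1 \<noteq> 0" "q * inverse \<mu> * (x / (q * q)) + 1 \<noteq> 0"
  shows "((P * Sm r (x / (q * q))) * Sm s x) * R r = (- inverse q) *\<^sub>C ((P * Sm r (x / (q * q))) * Sm s x)"
proof -
  define t where "t = - inverse q"
  define a where "a = (x - 1) / lam"
  define a' where "a' = (x / (q * q) - 1) / lam"
  define b where "b = (x - 1) / (q * inverse \<mu> * x + 1)"
  define b' where "b' = (x / (q * q) - 1) / (q * inverse \<mu> * (x / (q * q)) + 1)"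
  define w where "w = a' / t + b'"
  note co = fusion_coeffs[OF nz, folded t_def a_def a'_def b_def b'_def, folded w_def]
  have t0: "t \<noteq> 0" using q0 by (simp add: t_def)
  have adj': "adj s r" using adj by (auto simp: adj_def)
  have P1: "P * R s = t *\<^sub>C P" using P by (simp add: t_def)
  have P2: "P * K s = 0" using K_anti_right[OF P] .
  note P3 = arg_cong[OF P1, of "\<lambda>z. z * w" for w, simplified mult.assoc mult_cs_left]
  have e1: "P * (R r * R r) = P + lam *\<^sub>C (P * R r) - (lam * \<mu>) *\<^sub>C (P * K r)"
    using arg_cong[OF R_sq[of r], of "\<lambda>z. P * z"] by (simp add: distrib_left right_diff_distrib)
  have e2: "P * (K r * R r) = \<mu> *\<^sub>C (P * K r)" by (simp add: K_R)
  have e3: "P * (R r * (R s * R r)) = t *\<^sub>C (P * (R r * R s))"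
    using arg_cong[OF braid[OF adj], of "\<lambda>z. P * z"] by (simp add: P3)
  have e4: "P * (K r * (R s * R r)) = P * (K r * K s)" using KK_KRR[OF adj'] by simp
  have "P * (K r * K s) = t *\<^sub>C (P * (R r * K s))"
    using arg_cong[OF KK_RRK[OF adj'], of "\<lambda>z. P * z"] by (simp add: P3)
  then have e5: "P * (R r * K s) = inverse t *\<^sub>C (P * (K r * K s))" using t0 by simp
  have "K r * (K s * R r) = K r * Ri s"
    using arg_cong[OF KK_KRiRi[OF adj'], of "\<lambda>z. z * R r"] by (simp add: mult.assoc)
  then have e6: "P * (K r * (K s * R r)) = P * (K r * R s) - lam *\<^sub>C (P * K r) + lam *\<^sub>C (P * (K r * K s))"
    by (simp only: Ri_eq[of s] distrib_left right_diff_distrib mult_cs_right mult_1_right)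
  define X where "X = (P * Sm r (x / (q * q))) * Sm s x"
  have X: "X = (1 + a * t) *\<^sub>C P + a' *\<^sub>C (P * R r) + (a * a') *\<^sub>C (P * (R r * R s))
      + b' *\<^sub>C (P * K r) + (b * w) *\<^sub>C (P * (K r * K s)) + (a * b') *\<^sub>C (P * (K r * R s))"
    unfolding X_def Sm_def a_def[symmetric] b_def[symmetric] a'_def[symmetric] b'_def[symmetric]
    by (simp add: distrib_left distrib_right mult.assoc P1 P2 e5 cs_add_left cs_add_right divide_inverse w_def)
  have RX: "X * R r = a' *\<^sub>C P + ((1 + a * t) + lam * a') *\<^sub>C (P * R r) + (a * a' * t) *\<^sub>C (P * (R r * R s))
      + (\<mu> * b' - lam * \<mu> * a' - lam * (b * w)) *\<^sub>C (P * K r)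
      + (a * b' + lam * (b * w)) *\<^sub>C (P * (K r * K s)) + (b * w) *\<^sub>C (P * (K r * R s))"
    unfolding X by (simp add: distrib_right mult.assoc e1 e2 e3 e4 e6)
      (simp add: cs_add_left cs_add_right cs.scale_left_diff_distrib cs.scale_right_diff_distrib mult_ac add_ac)
  have tX: "t *\<^sub>C X = (t * (1 + a * t)) *\<^sub>C P + (t * a') *\<^sub>C (P * R r) + (t * (a * a')) *\<^sub>C (P * (R r * R s))
      + (t * b') *\<^sub>C (P * K r) + (t * (b * w)) *\<^sub>C (P * (K r * K s)) + (t * (a * b')) *\<^sub>C (P * (K r * R s))"
    unfolding X by (simp add: cs_add_right)
  have "X * R r = t *\<^sub>C X" unfolding RX tX by (rule comb_eqI) (use co in \<open>auto simp: mult_ac\<close>)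
  then show ?thesis by (simp add: X_def t_def)
qed

section \<open>Antisymmetrizers\<close>

definition anti :: "nat \<Rightarrow> nat \<Rightarrow> 'e \<Rightarrow> bool" where
  "anti m i z \<longleftrightarrow> (\<forall>j. m \<le> j \<and> Suc j < m + i \<longrightarrow> R j * z = (- inverse q) *\<^sub>C z)"

definition anti_right :: "nat \<Rightarrow> nat \<Rightarrow> 'e \<Rightarrow> bool" where
  "anti_right m i z \<longleftrightarrow> (\<forall>j. m \<le> j \<and> Suc j < m + i \<longrightarrow> z * R j = (- inverse q) *\<^sub>C z)"

definition xq :: "nat \<Rightarrow> complex" where "xq i = inverse q ^ (2 * i)"

lemma xq_Suc: "xq (Suc i) = xq i / (q * q)"
  by (simp add: xq_def divide_inverse)

definition cq :: "nat \<Rightarrow> complex" where "cq i = q ^ i / qnum q (Suc i)"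

text \<open>The antisymmetrizer on the strands \<open>m, \<dots>, m + i - 1\<close>; strands are numbered from 0.\<close>

fun asym :: "nat \<Rightarrow> nat \<Rightarrow> 'e" where
  "asym m 0 = 1"
| "asym m (Suc 0) = 1"
| "asym m (Suc (Suc i)) =
     cq (Suc i) *\<^sub>C (asym m (Suc i) * (Sm (m + i) (xq (Suc i)) * asym m (Suc i)))"

text \<open>The antisymmetrizer is a polynomial in generators, so it follows any operator that
  shifts each of them. The case \<open>d = e\<close> gives commutation with distant strands; the
  other cases transport antisymmetrizers along braids and along products of
  \<open>F\<close>.\<close>

lemma asym_intertwine:
  assumes "\<And>j. m \<le> j \<Longrightarrow> Suc j < m + i \<Longrightarrow> w * R (j + d) = R (j + e) * w"
  shows "w * asym (m + d) i = asym (m + e) i * w"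
  using assms
proof (induction m i rule: asym.induct)
  case (3 m i)
  have IH: "w * asym (m + d) (Suc i) = asym (m + e) (Suc i) * w" using 3 by simp
  have S: "w * Sm (m + d + i) (xq (Suc i)) = Sm (m + e + i) (xq (Suc i)) * w"
    using intertwine_Sm[OF 3(3)[of "m + i"]] by (simp add: add_ac)
  have "w * (asym (m + d) (Suc i) * (Sm (m + d + i) (xq (Suc i)) * asym (m + d) (Suc i)))
      = asym (m + e) (Suc i) * (w * (Sm (m + d + i) (xq (Suc i)) * asym (m + d) (Suc i)))"
    using arg_cong[OF IH, of "\<lambda>z. z * y" for y, unfolded mult.assoc] .
  also have "\<dots> = asym (m + e) (Suc i) * (Sm (m + e + i) (xq (Suc i)) * (w * asym (m + d) (Suc i)))"
    using arg_cong[OF S, of "\<lambda>z. z * y" for y, unfolded mult.assoc] by simp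
  finally show ?case by (simp add: IH mult.assoc)
qed simp_all

lemma asym_commute:
  assumes "\<And>j. m \<le> j \<Longrightarrow> Suc j < m + i \<Longrightarrow> w * R j = R j * w"
  shows "w * asym m i = asym m i * w"
  using asym_intertwine[of m i w 0 0] assms by simp

lemma Sm_anti:
  assumes "R j * z = (- inverse q) *\<^sub>C z"
  shows "Sm j x * z = (1 + (x - 1) / lam * (- inverse q)) *\<^sub>C z"
  by (simp add: Sm_def distrib_right assms K_anti[OF assms] cs_add_left cs.scale_left_diff_distrib)

lemma Sm_anti_right:
  assumes "z * R j = (- inverse q) *\<^sub>C z"
  shows "z * Sm j x = (1 + (x - 1) / lam * (- inverse q)) *\<^sub>C z"
  by (simp add: Sm_def distrib_left assms K_anti_right[OF assms] cs_add_left cs.scale_left_diff_distrib)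

text \<open>On an antisymmetric vector the factor \<open>Sm\<close> with parameter
  \<open>xq i\<close> acts by the scalar \<open>inverse q ^ i * qnum q (Suc i)\<close>. The
  normalization \<open>cq i\<close> is its inverse, which is why antisymmetrizers act as the
  identity there.\<close>

lemma cq_normalizes:
  assumes "qnum q (Suc i) \<noteq> 0"
  shows "cq i * (1 + (xq i - 1) / lam * (- inverse q)) = 1"
proof -
  have l: "lam \<noteq> 0" by (rule lam0)
  have "1 + (xq i - 1) / lam * (- inverse q) = (lam - inverse q * (xq i - 1)) / lam"
    using l by (simp add: divide_simps)
  also have "\<dots> = (q - inverse q * xq i) / lam" by (simp add: lam_def right_diff_distrib)
  finally have "q ^ i * (1 + (xq i - 1) / lam * (- inverse q)) = (q * q ^ i - inverse q * (q ^ i * xq i)) / lam"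
    by (simp add: right_diff_distrib mult_ac)
  also have "q ^ i * xq i = inverse q ^ i"
    using q0 by (simp add: xq_def mult_2 power_add power_inverse)
  finally have "q ^ i * (1 + (xq i - 1) / lam * (- inverse q)) = qnum q (Suc i)"
    by (simp add: qnum_def lam_def)
  then show ?thesis using assms by (simp add: cq_def)
qed

lemma asym_absorb:
  assumes "\<And>j. 2 \<le> j \<Longrightarrow> j \<le> i \<Longrightarrow> qnum q j \<noteq> 0"
  shows "anti m i z \<Longrightarrow> asym m i * z = z" and "anti_right m i z \<Longrightarrow> z * asym m i = z"
proof -
  have "(anti m i z \<longrightarrow> asym m i * z = z) \<and> (anti_right m i z \<longrightarrow> z * asym m i = z)"
    using assms
  proof (induction m i rule: asym.induct)
    case (3 m i)
    have nz: "qnum q (Suc (Suc i)) \<noteq> 0" by (rule 3(3)) simp_all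
    show ?case
    proof (intro conjI impI)
      assume a: "anti m (Suc (Suc i)) z"
      then have "anti m (Suc i) z" "R (m + i) * z = (- inverse q) *\<^sub>C z" by (auto simp: anti_def)
      then show "asym m (Suc (Suc i)) * z = z"
        using 3 Sm_anti[of "m + i" z "xq (Suc i)"] cq_normalizes[OF nz] by (simp add: mult.assoc)
    next
      assume a: "anti_right m (Suc (Suc i)) z"
      then have "anti_right m (Suc i) z" "z * R (m + i) = (- inverse q) *\<^sub>C z" by (auto simp: anti_right_def)
      then have "z * asym m (Suc i) = z" "z * Sm (m + i) (xq (Suc i)) = (1 + (xq (Suc i) - 1) / lam * (- inverse q)) *\<^sub>C z"
        using 3 Sm_anti_right by auto
      then have "z * (asym m (Suc i) * (Sm (m + i) (xq (Suc i)) * asym m (Suc i)))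
        = (1 + (xq (Suc i) - 1) / lam * (- inverse q)) *\<^sub>C z"
        by (metis mult.assoc mult_cs_left)
      then show "z * asym m (Suc (Suc i)) = z"
        using cq_normalizes[OF nz] by simp
    qed
  qed simp_all
  then show "anti m i z \<Longrightarrow> asym m i * z = z" and "anti_right m i z \<Longrightarrow> z * asym m i = z" by auto
qed

text \<open>\<open>P\<close> antisymmetrizes one strand more than \<open>P'\<close>, and
  \<open>R r\<close> reaches the next strand. When the left copy of \<open>P\<close> is written
  through \<open>P'\<close>, the inner \<open>P'\<close> passes \<open>Sm r\<close> and is absorbed
  by the right copy, leaving exactly the product treated in \<open>fusion_left\<close>. For
  multiplication from the right it is the other copy that is opened.\<close>

lemma fusion_step:
  assumes adj: "adj r s" and P: "P = c *\<^sub>C (P' * (Sm s x * P'))"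
    and comm: "P' * R r = R r * P'" and P'P: "P' * P = P" "P * P' = P"
    and sP: "R s * P = (- inverse q) *\<^sub>C P" "P * R s = (- inverse q) *\<^sub>C P"
    and nz: "q * inverse \<mu> * x + 1 \<noteq> 0" "q * inverse \<mu> * (x / (q * q)) + 1 \<noteq> 0"
  defines "Z \<equiv> P * (Sm r (x / (q * q)) * P)"
  shows "R r * Z = (- inverse q) *\<^sub>C Z" "Z * R r = (- inverse q) *\<^sub>C Z"
proof -
  let ?S = "Sm r (x / (q * q))"
  have comS: "P' * ?S = ?S * P'" using intertwine_Sm[OF comm] .
  have "Z = c *\<^sub>C (P' * (Sm s x * (P' * (?S * P))))" unfolding Z_def by (subst P) (simp add: mult.assoc)
  also have "P' * (?S * P) = ?S * (P' * P)" using comS by (metis mult.assoc)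
  finally have Z1: "Z = c *\<^sub>C (P' * (Sm s x * (?S * P)))" by (simp add: P'P)
  have "R r * Z = c *\<^sub>C (P' * (R r * (Sm s x * (?S * P))))"
    unfolding Z1 using comm by (simp flip: mult.assoc)
  then show "R r * Z = (- inverse q) *\<^sub>C Z"
    unfolding fusion_left[OF adj sP(1) nz] Z1 by (simp only: mult_cs_right cs_cs mult.commute[of c])
  have "Z = c *\<^sub>C ((P * ?S * P') * Sm s x * P')" unfolding Z_def by (subst (2) P) (simp add: mult.assoc)
  also have "P * ?S * P' = P * ?S" by (metis comS P'P(2) mult.assoc)
  finally have Z2: "Z = c *\<^sub>C ((P * ?S * Sm s x) * P')" .
  have "Z * R r = c *\<^sub>C ((P * ?S * Sm s x) * (P' * R r))" unfolding Z2 by (simp add: mult.assoc)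
  also have "\<dots> = c *\<^sub>C ((P * ?S * Sm s x * R r) * P')" by (simp only: comm mult.assoc)
  finally show "Z * R r = (- inverse q) *\<^sub>C Z"
    unfolding fusion_right[OF adj sP(2) nz] Z2 by (simp only: mult_cs_left cs_cs mult.commute[of c])
qed

end

locale bmw_antisym = bmw_algebra q \<mu> R Ri K
  for q \<mu> :: complex and R Ri K :: "nat \<Rightarrow> 'e::calgebra" +
  fixes k :: nat
  assumes qnum0: "2 \<le> i \<Longrightarrow> i \<le> k \<Longrightarrow> qnum q i \<noteq> 0"
    and den0: "1 \<le> i \<Longrightarrow> i \<le> k \<Longrightarrow> q * inverse \<mu> * xq i + 1 \<noteq> 0"
begin

text \<open>At the parameter \<open>xq 1\<close> the coefficient of \<open>R j\<close> is
  \<open>- inverse q\<close>, and the quadratic relation for \<open>R j\<close> then makes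
  \<open>Sm\<close> an eigenvector: this is the two-strand antisymmetrizer up to a factor.\<close>

lemma Sm_anti_base:
  assumes "1 \<le> k"
  shows "R j * Sm j (xq 1) = (- inverse q) *\<^sub>C Sm j (xq 1)" "Sm j (xq 1) * R j = (- inverse q) *\<^sub>C Sm j (xq 1)"
proof -
  define a where "a = (xq 1 - 1) / lam"
  define b where "b = (xq 1 - 1) / (q * inverse \<mu> * xq 1 + 1)"
  have n: "q * inverse \<mu> * xq 1 + 1 \<noteq> 0" using den0[of 1] assms by simp
  have x1: "xq 1 = inverse q * inverse q" by (simp add: xq_def power2_eq_square)
  have a1: "a = - inverse q"
  proof -
    have "xq 1 - 1 = - inverse q * lam" unfolding x1 using q0 by (simp add: lam_def algebra_simps)
    then show ?thesis using lam0 by (simp add: a_def)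
  qed
  have n': "inverse q + \<mu> \<noteq> 0"
  proof
    assume "inverse q + \<mu> = 0"
    then have "\<mu> = - inverse q" by (simp add: add_eq_0_iff2)
    then show False using n q0 unfolding x1 by (simp add: field_simps)
  qed
  have b1: "b * (\<mu> + inverse q) = lam * \<mu> * a"
  proof -
    have "b * (q * inverse \<mu> * xq 1 + 1) = xq 1 - 1" using n by (simp add: b_def)
    moreover have "q * inverse \<mu> * xq 1 + 1 = (inverse q + \<mu>) / \<mu>" unfolding x1 using q0 mu0 by (simp add: field_simps)
    moreover have "xq 1 - 1 = lam * a" using lam0 by (simp add: a_def)
    ultimately have *: "b * ((inverse q + \<mu>) / \<mu>) = lam * a" by metis
    have "b * (\<mu> + inverse q) = \<mu> * (b * ((inverse q + \<mu>) / \<mu>))" using mu0 by (simp add: add.commute)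
    also have "\<dots> = \<mu> * (lam * a)" by (simp only: *)
    finally show ?thesis by (simp add: mult_ac)
  qed
  have S: "Sm j (xq 1) = 1 + a *\<^sub>C R j + b *\<^sub>C K j" by (simp add: Sm_def a_def b_def)
  have e: "1 + lam * a = (- inverse q) * a" using q0 by (simp add: a1 lam_def algebra_simps)
  have f: "\<mu> * b - lam * \<mu> * a = (- inverse q) * b" using b1 by (simp add: algebra_simps)
  have *: "a *\<^sub>C 1 + (1 + lam * a) *\<^sub>C R j + (\<mu> * b - lam * \<mu> * a) *\<^sub>C K j = (- inverse q) *\<^sub>C Sm j (xq 1)"
    unfolding e f S by (simp add: cs_add_right cs.scale_right_diff_distrib a1)
  have "R j * Sm j (xq 1) = a *\<^sub>C 1 + (1 + lam * a) *\<^sub>C R j + (\<mu> * b - lam * \<mu> * a) *\<^sub>C K j"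
    unfolding S
    by (simp add: distrib_left K_R_comm R_sq cs_add_right cs_add_left cs.scale_right_diff_distrib cs.scale_left_diff_distrib)
      (simp add: mult_ac)
  then show "R j * Sm j (xq 1) = (- inverse q) *\<^sub>C Sm j (xq 1)" unfolding * .
  have "Sm j (xq 1) * R j = a *\<^sub>C 1 + (1 + lam * a) *\<^sub>C R j + (\<mu> * b - lam * \<mu> * a) *\<^sub>C K j"
    unfolding S
    by (simp add: distrib_right K_R R_sq cs_add_right cs_add_left cs.scale_right_diff_distrib cs.scale_left_diff_distrib)
      (simp add: mult_ac)
  then show "Sm j (xq 1) * R j = (- inverse q) *\<^sub>C Sm j (xq 1)" unfolding * .
qed

text \<open>The definition adds a strand on the right, whereas the trace recursions need it added on
  the left. Antisymmetry of the element built on the left rests on the reversed formula for fewer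
  strands, and the reversed formula rests on antisymmetry, so all claims share one induction with
  \<open>m\<close> arbitrary.\<close>

lemma asym_properties:
  assumes "i \<le> k"
  shows "anti m i (asym m i) \<and> anti_right m i (asym m i) \<and>
    (\<forall>j. i = Suc (Suc j) \<longrightarrow>
      asym m i = cq (Suc j) *\<^sub>C (asym (Suc m) (Suc j) * (Sm m (xq (Suc j)) * asym (Suc m) (Suc j))))"
  using assms
proof (induction i arbitrary: m rule: less_induct)
  case (less i)
  consider "i < 2" | "i = 2" | j where "i = Suc (Suc (Suc j))"
    by (metis One_nat_def Suc_1 less_2_cases_iff not0_implies_Suc)
  then show ?case
  proof cases
    case 1
    then show ?thesis by (auto simp: anti_def anti_right_def)
  next
    case 2
    have e: "asym m 2 = cq 1 *\<^sub>C Sm m (xq 1)" by (simp add: numeral_2_eq_2)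
    have "anti m 2 (asym m 2)" "anti_right m 2 (asym m 2)"
      using Sm_anti_base[of m] less.prems 2
      by (auto simp: anti_def anti_right_def e mult_ac le_less_Suc_eq simp del: cs.scale_minus_left)
    then show ?thesis using e 2 by simp
  next
    case (3 j)
    define P where "P = asym m (Suc (Suc j))"
    define P' where "P' = asym m (Suc j)"
    define Q where "Q = asym (Suc m) (Suc (Suc j))"
    define Q' where "Q' = asym (Suc (Suc m)) (Suc j)"
    let ?x = "xq (Suc j)"
    have nz: "q * inverse \<mu> * ?x + 1 \<noteq> 0" "q * inverse \<mu> * (?x / (q * q)) + 1 \<noteq> 0"
      using den0[of "Suc j"] den0[of "Suc (Suc j)"] less.prems 3 by (simp_all add: xq_Suc)
    have qn: "\<And>l. 2 \<le> l \<Longrightarrow> l \<le> i \<Longrightarrow> qnum q l \<noteq> 0" using qnum0 less.prems by auto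
    have PA: "anti m (Suc (Suc j)) P" "anti_right m (Suc (Suc j)) P"
      using less.IH[of "Suc (Suc j)" m] less.prems 3 by (auto simp: P_def)
    have QA: "anti (Suc m) (Suc (Suc j)) Q" "anti_right (Suc m) (Suc (Suc j)) Q"
      and Qrev: "Q = cq (Suc j) *\<^sub>C (Q' * (Sm (Suc m) ?x * Q'))"
      using less.IH[of "Suc (Suc j)" "Suc m"] less.prems 3 by (auto simp: Q_def Q'_def)
    have PA': "anti m (Suc j) P" "anti_right m (Suc j) P"
      using PA by (auto simp: anti_def anti_right_def)
    have QA': "anti (Suc (Suc m)) (Suc j) Q" "anti_right (Suc (Suc m)) (Suc j) Q"
      using QA by (auto simp: anti_def anti_right_def)
    have P'P: "P' * P = P" "P * P' = P"
      using PA' asym_absorb[of "Suc j" m P] qn 3 by (auto simp: P'_def)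
    have Q'Q: "Q' * Q = Q" "Q * Q' = Q"
      using QA' asym_absorb[of "Suc j" "Suc (Suc m)" Q] qn 3 by (auto simp: Q'_def)
    have Pf: "P = cq (Suc j) *\<^sub>C (P' * (Sm (m + j) ?x * P'))" by (simp add: P_def P'_def)
    have cP: "P' * R (Suc (m + j)) = R (Suc (m + j)) * P'"
      unfolding P'_def by (rule asym_commute[symmetric]) (auto intro: R_far)
    have cQ: "Q' * R m = R m * Q'"
      unfolding Q'_def by (rule asym_commute[symmetric]) (auto intro: R_far)
    define Z where "Z = P * (Sm (Suc (m + j)) (xq (Suc (Suc j))) * P)"
    define Y where "Y = Q * (Sm m (xq (Suc (Suc j))) * Q)"
    have Z: "R (Suc (m + j)) * Z = (- inverse q) *\<^sub>C Z" "Z * R (Suc (m + j)) = (- inverse q) *\<^sub>C Z"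
      using fusion_step[OF _ Pf cP P'P _ _ nz] PA by (auto simp: Z_def xq_Suc adj_def anti_def anti_right_def)
    have Y: "R m * Y = (- inverse q) *\<^sub>C Y" "Y * R m = (- inverse q) *\<^sub>C Y"
      using fusion_step[OF _ Qrev cQ Q'Q _ _ nz] QA by (auto simp: Y_def xq_Suc adj_def anti_def anti_right_def)
    have ZA: "anti m i Z" "anti_right m i Z"
    proof -
      have "R l * Z = (- inverse q) *\<^sub>C Z \<and> Z * R l = (- inverse q) *\<^sub>C Z" if "m \<le> l" "Suc l < m + i" for l
      proof (cases "l = Suc (m + j)")
        case False
        then have "R l * P = (- inverse q) *\<^sub>C P" "P * R l = (- inverse q) *\<^sub>C P"
          using PA that 3 by (auto simp: anti_def anti_right_def)
        moreover have "R l * Z = (R l * P) * (Sm (Suc (m + j)) (xq (Suc (Suc j))) * P)" "Z * R l = P * (Sm (Suc (m + j)) (xq (Suc (Suc j))) * (P * R l))"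
          by (simp_all add: Z_def mult.assoc)
        ultimately show ?thesis by (simp add: Z_def)
      qed (use Z in auto)
      then show "anti m i Z" "anti_right m i Z" by (auto simp: anti_def anti_right_def)
    qed
    have YA: "anti m i Y" "anti_right m i Y"
    proof -
      have "R l * Y = (- inverse q) *\<^sub>C Y \<and> Y * R l = (- inverse q) *\<^sub>C Y" if "m \<le> l" "Suc l < m + i" for l
      proof (cases "l = m")
        case False
        then have "R l * Q = (- inverse q) *\<^sub>C Q" "Q * R l = (- inverse q) *\<^sub>C Q"
          using QA that 3 by (auto simp: anti_def anti_right_def)
        moreover have "R l * Y = (R l * Q) * (Sm m (xq (Suc (Suc j))) * Q)" "Y * R l = Q * (Sm m (xq (Suc (Suc j))) * (Q * R l))"
          by (simp_all add: Y_def mult.assoc)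
        ultimately show ?thesis by (simp add: Y_def)
      qed (use Y in auto)
      then show "anti m i Y" "anti_right m i Y" by (auto simp: anti_def anti_right_def)
    qed
    let ?c = "cq (Suc (Suc j))"
    have aZ: "asym m i = ?c *\<^sub>C Z" by (simp add: 3 Z_def P_def)
    have A: "anti m i (asym m i)" "anti_right m i (asym m i)"
      using ZA unfolding aZ by (auto simp: anti_def anti_right_def mult_ac)
    \<comment> \<open>The product \<open>asym m i * Y\<close> is evaluated twice: \<open>Y\<close>
      is antisymmetric and absorbs the antisymmetrizer, and conversely the factors of
      \<open>Y\<close> are absorbed one by one on the right at the cost of a scalar. Hence
      \<open>Y\<close> is a multiple of \<open>asym m i\<close>.\<close>
    have A': "asym m i * Y = Y" using asym_absorb(1)[OF _ YA(1)] qn by blast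
    have "asym m i * Q = asym m i"
    proof -
      have "anti_right (Suc m) (Suc (Suc j)) (asym m i)" using A(2) 3 by (auto simp: anti_right_def)
      from asym_absorb(2)[OF _ this] show ?thesis using qn 3 by (auto simp: Q_def)
    qed
    moreover have "asym m i * Sm m (xq (Suc (Suc j))) = (1 + (xq (Suc (Suc j)) - 1) / lam * (- inverse q)) *\<^sub>C asym m i"
      by (rule Sm_anti_right) (use A(2) 3 in \<open>auto simp: anti_right_def\<close>)
    moreover have "asym m i * Y = ((asym m i * Q) * Sm m (xq (Suc (Suc j)))) * Q"
      by (simp add: Y_def mult.assoc)
    ultimately have "asym m i * Y = (1 + (xq (Suc (Suc j)) - 1) / lam * (- inverse q)) *\<^sub>C asym m i"
      by simp
    then have YY: "Y = (1 + (xq (Suc (Suc j)) - 1) / lam * (- inverse q)) *\<^sub>C asym m i"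
      unfolding A' .
    have n1: "?c * (1 + (xq (Suc (Suc j)) - 1) / lam * (- inverse q)) = 1"
      by (rule cq_normalizes, rule qn) (simp_all add: 3)
    have "?c *\<^sub>C Y = (?c * (1 + (xq (Suc (Suc j)) - 1) / lam * (- inverse q))) *\<^sub>C asym m i"
      by (subst YY) (rule cs_cs)
    then have *: "asym m i = ?c *\<^sub>C Y" unfolding n1 by simp
    have "\<forall>j'. i = Suc (Suc j') \<longrightarrow> asym m i =
        cq (Suc j') *\<^sub>C (asym (Suc m) (Suc j') * (Sm m (xq (Suc j')) * asym (Suc m) (Suc j')))"
    proof (intro allI impI)
      fix j' assume "i = Suc (Suc j')"
      then have "j' = Suc j" using 3 by simp
      then show "asym m i = cq (Suc j') *\<^sub>C (asym (Suc m) (Suc j') * (Sm m (xq (Suc j')) * asym (Suc m) (Suc j')))"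
        using * by (simp only: Y_def Q_def)
    qed
    with A show ?thesis by blast
  qed
qed

lemma asym_rev:
  assumes "Suc i \<le> k" "1 \<le> i"
  shows "asym m (Suc i) = cq i *\<^sub>C (asym (Suc m) i * (Sm m (xq i) * asym (Suc m) i))"
  using asym_properties[OF assms(1)] assms(2) by (cases i) auto

lemma asym_idem:
  assumes "i \<le> k" shows "asym m i * asym m i = asym m i"
  using asym_absorb(1) asym_properties[OF assms] qnum0 assms by (meson le_trans)

end

section \<open>Partial traces and the recursions for matrix powers\<close>

lemma comm_left:
  fixes x y z :: "'a::semigroup_mult"
  assumes "x * y = y * x" shows "x * (y * z) = y * (x * z)"
  using assms by (simp flip: mult.assoc)

lemma comm_trans:
  fixes x y z :: "'a::semigroup_mult"
  assumes "x * y = y * x" "x * z = z * x" shows "x * (y * z) = (y * z) * x"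
  using assms by (metis mult.assoc)

text \<open>
  Strands are numbered from 0: \<open>R i\<close> and \<open>F i\<close> act on the strands \<open>i, i + 1\<close>, \<open>E n\<close> holds the operators
  on the first \<open>n\<close> strands, and \<open>T n\<close> is the R-trace over the strand \<open>n\<close>.
\<close>

locale quantum_matrix = bmw_antisym q \<mu> R Ri K k
  for q \<mu> :: complex and R Ri K :: "nat \<Rightarrow> 'e::calgebra" and k :: nat +
  fixes F Fi :: "nat \<Rightarrow> 'e" and E :: "nat \<Rightarrow> 'e set" and T :: "nat \<Rightarrow> 'e \<Rightarrow> 'e" and M0 g :: 'e
  assumes E_one: "1 \<in> E n" and E_add: "x \<in> E n \<Longrightarrow> y \<in> E n \<Longrightarrow> x + y \<in> E n"
    and E_mult: "x \<in> E n \<Longrightarrow> y \<in> E n \<Longrightarrow> x * y \<in> E n" and E_cs: "x \<in> E n \<Longrightarrow> c *\<^sub>C x \<in> E n"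
    and E_Suc: "x \<in> E n \<Longrightarrow> x \<in> E (Suc n)"
    and T_E: "x \<in> E (Suc n) \<Longrightarrow> T n x \<in> E n"
    and T_add: "T n (x + y) = T n x + T n y" and T_cs: "T n (c *\<^sub>C x) = c *\<^sub>C T n x"
    and T_left: "x \<in> E n \<Longrightarrow> T n (x * y) = x * T n y" and T_right: "x \<in> E n \<Longrightarrow> T n (y * x) = T n y * x"
    and R_E: "R i \<in> E (Suc (Suc i))" and Ri_E: "Ri i \<in> E (Suc (Suc i))"
    and F_E: "F i \<in> E (Suc (Suc i))" and Fi_E: "Fi i \<in> E (Suc (Suc i))"
    and M0_E: "M0 \<in> E 1" and g_E: "g \<in> E 0"
    and F_Fi: "F i * Fi i = 1" and Fi_F: "Fi i * F i = 1"
    and F_braid: "F i * F (Suc i) * F i = F (Suc i) * F i * F (Suc i)"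
    and F_far_less: "Suc i < j \<Longrightarrow> F i * F j = F j * F i"
    and F_R_far: "Suc i < j \<or> Suc j < i \<Longrightarrow> F i * R j = R j * F i"
    and RFF: "R i * F (Suc i) * F i = F (Suc i) * F i * R (Suc i)"
    and FFR: "R (Suc i) * F i * F (Suc i) = F i * F (Suc i) * R i"
    and R_M0: "R (Suc i) * M0 = M0 * R (Suc i)" and F_M0: "F (Suc i) * M0 = M0 * F (Suc i)"
    and E0_R: "z \<in> E 0 \<Longrightarrow> R i * z = z * R i" and E0_F: "z \<in> E 0 \<Longrightarrow> F i * z = z * F i"
    and T_R: "T (Suc i) (R i) = 1" and T_K: "T (Suc i) (K i) = \<mu> *\<^sub>C 1"
    and T_F: "x \<in> E (Suc i) \<Longrightarrow> T (Suc i) (F i * x * Fi i) = T i x"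
    and T_cyc: "T i (T (Suc i) (R i * x)) = T i (T (Suc i) (x * R i))"
    and RMM0: "R 0 * (M0 * (F 0 * M0 * Fi 0)) = M0 * (F 0 * M0 * Fi 0) * R 0"
    and KMM0: "M0 * (F 0 * M0 * Fi 0) * K 0 = (inverse \<mu> * inverse \<mu>) *\<^sub>C (K 0 * g)"
begin

lemma E_mono: "x \<in> E m \<Longrightarrow> m \<le> n \<Longrightarrow> x \<in> E n"
  by (induction n) (auto simp: le_Suc_eq intro: E_Suc)

lemma F_Fi_left: "F i * (Fi i * x) = x" "Fi i * (F i * x) = x"
  by (simp_all add: F_Fi Fi_F flip: mult.assoc)

lemma Fi_intertwine:
  assumes "w * F a = F b * w" shows "w * Fi a = Fi b * w"
proof -
  have "w * Fi a = Fi b * (F b * w) * Fi a" by (simp add: F_Fi_left mult.assoc)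
  also have "\<dots> = Fi b * w" by (simp only: assms[symmetric] mult.assoc F_Fi mult_1_right)
  finally show ?thesis .
qed

section \<open>Copies of \<open>M\<close> on the strands (\<open>M i\<close> has barred index
  \<open>i + 1\<close>)\<close>

primrec M :: "nat \<Rightarrow> 'e" where
  "M 0 = M0"
| "M (Suc i) = F i * (M i * Fi i)"

lemma M_E: "M i \<in> E (Suc i)"
  by (induction i) (use M0_E in \<open>auto intro!: E_mult F_E Fi_E intro: E_Suc\<close>)

lemma R_F_far: "Suc i < j \<or> Suc j < i \<Longrightarrow> R j * F i = F i * R j"
  using F_R_far[of i j] by simp

lemma F_far: "Suc i < j \<or> Suc j < i \<Longrightarrow> F j * F i = F i * F j"
  using F_far_less[of i j] F_far_less[of j i] by auto

lemma M_Suc_comm: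
  assumes "w * F i = F i * w" "w * M i = M i * w"
  shows "w * M (Suc i) = M (Suc i) * w"
  using assms Fi_intertwine[OF assms(1)] by (simp add: comm_trans)

lemma R_M_above: "i < j \<Longrightarrow> R j * M i = M i * R j"
proof (induction i)
  case 0
  then show ?case using R_M0[of "j - 1"] by simp
next
  case (Suc i)
  then show ?case using M_Suc_comm[of "R j" i] R_F_far[of i j] by simp
qed

lemma F_M_above: "i < j \<Longrightarrow> F j * M i = M i * F j"
proof (induction i)
  case 0
  then show ?case using F_M0[of "j - 1"] by simp
next
  case (Suc i)
  then show ?case using M_Suc_comm[of "F j" i] F_far[of i j] by simp
qed

text \<open>Conjugation by \<open>F (Suc i) * F i\<close> carries \<open>M i\<close> to
  \<open>M (Suc (Suc i))\<close> and carries \<open>v\<close> to \<open>w\<close>. Applied to an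
  operator \<open>v\<close> lying above the strand \<open>i\<close>, it turns the known commutation
  from above into commutation from below.\<close>

lemma below_M_aux:
  assumes "w * F (Suc i) * F i = F (Suc i) * F i * v" "v * M i = M i * v"
  shows "w * M (Suc (Suc i)) = M (Suc (Suc i)) * w"
proof -
  let ?P = "F (Suc i) * F i" and ?Pi = "Fi i * Fi (Suc i)"
  have P: "?P * ?Pi = 1" "?Pi * ?P = 1"
    by (simp_all add: mult.assoc F_Fi_left F_Fi Fi_F)
  have M: "M (Suc (Suc i)) = ?P * M i * ?Pi" by (simp add: mult.assoc)
  have "v * ?Pi = ?Pi * (?P * v) * ?Pi" using P(2) by (simp flip: mult.assoc)
  also have "\<dots> = ?Pi * w" using P(1) by (simp only: assms(1)[unfolded mult.assoc, symmetric] mult.assoc) simp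
  finally have v: "v * ?Pi = ?Pi * w" .
  have "w * M (Suc (Suc i)) = (w * F (Suc i) * F i) * M i * ?Pi" by (simp add: M mult.assoc)
  also have "\<dots> = ?P * (v * M i) * ?Pi" by (simp only: assms(1)) (simp only: mult.assoc)
  also have "\<dots> = ?P * M i * (v * ?Pi)" by (simp only: assms(2)) (simp only: mult.assoc)
  also have "\<dots> = M (Suc (Suc i)) * w" unfolding v M by (simp only: mult.assoc)
  finally show ?thesis .
qed

lemma R_M_below: "Suc (Suc j) \<le> i \<Longrightarrow> R j * M i = M i * R j"
proof (induction i rule: nat_induct_at_least)
  case base
  show ?case by (rule below_M_aux[OF RFF]) (rule R_M_above, simp)
next
  case (Suc i)
  then show ?case using M_Suc_comm[of "R j" i] R_F_far[of i j] by simp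
qed

lemma F_M_below: "Suc (Suc j) \<le> i \<Longrightarrow> F j * M i = M i * F j"
proof (induction i rule: nat_induct_at_least)
  case base
  show ?case by (rule below_M_aux[OF F_braid]) (rule F_M_above, simp)
next
  case (Suc i)
  then show ?case using M_Suc_comm[of "F j" i] F_far[of i j] by simp
qed

lemma FF_M:
  shows FF_M_1: "F i * F (Suc i) * M i = M (Suc i) * (F i * F (Suc i))"
    and FF_M_2: "F i * F (Suc i) * M (Suc i) = M (Suc (Suc i)) * (F i * F (Suc i))"
proof -
  have "F i * F (Suc i) * M i = F i * (M i * F (Suc i))" using F_M_above[of i "Suc i"] by (simp add: mult.assoc)
  also have "\<dots> = M (Suc i) * (F i * F (Suc i))" by (simp add: mult.assoc F_Fi_left)
  finally show "F i * F (Suc i) * M i = M (Suc i) * (F i * F (Suc i))" .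
  have "F i * F (Suc i) * M (Suc i) = (F i * M (Suc (Suc i))) * F (Suc i)"
    by (simp add: mult.assoc F_Fi_left Fi_F)
  also have "\<dots> = M (Suc (Suc i)) * (F i * F (Suc i))" by (simp only: F_M_below[OF order_refl] mult.assoc)
  finally show "F i * F (Suc i) * M (Suc i) = M (Suc (Suc i)) * (F i * F (Suc i))" .
qed

text \<open>Conjugation by \<open>F i * F (Suc i)\<close> moves relations for \<open>M\<close> up by one strand.\<close>

lemma shift_MM:
  assumes h: "F i * F (Suc i) * x = y * (F i * F (Suc i))" "F i * F (Suc i) * z = z' * (F i * F (Suc i))"
    and MM: "M i * M (Suc i) * x = z"
  shows "M (Suc i) * M (Suc (Suc i)) * y = z'"
proof -
  let ?P = "F i * F (Suc i)" and ?Pi = "Fi (Suc i) * Fi i"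
  have P: "w * (?P * ?Pi) = w" for w
    by (simp add: mult.assoc F_Fi_left F_Fi Fi_F)
  have "M (Suc i) * M (Suc (Suc i)) * y = (M (Suc i) * (M (Suc (Suc i)) * (y * ?P))) * ?Pi"
    using P[of "M (Suc i) * M (Suc (Suc i)) * y"] by (simp only: mult.assoc)
  also have "\<dots> = (M (Suc i) * ((M (Suc (Suc i)) * ?P) * x)) * ?Pi"
    by (simp only: h(1)[symmetric] mult.assoc)
  also have "\<dots> = ((M (Suc i) * ?P) * (M (Suc i) * x)) * ?Pi"
    by (simp only: FF_M_2[symmetric] mult.assoc)
  also have "\<dots> = (?P * (M i * M (Suc i) * x)) * ?Pi"
    by (simp only: FF_M_1[symmetric] mult.assoc)
  also have "\<dots> = z' * (?P * ?Pi)" by (simp only: MM h(2)) (simp only: mult.assoc)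
  finally show ?thesis by (simp only: P)
qed

lemma RMM: "R i * (M i * M (Suc i)) = M i * (M (Suc i) * R i)"
proof (induction i)
  case 0
  then show ?case using RMM0 by (simp add: mult.assoc)
next
  case (Suc i)
  have h: "F i * F (Suc i) * R i = R (Suc i) * (F i * F (Suc i))"
    using FFR[of i] by (simp only: mult.assoc)
  have "F i * F (Suc i) * (R i * (M i * M (Suc i))) = R (Suc i) * ((F i * F (Suc i) * M i) * M (Suc i))"
    using h by (simp only: flip: mult.assoc)
  also have "\<dots> = R (Suc i) * (M (Suc i) * (F i * F (Suc i) * M (Suc i)))"
    by (simp only: FF_M_1) (simp only: mult.assoc)
  also have "\<dots> = R (Suc i) * (M (Suc i) * M (Suc (Suc i))) * (F i * F (Suc i))"
    by (simp only: FF_M_2) (simp only: mult.assoc)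
  finally have "F i * F (Suc i) * (R i * (M i * M (Suc i)))
      = R (Suc i) * (M (Suc i) * M (Suc (Suc i))) * (F i * F (Suc i))" .
  from shift_MM[OF h this] Suc show ?case by (simp add: mult.assoc)
qed

lemma KMM: "M i * (M (Suc i) * K i) = (inverse \<mu> * inverse \<mu>) *\<^sub>C (K i * g)"
proof (induction i)
  case 0
  then show ?case using KMM0 by (simp add: mult.assoc)
next
  case (Suc i)
  have "F i * F (Suc i) * R i = R (Suc i) * (F i * F (Suc i))" using FFR[of i] by (simp only: mult.assoc)
  from intertwine_K[OF this] have h: "F i * F (Suc i) * K i = K (Suc i) * (F i * F (Suc i))" .
  have c: "F i * F (Suc i) * g = g * (F i * F (Suc i))"
    using E0_F[OF g_E, of i] E0_F[OF g_E, of "Suc i"] by (simp add: comm_trans)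
  have "F i * F (Suc i) * ((inverse \<mu> * inverse \<mu>) *\<^sub>C (K i * g))
      = (inverse \<mu> * inverse \<mu>) *\<^sub>C (K (Suc i) * (F i * F (Suc i) * g))"
    using h by (simp only: mult_cs_left mult_cs_right flip: mult.assoc)
  also have "\<dots> = (inverse \<mu> * inverse \<mu>) *\<^sub>C (K (Suc i) * g) * (F i * F (Suc i))"
    by (simp only: c) (simp only: mult_cs_left mult.assoc)
  finally have z: "F i * F (Suc i) * ((inverse \<mu> * inverse \<mu>) *\<^sub>C (K i * g))
      = (inverse \<mu> * inverse \<mu>) *\<^sub>C (K (Suc i) * g) * (F i * F (Suc i))" .
  show ?case using shift_MM[OF h z] Suc by (simp add: mult.assoc)
qed

text \<open>\<open>R j\<close> links the strands \<open>j\<close> and \<open>j + 1\<close>, so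
  \<open>Alg a b\<close> acts on the strands from \<open>a\<close> to \<open>b\<close> inclusive.
  The set singles out the numerical operators, for which commutation at a distance and cyclicity of
  the trace are available.\<close>

inductive_set Alg :: "nat \<Rightarrow> nat \<Rightarrow> 'e set" for a b :: nat where
  R: "a \<le> j \<Longrightarrow> j < b \<Longrightarrow> R j \<in> Alg a b"
| Ri: "a \<le> j \<Longrightarrow> j < b \<Longrightarrow> Ri j \<in> Alg a b"
| one: "1 \<in> Alg a b"
| add: "x \<in> Alg a b \<Longrightarrow> y \<in> Alg a b \<Longrightarrow> x + y \<in> Alg a b"
| mult: "x \<in> Alg a b \<Longrightarrow> y \<in> Alg a b \<Longrightarrow> x * y \<in> Alg a b"
| cs: "x \<in> Alg a b \<Longrightarrow> c *\<^sub>C x \<in> Alg a b"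

lemma Alg_diff: "x \<in> Alg a b \<Longrightarrow> y \<in> Alg a b \<Longrightarrow> x - y \<in> Alg a b"
  using Alg.add[of x a b "(-1) *\<^sub>C y"] Alg.cs[of y a b "-1"] by simp

lemma Alg_K: "a \<le> j \<Longrightarrow> j < b \<Longrightarrow> K j \<in> Alg a b"
  unfolding K_lam by (intro Alg_diff Alg.one Alg.cs Alg.R Alg.Ri)

lemma Alg_Sm: "a \<le> j \<Longrightarrow> j < b \<Longrightarrow> Sm j x \<in> Alg a b"
  unfolding Sm_def by (intro Alg.add Alg.one Alg.cs Alg.R Alg_K)

lemma Alg_mono: "x \<in> Alg a b \<Longrightarrow> a' \<le> a \<Longrightarrow> b \<le> b' \<Longrightarrow> x \<in> Alg a' b'"
  by (induction rule: Alg.induct) (auto intro: Alg.intros)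

lemma Alg_asym: "m + i \<le> Suc n \<Longrightarrow> asym m i \<in> Alg m n"
  by (induction m i rule: asym.induct) (auto intro!: Alg.one Alg.cs Alg.mult Alg_Sm)

lemma Alg_commute:
  assumes "x \<in> Alg a b" and w: "\<And>j. a \<le> j \<Longrightarrow> j < b \<Longrightarrow> w * R j = R j * w"
  shows "w * x = x * w"
  using assms(1)
proof (induction rule: Alg.induct)
  case (Ri j)
  then show ?case using intertwine_Ri w by blast
qed (auto simp: w distrib_left distrib_right intro: comm_trans)

lemma Alg_far: "x \<in> Alg a b \<Longrightarrow> y \<in> Alg c d \<Longrightarrow> b < c \<Longrightarrow> x * y = y * x"
  by (rule Alg_commute, assumption, rule Alg_commute[symmetric], assumption) (auto intro!: R_far)

lemma Alg_E: "x \<in> Alg a b \<Longrightarrow> b < n \<Longrightarrow> x \<in> E n"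
proof (induction rule: Alg.induct)
  case (R j) then show ?case using E_mono[OF R_E] by simp
next
  case (Ri j) then show ?case using E_mono[OF Ri_E] by simp
qed (auto intro: E_one E_add E_mult E_cs)

lemma Alg_E0: "x \<in> Alg a b \<Longrightarrow> c \<in> E 0 \<Longrightarrow> c * x = x * c"
  by (rule Alg_commute) (auto simp: E0_R)

primrec MP :: "nat \<Rightarrow> nat \<Rightarrow> 'e" where
  "MP m 0 = 1"
| "MP m (Suc s) = MP m s * M (m + s)"

lemma MP_E: "m + s \<le> n \<Longrightarrow> MP m s \<in> E n"
proof (induction s)
  case (Suc s)
  then show ?case using E_mono[OF M_E[of "m + s"]] by (simp add: E_mult)
qed (simp add: E_one)

lemma MP_comm_aux: "(\<And>i. m \<le> i \<Longrightarrow> i < m + s \<Longrightarrow> w * M i = M i * w) \<Longrightarrow> w * MP m s = MP m s * w"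
  by (induction s) (auto intro: comm_trans)

lemma R_MP: assumes "m \<le> j" "Suc (Suc j) \<le> m + s" shows "R j * MP m s = MP m s * R j"
  using assms
proof (induction s)
  case (Suc s)
  show ?case
  proof (cases "Suc (Suc j) \<le> m + s")
    case True
    then show ?thesis using Suc R_M_below[of j "m + s"] by (simp add: comm_trans)
  next
    case False
    define s' where "s' = j - m"
    have s: "s = Suc s'" "j = m + s'" using Suc.prems False by (auto simp: s'_def)
    have 1: "R j * MP m s' = MP m s' * R j" by (rule MP_comm_aux) (auto intro!: R_M_above simp: s)
    have "R j * MP m (Suc s) = (R j * MP m s') * (M j * M (Suc j))" by (simp add: s mult.assoc)
    also have "\<dots> = MP m s' * (R j * (M j * M (Suc j)))" by (simp only: 1 mult.assoc)
    also have "\<dots> = MP m (Suc s) * R j" by (simp only: RMM) (simp add: s mult.assoc)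
    finally show ?thesis .
  qed
qed simp

lemma Alg_MP: "x \<in> Alg a b \<Longrightarrow> m \<le> a \<Longrightarrow> b < m + s \<Longrightarrow> MP m s * x = x * MP m s"
  by (rule Alg_commute) (auto intro!: R_MP[symmetric])

lemma Alg_MP_below: "x \<in> Alg a b \<Longrightarrow> b < m \<Longrightarrow> MP m s * x = x * MP m s"
  by (rule Alg_commute) (auto intro!: MP_comm_aux[symmetric] R_M_below)

primrec TR :: "nat \<Rightarrow> nat \<Rightarrow> 'e \<Rightarrow> 'e" where
  "TR m 0 x = x"
| "TR m (Suc s) x = TR m s (T (m + s) x)"

lemma TR_add: "TR m s (x + y) = TR m s x + TR m s y"
  by (induction s arbitrary: x y) (simp_all add: T_add)

lemma TR_cs: "TR m s (c *\<^sub>C x) = c *\<^sub>C TR m s x"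
  by (induction s arbitrary: x) (simp_all add: T_cs)

lemma TR_left: "x \<in> E m \<Longrightarrow> TR m s (x * y) = x * TR m s y"
  by (induction s arbitrary: y) (simp_all add: T_left E_mono)

lemma TR_right: "x \<in> E m \<Longrightarrow> TR m s (y * x) = TR m s y * x"
  by (induction s arbitrary: y) (simp_all add: T_right E_mono)

lemma TR_E: "x \<in> E (m + s) \<Longrightarrow> TR m s x \<in> E m"
  by (induction s arbitrary: x) (simp_all add: T_E)

lemma TR_split: "TR m (s + s') x = TR m s (TR (m + s) s' x)"
  by (induction s' arbitrary: x) (simp_all add: add_ac)

lemma TR_cyc_R: "1 \<le> j \<Longrightarrow> j < s \<Longrightarrow> TR 1 s (R j * x) = TR 1 s (x * R j)"
proof (induction s arbitrary: x)
  case (Suc s)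
  show ?case
  proof (cases "j < s")
    case True
    have "R j \<in> E (Suc s)" using E_mono[OF R_E] True by simp
    then show ?thesis using Suc True by (simp add: T_left T_right)
  next
    case False
    then obtain s' where s: "s = Suc s'" "j = s" using Suc.prems by (cases s) auto
    then show ?thesis using T_cyc[of s x] by simp
  qed
qed simp

text \<open>A product travels around the trace factor by factor, and an inverse generator is reduced
  to the generator by conjugation. Strand 0 is never traced, hence the condition
  \<open>1 \<le> a\<close>.\<close>

lemma TR_cyc: "w \<in> Alg a b \<Longrightarrow> 1 \<le> a \<Longrightarrow> b \<le> s \<Longrightarrow> TR 1 s (w * x) = TR 1 s (x * w)"
proof (induction arbitrary: x rule: Alg.induct)
  case (R j)
  then show ?case using TR_cyc_R by simp
next
  case (Ri j)
  have "TR 1 s (Ri j * x) = TR 1 s ((Ri j * x * Ri j) * R j)" by (simp add: mult.assoc)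
  also have "\<dots> = TR 1 s (R j * (Ri j * x * Ri j))" using TR_cyc_R[of j s] Ri by simp
  also have "\<dots> = TR 1 s (x * Ri j)" by (simp add: mult.assoc)
  finally show ?case .
next
  case (mult v w)
  have "TR 1 s (v * w * x) = TR 1 s (w * (x * v))" using mult by (simp add: mult.assoc)
  also have "\<dots> = TR 1 s (x * (v * w))" using mult by (simp add: mult.assoc)
  finally show ?case .
qed (simp_all add: distrib_left distrib_right TR_add TR_cs)

section \<open>Descending braids and the transport of contracted pairs\<close>

primrec desc :: "nat \<Rightarrow> nat \<Rightarrow> 'e" where
  "desc a 0 = 1"
| "desc a (Suc s) = R (a + s) * desc a s"

primrec desci :: "nat \<Rightarrow> nat \<Rightarrow> 'e" where
  "desci a 0 = 1"
| "desci a (Suc s) = desci a s * Ri (a + s)"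

lemma desc_desci [simp]: "desc a s * desci a s = 1" "desci a s * desc a s = 1"
proof -
  show 1: "desc a s * desci a s = 1"
  proof (induction s)
    case (Suc s)
    have "desc a (Suc s) * desci a (Suc s) = R (a + s) * (desc a s * desci a s) * Ri (a + s)"
      by (simp add: mult.assoc)
    then show ?case using Suc by simp
  qed simp
  show "desci a s * desc a s = 1"
    by (induction s) (simp_all add: mult.assoc)
qed

lemma desc_desci_left [simp]: "desc a s * (desci a s * x) = x" "desci a s * (desc a s * x) = x"
  by (simp_all flip: mult.assoc)

lemma desc_alt: "desc a (Suc s) = desc (Suc a) s * R a"
  by (induction s) (simp_all add: mult.assoc)

lemma Alg_desc: "a' \<le> a \<Longrightarrow> a + s \<le> b \<Longrightarrow> desc a s \<in> Alg a' b"
  by (induction s) (auto intro!: Alg.mult Alg.R Alg.one)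

lemma Alg_desci: "a' \<le> a \<Longrightarrow> a + s \<le> b \<Longrightarrow> desci a s \<in> Alg a' b"
  by (induction s) (auto intro!: Alg.mult Alg.Ri Alg.one)

lemma desc_shift: "a \<le> j \<Longrightarrow> Suc j < a + s \<Longrightarrow> desc a s * R (Suc j) = R j * desc a s"
proof (induction s)
  case (Suc s)
  show ?case
  proof (cases "Suc j < a + s")
    case True
    then have "desc a (Suc s) * R (Suc j) = R (a + s) * (R j * desc a s)" using Suc by (simp add: mult.assoc)
    also have "\<dots> = R j * desc a (Suc s)" using R_far[of "a + s" j] True by (simp add: comm_left)
    finally show ?thesis .
  next
    case False
    define s' where "s' = j - a"
    have s: "s = Suc s'" "j = a + s'" using Suc.prems False by (auto simp: s'_def)
    have c: "desc a s' * R (Suc j) = R (Suc j) * desc a s'"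
      by (rule Alg_far[of _ a j _ "Suc j" "Suc (Suc j)"]) (auto intro!: Alg_desc Alg.R simp: s)
    have "desc a (Suc s) * R (Suc j) = R (Suc j) * (R j * (desc a s' * R (Suc j)))"
      by (simp add: s mult.assoc)
    also have "\<dots> = (R (Suc j) * (R j * R (Suc j))) * desc a s'" by (simp only: c mult.assoc)
    also have "\<dots> = (R j * (R (Suc j) * R j)) * desc a s'" using braid[of "Suc j" j] by (simp add: adj_def)
    also have "\<dots> = R j * desc a (Suc s)" by (simp add: s mult.assoc)
    finally show ?thesis .
  qed
qed simp

lemma desc_desc: "desc a (Suc s) * desc (Suc a) s = desc a s * desc a (Suc s)"
proof -
  have "t \<le> s \<Longrightarrow> desc a (Suc s) * desc (Suc a) t = desc a t * desc a (Suc s)" for t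
  proof (induction t)
    case (Suc t)
    have "desc a (Suc s) * desc (Suc a) (Suc t) = (desc a (Suc s) * R (Suc (a + t))) * desc (Suc a) t"
      by (simp add: mult.assoc)
    also have "\<dots> = R (a + t) * (desc a (Suc s) * desc (Suc a) t)"
      using desc_shift[of a "a + t" "Suc s"] Suc.prems by (simp add: mult.assoc flip: desc.simps)
    also have "\<dots> = desc a (Suc t) * desc a (Suc s)" using Suc by (simp add: mult.assoc)
    finally show ?case .
  qed simp
  then show ?thesis by simp
qed

text \<open>The braid carrying the strands \<open>a, a + 1\<close> past the next \<open>s\<close> strands.\<close>

definition pair_braid :: "nat \<Rightarrow> nat \<Rightarrow> 'e" where
  "pair_braid a s = desc a s * desc (Suc a) s"

definition pair_braid_inv :: "nat \<Rightarrow> nat \<Rightarrow> 'e" where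
  "pair_braid_inv a s = desci (Suc a) s * desci a s"

lemma pair_braid_inv [simp]: "pair_braid_inv a s * pair_braid a s = 1"
  by (simp add: pair_braid_def pair_braid_inv_def mult.assoc)

lemma Alg_pair_braid_inv: "a' \<le> a \<Longrightarrow> Suc (a + s) \<le> b \<Longrightarrow> pair_braid_inv a s \<in> Alg a' b"
  unfolding pair_braid_inv_def by (intro Alg.mult Alg_desci) auto

lemma pair_braid_shift:
  assumes "a \<le> j" "Suc (Suc j) \<le> a + s"
  shows "pair_braid a s * R (Suc (Suc j)) = R j * pair_braid a s"
proof -
  have "pair_braid a s * R (Suc (Suc j)) = desc a s * (desc (Suc a) s * R (Suc (Suc j)))"
    by (simp add: pair_braid_def mult.assoc)
  also have "\<dots> = (desc a s * R (Suc j)) * desc (Suc a) s"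
    using desc_shift[of "Suc a" "Suc j" s] assms by (simp add: mult.assoc)
  also have "\<dots> = R j * pair_braid a s"
    using desc_shift[of a j s] assms by (simp add: pair_braid_def mult.assoc)
  finally show ?thesis .
qed

lemma pair_braid_K: "K (a + s) * pair_braid a s = pair_braid a s * K a"
proof (induction s)
  case (Suc s)
  have c: "desc a s * R (Suc (a + s)) = R (Suc (a + s)) * desc a s"
    by (rule Alg_far[of _ a "a + s" _ "Suc (a + s)" "Suc (Suc (a + s))"]) (auto intro!: Alg_desc Alg.R)
  have e: "pair_braid a (Suc s) = R (a + s) * (R (Suc (a + s)) * pair_braid a s)"
    using c by (simp add: pair_braid_def mult.assoc comm_left)
  have "K (Suc (a + s)) * pair_braid a (Suc s) = (K (Suc (a + s)) * (R (a + s) * R (Suc (a + s)))) * pair_braid a s"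
    unfolding e by (simp only: mult.assoc)
  also have "\<dots> = R (a + s) * (R (Suc (a + s)) * (K (a + s) * pair_braid a s))"
    by (subst adj_K_conj(1)[symmetric]) (simp_all add: adj_def mult.assoc)
  also have "\<dots> = pair_braid a (Suc s) * K a" unfolding Suc e by (simp only: mult.assoc)
  finally show ?case by simp
qed (simp add: pair_braid_def)

lemma pair_braid_Suc: "pair_braid a (Suc s) = pair_braid (Suc a) s * (R a * R (Suc a))"
proof -
  have c: "R a * desc (Suc (Suc a)) s = desc (Suc (Suc a)) s * R a"
    by (rule Alg_far[of _ a "Suc a" _ "Suc (Suc a)" "Suc (Suc a) + s"]) (auto intro!: Alg_desc Alg.R)
  show ?thesis by (simp add: pair_braid_def desc_alt mult.assoc comm_left[OF c] del: desc.simps)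
qed

text \<open>Since \<open>K (Suc a) * R a * R (Suc a)\<close> equals \<open>K (Suc a) * K a\<close>,
  the factor \<open>K a\<close> is hidden in two crossings of the longer pair braid. The remaining
  crossings slide the other contractor up to \<open>K (Suc a + s)\<close>.\<close>

lemma KK_pair_braid: "K (Suc a) * K a = pair_braid_inv (Suc a) s * (K (Suc a + s) * pair_braid a (Suc s))"
proof -
  have "K (Suc a + s) * pair_braid a (Suc s) = pair_braid (Suc a) s * (K (Suc a) * (R a * R (Suc a)))"
    unfolding pair_braid_Suc using pair_braid_K[of "Suc a" s] by (simp flip: mult.assoc)
  also have "K (Suc a) * (R a * R (Suc a)) = K (Suc a) * K a"
    using KK_KRR[of a "Suc a"] by (simp add: adj_def)
  finally show ?thesis by (simp flip: mult.assoc)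
qed

lemma desc_desci_swap: "desc a (Suc s) * desci (Suc a) s = desci a s * desc a (Suc s)"
proof -
  have "desc a (Suc s) * desci (Suc a) s = desci a s * (desc a s * desc a (Suc s)) * desci (Suc a) s"
    by (simp flip: mult.assoc)
  also have "\<dots> = desci a s * desc a (Suc s)" unfolding desc_desc[symmetric]
    by (simp add: mult.assoc del: desc.simps desci.simps)
  finally show ?thesis .
qed

text \<open>The shorter braid cancels most of the longer one. In the resulting form the generators
  \<open>R (a + s)\<close> and \<open>R (Suc a + s)\<close> occur once each, so the traces over the
  last two strands can be evaluated.\<close>

lemma pair_braid_quotient:
  "pair_braid a (Suc s) * pair_braid_inv (Suc a) s = desci a s * (R (a + s) * (desc a s * R (Suc a + s)))"
proof -
  have "pair_braid a (Suc s) * pair_braid_inv (Suc a) s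
      = desc a (Suc s) * (desc (Suc a) (Suc s) * desci (Suc (Suc a)) s) * desci (Suc a) s"
    by (simp add: pair_braid_def pair_braid_inv_def mult.assoc del: desc.simps desci.simps)
  also have "\<dots> = (desc a (Suc s) * desci (Suc a) s) * R (Suc a + s)"
    unfolding desc_desci_swap[of "Suc a"] by (subst (2) desc.simps) (simp add: mult.assoc del: desc.simps desci.simps)
  also have "\<dots> = desci a s * (R (a + s) * (desc a s * R (Suc a + s)))"
    unfolding desc_desci_swap by (simp add: mult.assoc)
  finally show ?thesis .
qed

end

context quantum_matrix
begin

section \<open>Traces of antisymmetrizers, matrix powers and their recursions\<close>

definition ach :: "nat \<Rightarrow> 'e" where "ach i = TR 0 i (MP 0 i * asym 0 i)"

lemma ach_E: "ach i \<in> E 0"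
  unfolding ach_def
  by (rule TR_E, cases i) (auto intro!: E_mult MP_E Alg_E[OF Alg_asym] E_one M_E)

primrec FP :: "nat \<Rightarrow> nat \<Rightarrow> 'e" where
  "FP m 0 = 1"
| "FP m (Suc s) = FP m s * F (m + s)"

primrec FPi :: "nat \<Rightarrow> nat \<Rightarrow> 'e" where
  "FPi m 0 = 1"
| "FPi m (Suc s) = Fi (m + s) * FPi m s"

lemma FP_FPi: "FP m s * FPi m s = 1" "FPi m s * FP m s = 1"
proof -
  show "FP m s * FPi m s = 1" by (induction s) (simp_all add: mult.assoc F_Fi_left)
  show "FPi m s * FP m s = 1"
  proof (induction s)
    case (Suc s)
    have "FPi m (Suc s) * FP m (Suc s) = Fi (m + s) * (FPi m s * FP m s) * F (m + s)" by (simp add: mult.assoc)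
    then show ?case using Suc by (simp add: Fi_F)
  qed simp
qed

lemma FP_E: "m + s < n \<Longrightarrow> FP m s \<in> E n" and FPi_E: "m + s < n \<Longrightarrow> FPi m s \<in> E n"
proof -
  have *: "F j \<in> E n \<and> Fi j \<in> E n" if "Suc (Suc j) \<le> n" for j
    using that E_mono[OF F_E] E_mono[OF Fi_E] by blast
  show "m + s < n \<Longrightarrow> FP m s \<in> E n" "m + s < n \<Longrightarrow> FPi m s \<in> E n"
    by (induction s) (use * in \<open>auto intro!: E_one E_mult\<close>)
qed

lemma FP_R: "m \<le> j \<Longrightarrow> Suc j < m + i \<Longrightarrow> FP m i * R j = R (Suc j) * FP m i"
proof (induction i)
  case (Suc i)
  show ?case
  proof (cases "Suc j < m + i")
    case True
    then show ?thesis using Suc F_R_far[of "m + i" j] by (simp add: mult.assoc flip: comm_left) (metis mult.assoc)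
  next
    case False
    define i' where "i' = j - m"
    have i: "i = Suc i'" "j = m + i'" using Suc.prems False by (auto simp: i'_def)
    have far: "R (Suc j) * FP m l = FP m l * R (Suc j)" if "l \<le> i'" for l
      using that by (induction l) (auto simp: i intro!: comm_trans R_F_far)
    have "FP m (Suc i) * R j = FP m i' * (F j * F (Suc j) * R j)" by (simp add: i mult.assoc)
    also have "\<dots> = (FP m i' * R (Suc j)) * (F j * F (Suc j))"
      by (simp only: FFR[symmetric]) (simp only: mult.assoc)
    also have "\<dots> = R (Suc j) * FP m (Suc i)" by (simp only: far[OF order_refl, symmetric]) (simp add: i mult.assoc)
    finally show ?thesis .
  qed
qed simp

lemma FP_asym: "FP m i * asym m i = asym (Suc m) i * FP m i"
  using asym_intertwine[of m i "FP m i" 0 1] FP_R[of m _ i] by simp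

lemma MP_Suc_FP: "MP (Suc m) s = FP m s * (MP m s * FPi m s)"
proof (induction s)
  case (Suc s)
  have c1: "F (m + s) * MP m s = MP m s * F (m + s)" by (rule MP_comm_aux) (auto intro: F_M_above)
  have c2: "M (Suc (m + s)) * FPi m s' = FPi m s' * M (Suc (m + s))" if "s' \<le> s" for s'
    using that
  proof (induction s')
    case (Suc s')
    have "M (Suc (m + s)) * F (m + s') = F (m + s') * M (Suc (m + s))"
      using F_M_below[of "m + s'" "Suc (m + s)"] Suc.prems by simp
    from Fi_intertwine[OF this] Suc show ?case by (simp add: comm_trans)
  qed simp
  have "FP m (Suc s) * (MP m (Suc s) * FPi m (Suc s))
      = FP m s * ((F (m + s) * MP m s) * (M (m + s) * (Fi (m + s) * FPi m s)))"
    by (simp only: FP.simps MP.simps FPi.simps mult.assoc)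
  also have "\<dots> = FP m s * (MP m s * (M (Suc (m + s)) * FPi m s))"
    by (simp only: c1) (simp add: mult.assoc)
  also have "\<dots> = MP (Suc m) s * M (Suc (m + s))"
    by (simp only: c2[OF order_refl] Suc) (simp only: mult.assoc)
  finally show ?case by simp
qed simp

lemma TR_FP: "x \<in> E (m + i) \<Longrightarrow> TR (Suc m) i (FP m i * (x * FPi m i)) = TR m i x"
proof (induction i arbitrary: x)
  case (Suc i)
  have "TR (Suc m) (Suc i) (FP m (Suc i) * (x * FPi m (Suc i)))
      = TR (Suc m) i (T (Suc (m + i)) (FP m i * ((F (m + i) * x * Fi (m + i)) * FPi m i)))"
    by (simp add: mult.assoc)
  also have "\<dots> = TR (Suc m) i (FP m i * (T (Suc (m + i)) (F (m + i) * x * Fi (m + i)) * FPi m i))"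
    by (simp add: T_left T_right FP_E FPi_E)
  also have "\<dots> = TR m (Suc i) x"
    using Suc.prems T_F[of x "m + i"] Suc.IH[of "T (m + i) x"] T_E by simp
  finally show ?case .
qed simp

text \<open>Conjugation by \<open>FP\<close> shifts the copies of \<open>M\<close>, the
  antisymmetrizer and the R-trace by one strand simultaneously, so the value does not depend on
  \<open>m\<close>.\<close>

lemma TR_MP_asym: "TR m i (MP m i * asym m i) = ach i"
proof (induction m)
  case (Suc m)
  have "FPi m i * asym (Suc m) i = FPi m i * (asym (Suc m) i * FP m i) * FPi m i"
    using FP_FPi(1)[of m i] by (simp add: mult.assoc)
  also have "\<dots> = asym m i * FPi m i" by (simp only: FP_asym[symmetric]) (simp add: FP_FPi flip: mult.assoc)
  finally have c: "FPi m i * asym (Suc m) i = asym m i * FPi m i" .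
  have e: "MP m i * asym m i \<in> E (m + i)"
    by (cases i) (auto intro!: E_mult MP_E Alg_E[OF Alg_asym] E_one M_E)
  have "MP (Suc m) i * asym (Suc m) i = FP m i * ((MP m i * asym m i) * FPi m i)"
    by (simp only: MP_Suc_FP c mult.assoc)
  then show ?case using TR_FP[OF e] Suc by simp
qed (simp add: ach_def)

primrec pw :: "nat \<Rightarrow> 'e" where
  "pw 0 = 1"
| "pw (Suc m) = TR 1 m (MP 0 (Suc m) * desc 0 m)"

text \<open>
  For \<open>i = 1\<close> these are \<open>pw (m + 1)\<close> and \<open>inverse \<mu> (pw m) g\<close>; a further strand is moved from the braid
  into the antisymmetrizer at the cost of a product \<open>pw (m + 1) ach i\<close>.
\<close>

definition av :: "nat \<Rightarrow> nat \<Rightarrow> 'e" where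
  "av m i = qnum q i *\<^sub>C TR 1 (m + i - 1) (MP 0 (m + i) * (asym m i * desc 0 m))"

definition bv :: "nat \<Rightarrow> nat \<Rightarrow> 'e" where
  "bv m i = qnum q i *\<^sub>C TR 1 (m + i) (MP 0 (Suc (m + i)) * (asym (Suc m) i * (K m * desc 0 m)))"

lemma asym_desc: "asym (Suc m) i * desc 0 m = desc 0 m * asym (Suc m) i"
  by (rule Alg_far[symmetric, of _ 0 m _ "Suc m" "m + i"]) (auto intro!: Alg_desc Alg_asym)

lemma MP_add: "MP m (s + s') = MP m s * MP (m + s) s'"
  by (induction s') (simp_all add: mult.assoc add_ac)

text \<open>The braid occupies the strands up to \<open>m\<close> and the antisymmetrizer the later
  ones, so the inner traces act on the second group only and produce \<open>ach i\<close>.\<close>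

lemma TR_asym_split:
  "TR 1 (m + i) (MP 0 (Suc (m + i)) * (asym (Suc m) i * desc 0 m)) = pw (Suc m) * ach i"
proof -
  have c: "MP (Suc m) i * desc 0 m = desc 0 m * MP (Suc m) i"
    by (rule Alg_MP_below[of _ 0 m]) (auto intro!: Alg_desc)
  have "MP 0 (Suc (m + i)) * (asym (Suc m) i * desc 0 m)
      = MP 0 (Suc m) * ((MP (Suc m) i * desc 0 m) * asym (Suc m) i)"
    using MP_add[of 0 "Suc m" i] by (simp only: add_Suc add_0 asym_desc mult.assoc)
  also have "\<dots> = (MP 0 (Suc m) * desc 0 m) * (MP (Suc m) i * asym (Suc m) i)"
    by (simp only: c mult.assoc)
  finally have e: "MP 0 (Suc (m + i)) * (asym (Suc m) i * desc 0 m)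
      = (MP 0 (Suc m) * desc 0 m) * (MP (Suc m) i * asym (Suc m) i)" .
  have "MP 0 (Suc m) * desc 0 m \<in> E (Suc m)"
    by (intro E_mult MP_E Alg_E[OF Alg_desc[OF order_refl order_refl]]) auto
  then have "TR 1 (m + i) (MP 0 (Suc (m + i)) * (asym (Suc m) i * desc 0 m))
      = TR 1 m ((MP 0 (Suc m) * desc 0 m) * ach i)"
    unfolding e by (simp add: TR_split TR_left TR_MP_asym)
  also have "\<dots> = pw (Suc m) * ach i"
    using TR_right[of "ach i" 1 m] E_mono[OF ach_E, of 1] by simp
  finally show ?thesis .
qed

text \<open>The second copy of the antisymmetrizer goes around the trace, past all copies of
  \<open>M\<close>, and is swallowed by the first copy. It commutes with the product of the copies
  because that product covers every strand on which it acts.\<close>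

lemma TR_asym_expand:
  assumes i: "i \<le> k" and a: "1 \<le> m" and s: "m + i \<le> Suc s"
    and Y: "asym m i * Y = Y * asym m i"
  shows "TR 1 s (MP 0 (Suc s) * (asym m i * (Z * (asym m i * Y)))) = TR 1 s (MP 0 (Suc s) * (asym m i * (Z * Y)))"
proof (cases "i = 0")
  case False
  have A: "asym m i \<in> Alg m s" by (rule Alg_asym) (use s in auto)
  have "TR 1 s (MP 0 (Suc s) * (asym m i * (Z * (asym m i * Y))))
      = TR 1 s ((MP 0 (Suc s) * (asym m i * (Z * Y))) * asym m i)" by (simp add: Y mult.assoc)
  also have "\<dots> = TR 1 s (asym m i * (MP 0 (Suc s) * (asym m i * (Z * Y))))"
    using TR_cyc[OF A a order_refl] by simp
  also have "\<dots> = TR 1 s (MP 0 (Suc s) * ((asym m i * asym m i) * (Z * Y)))"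
    using comm_left[OF Alg_MP[OF A, of 0 "Suc s"]] by (simp add: mult.assoc del: MP.simps)
  finally show ?thesis using asym_idem[OF i] by simp
qed simp

lemma q_xq: "q ^ i * (xq i - 1) = - (lam * qnum q i)"
proof -
  have "q ^ i * xq i = inverse q ^ i"
    using q0 by (simp add: xq_def mult_2 power_add power_inverse)
  moreover have "lam * qnum q i = q ^ i - inverse q ^ i"
    using lam0 by (simp add: qnum_def lam_def)
  ultimately show ?thesis by (simp add: right_diff_distrib)
qed

definition dn :: "nat \<Rightarrow> complex" where "dn i = q * inverse \<mu> * xq i + 1"

lemma qnum_scale:
  "q ^ i * ((xq i - 1) / lam) = - qnum q i" "q ^ i * ((xq i - 1) / dn i) = - (lam / dn i * qnum q i)"
  using q_xq[of i] lam0 by simp_all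

lemma q_cq: "qnum q (Suc i) \<noteq> 0 \<Longrightarrow> qnum q (Suc i) * cq i = q ^ i"
  by (simp add: cq_def)

lemma Sm_dn: "Sm i x = 1 + ((x - 1) / lam) *\<^sub>C R i + ((x - 1) / (q * inverse \<mu> * x + 1)) *\<^sub>C K i"
  by (rule Sm_def)

lemma TR_Sm_expand:
  "TR 1 (m + i) (MP 0 (Suc (m + i)) * (asym (Suc m) i * (Sm m (xq i) * desc 0 m)))
    = pw (Suc m) * ach i
      + ((xq i - 1) / lam) *\<^sub>C TR 1 (m + i) (MP 0 (Suc (m + i)) * (asym (Suc m) i * desc 0 (Suc m)))
      + ((xq i - 1) / dn i) *\<^sub>C TR 1 (m + i) (MP 0 (Suc (m + i)) * (asym (Suc m) i * (K m * desc 0 m)))"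
  unfolding TR_asym_split[symmetric]
  by (simp add: Sm_dn dn_def distrib_left distrib_right TR_add TR_cs mult.assoc del: MP.simps pw.simps)

text \<open>The antisymmetrizer is opened at its leftmost strand, which is where the braid
  \<open>desc 0 m\<close> ends. Of the three terms of \<open>Sm m\<close>, the first separates the
  two groups of strands, the second lengthens the braid by a crossing, and the third links them by
  \<open>K m\<close>.\<close>

lemma av_Suc:
  assumes "1 \<le> i" "Suc i \<le> k"
  shows "av m (Suc i) = q ^ i *\<^sub>C (pw (Suc m) * ach i) - av (Suc m) i - (lam / dn i) *\<^sub>C bv m i"
proof -
  have qn: "qnum q (Suc i) \<noteq> 0" using qnum0[of "Suc i"] assms by simp
  have "av m (Suc i) = (qnum q (Suc i) * cq i) *\<^sub>C
      TR 1 (m + i) (MP 0 (Suc (m + i)) * (asym (Suc m) i * (Sm m (xq i) * (asym (Suc m) i * desc 0 m))))"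
    unfolding av_def using asym_rev[OF assms(2,1), of m] by (simp add: TR_cs mult.assoc del: MP.simps asym.simps)
  also have "\<dots> = q ^ i *\<^sub>C TR 1 (m + i) (MP 0 (Suc (m + i)) * (asym (Suc m) i * (Sm m (xq i) * desc 0 m)))"
    using TR_asym_expand[of i "Suc m" "m + i" "desc 0 m" "Sm m (xq i)"] assms q_cq[OF qn]
    by (simp add: asym_desc del: MP.simps)
  also have "\<dots> = q ^ i *\<^sub>C (pw (Suc m) * ach i) - av (Suc m) i - (lam / dn i) *\<^sub>C bv m i"
    unfolding TR_Sm_expand cs_add_right cs_cs qnum_scale av_def bv_def
    using assms by (simp del: MP.simps pw.simps desc.simps)
  finally show ?thesis .
qed

text \<open>The relation lives on \<open>k + 1\<close> neighbouring strands, and conjugation by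
  \<open>FP m (Suc k)\<close> moves it up by one strand.\<close>

lemma vanish_shift:
  assumes "asym 1 k * (Sm 0 (xq k) * asym 1 k) = 0"
  shows "asym (Suc m) k * (Sm m (xq k) * asym (Suc m) k) = 0"
proof (induction m)
  case (Suc m)
  let ?w = "FP m (Suc k)" and ?wi = "FPi m (Suc k)"
  have a: "?w * asym (Suc m) k = asym (Suc (Suc m)) k * ?w"
    using asym_intertwine[of m k ?w 1 2] FP_R[of m _ "Suc k"] by (simp del: FP.simps)
  have s: "?w * Sm m (xq k) = Sm (Suc m) (xq k) * ?w" if "k \<noteq> 0"
    using that by (intro intertwine_Sm FP_R) auto
  show ?case
  proof (cases "k = 0")
    case False
    have "asym (Suc (Suc m)) k * (Sm (Suc m) (xq k) * asym (Suc (Suc m)) k) * ?w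
        = asym (Suc (Suc m)) k * (Sm (Suc m) (xq k) * (?w * asym (Suc m) k))" by (simp only: a mult.assoc)
    also have "\<dots> = asym (Suc (Suc m)) k * ((?w * Sm m (xq k)) * asym (Suc m) k)"
      by (simp only: s[OF False] mult.assoc)
    also have "\<dots> = (?w * asym (Suc m) k) * (Sm m (xq k) * asym (Suc m) k)"
      by (simp only: a mult.assoc)
    also have "\<dots> = ?w * (asym (Suc m) k * (Sm m (xq k) * asym (Suc m) k))" by (simp only: mult.assoc)
    also have "\<dots> = 0" unfolding Suc by simp
    finally have "asym (Suc (Suc m)) k * (Sm (Suc m) (xq k) * asym (Suc (Suc m)) k) * ?w * ?wi = 0" by simp
    then show ?thesis using FP_FPi(1)[of m "Suc k"] by (simp only: mult.assoc) simp
  next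
    case True
    \<comment> \<open>For \<open>k = 0\<close> the parameter is 1, so \<open>Sm\<close> is 1 and the
      hypothesis is contradictory.\<close>
    have "Sm 0 1 = 0" using assms by (simp add: True xq_def)
    then have "(1::'e) = 0" by (simp add: Sm_def)
    then show ?thesis by simp
  qed
qed (use assms in simp)

text \<open>The same expansion as for \<open>av_Suc\<close>, but without passing through the
  antisymmetrizer on \<open>k + 1\<close> strands, whose normalization divides by
  \<open>qnum q (Suc k)\<close>. The expanded product is zero by hypothesis.\<close>

lemma av_top:
  assumes "asym 1 k * (Sm 0 (xq k) * asym 1 k) = 0" "1 \<le> k"
  shows "q ^ k *\<^sub>C (pw (Suc m) * ach k) - av (Suc m) k - (lam / dn k) *\<^sub>C bv m k = 0"
proof -
  have "0 = q ^ k *\<^sub>C TR 1 (m + k) (MP 0 (Suc (m + k)) * ((asym (Suc m) k * (Sm m (xq k) * asym (Suc m) k)) * desc 0 m))"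
    unfolding vanish_shift[OF assms(1)] using TR_cs[of 1 "m + k" 0 0] by simp
  also have "\<dots> = q ^ k *\<^sub>C TR 1 (m + k) (MP 0 (Suc (m + k)) * (asym (Suc m) k * (Sm m (xq k) * desc 0 m)))"
    using TR_asym_expand[of k "Suc m" "m + k" "desc 0 m" "Sm m (xq k)"]
    by (simp add: asym_desc mult.assoc del: MP.simps)
  also have "\<dots> = q ^ k *\<^sub>C (pw (Suc m) * ach k) - av (Suc m) k - (lam / dn k) *\<^sub>C bv m k"
    unfolding TR_Sm_expand cs_add_right cs_cs qnum_scale av_def bv_def
    using assms by (simp del: MP.simps pw.simps desc.simps)
  finally show ?thesis by simp
qed

lemma MP_K_last: "MP 0 (Suc (Suc n)) * K n = (inverse \<mu> * inverse \<mu>) *\<^sub>C (MP 0 n * (K n * g))"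
  using KMM[of n] by (simp add: mult.assoc)

text \<open>The cap and cup of \<open>K (Suc l) * K l\<close> travel to the last two strands, where they absorb two
  copies of \<open>M\<close> and leave the factor \<open>g\<close>.\<close>

lemma contraction_step:
  assumes Q: "Q \<in> Alg (Suc (Suc l)) (Suc (Suc (l + j)))" and Qt: "Qt \<in> Alg l (l + j)"
    and WQ: "pair_braid l (Suc j) * Q = Qt * pair_braid l (Suc j)"
  shows "TR 1 (Suc (Suc (l + j))) (MP 0 (Suc (Suc (Suc (l + j)))) * (Q * (K (Suc l) * (K l * desc 0 l))))
    = TR 1 (l + j) (MP 0 (Suc (l + j)) * (Qt * desc 0 l)) * g"
proof -
  define n where "n = Suc (l + j)"
  define S where "S = TR 1 (Suc n)"
  define MM where "MM = MP 0 (Suc (Suc n))"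
  define X where "X = desc 0 l"
  define W where "W = pair_braid l (Suc j)"
  define Wi where "Wi = pair_braid_inv (Suc l) j"
  define V where "V = desci l j * (R (l + j) * desc l j)"
  have XA: "X \<in> Alg 0 l" unfolding X_def by (rule Alg_desc) auto
  have WiA: "Wi \<in> Alg (Suc l) (Suc n)" unfolding Wi_def n_def by (rule Alg_pair_braid_inv) auto
  have RA: "R n \<in> Alg (Suc l) (Suc n)" by (rule Alg.R) (auto simp: n_def)
  have QKl: "K l * Q = Q * K l" by (rule Alg_far[OF Alg_K[of l l "Suc l"] Q]) auto
  have QX: "X * Q = Q * X" by (rule Alg_far[OF XA Q]) auto
  have WiX: "X * Wi = Wi * X" by (rule Alg_far[OF XA WiA]) auto
  have RX: "X * R n = R n * X" by (rule Alg_far[OF XA RA]) auto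
  have QM: "MM * Q = Q * MM" unfolding MM_def by (rule Alg_MP[OF Q]) (auto simp: n_def)
  have WiM: "MM * Wi = Wi * MM" unfolding MM_def by (rule Alg_MP[OF WiA]) auto
  have RM: "MM * R n = R n * MM" unfolding MM_def by (rule Alg_MP[OF RA]) auto
  have VA: "V \<in> Alg l n" unfolding V_def
    by (intro Alg.mult Alg_desci Alg_desc Alg.R) (auto simp: n_def)
  have KK: "K (Suc l) * K l = Wi * (K n * W)"
    unfolding Wi_def W_def n_def using KK_pair_braid[of l j] by simp
  have quot: "W * Wi = V * R n"
    unfolding Wi_def W_def n_def V_def using pair_braid_quotient[of l j] by (simp add: mult.assoc)
  \<comment> \<open>\<open>Q\<close> goes around the trace so as to re-enter on the right of the
    contractors, where \<open>W\<close> carries it down by two strands and makes it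
    \<open>Qt\<close>. Then \<open>Wi\<close> goes around to meet \<open>W\<close>, and finally
    \<open>R n\<close>, one of the two factors of \<open>W * Wi\<close>, goes around to meet
    \<open>K n\<close>.\<close>
  have "S (MM * (Q * (K (Suc l) * (K l * X)))) = S (Q * (MM * (K (Suc l) * (K l * X))))"
    by (simp only: comm_left[OF QM])
  also have "\<dots> = S ((MM * (K (Suc l) * (K l * X))) * Q)"
    unfolding S_def by (rule TR_cyc[OF Q]) (auto simp: n_def)
  also have "\<dots> = S (MM * ((K (Suc l) * K l) * (Q * X)))" by (simp only: QX mult.assoc)
  also have "\<dots> = S (MM * (Wi * (K n * ((W * Q) * X))))" by (simp only: KK mult.assoc)
  also have "\<dots> = S (Wi * (MM * (K n * (Qt * (W * X)))))"
    by (simp only: WQ[folded W_def]) (simp only: comm_left[OF WiM] mult.assoc)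
  also have "\<dots> = S ((MM * (K n * (Qt * (W * X)))) * Wi)"
    unfolding S_def by (rule TR_cyc[OF WiA]) (auto simp: n_def)
  also have "\<dots> = S (MM * (K n * (Qt * ((W * Wi) * X))))" by (simp only: WiX mult.assoc)
  also have "\<dots> = S ((MM * (K n * (Qt * (V * X)))) * R n)"
    by (simp only: quot) (simp only: RX mult.assoc)
  also have "\<dots> = S (R n * (MM * (K n * (Qt * (V * X)))))"
    unfolding S_def by (rule TR_cyc[OF RA, symmetric]) (auto simp: n_def)
  also have "\<dots> = S (MM * ((R n * K n) * (Qt * (V * X))))"
    by (simp only: comm_left[OF RM, symmetric] mult.assoc)
  also have "\<dots> = \<mu> *\<^sub>C S ((MM * K n) * (Qt * (V * X)))"
    by (simp add: K_R_comm S_def TR_cs mult.assoc)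
  also have "\<dots> = inverse \<mu> *\<^sub>C S (MP 0 n * (K n * (g * (Qt * (V * X)))))"
  proof -
    have "\<mu> * (inverse \<mu> * inverse \<mu>) = inverse \<mu>" using mu0 by simp
    then show ?thesis unfolding MM_def MP_K_last S_def
      by (simp only: mult_cs_left TR_cs cs_cs mult.assoc)
  qed
  also have "g * (Qt * (V * X)) = (Qt * (V * X)) * g"
    by (intro comm_trans Alg_E0[OF Qt g_E] Alg_E0[OF VA g_E] Alg_E0[OF XA g_E])
  also have "S (MP 0 n * (K n * (Qt * (V * X) * g))) = S ((MP 0 n * (K n * (Qt * (V * X)))) * g)"
    by (simp only: mult.assoc)
  also have "\<dots> = S (MP 0 n * (K n * (Qt * (V * X)))) * g"
    unfolding S_def by (rule TR_right) (rule E_mono[OF g_E], simp)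
  \<comment> \<open>Closing the strand \<open>Suc n\<close> through \<open>K n\<close> gives
    \<open>\<mu>\<close>. This cancels the \<open>inverse \<mu>\<close> that is left from
    \<open>R n * K n\<close> (factor \<open>\<mu>\<close>) and from the two absorbed copies of
    \<open>M\<close> (factor \<open>inverse \<mu> * inverse \<mu>\<close>).\<close>
  also have "S (MP 0 n * (K n * (Qt * (V * X)))) = \<mu> *\<^sub>C TR 1 n (MP 0 n * (Qt * (V * X)))"
  proof -
    have M1: "MP 0 n \<in> E (Suc n)" by (rule MP_E) simp
    have Q1: "Qt * (V * X) \<in> E (Suc n)"
      by (intro E_mult Alg_E[OF Qt] Alg_E[OF VA] Alg_E[OF XA]) (auto simp: n_def)
    have "T (Suc n) (MP 0 n * (K n * (Qt * (V * X)))) = MP 0 n * (T (Suc n) (K n) * (Qt * (V * X)))"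
      by (simp only: T_left[OF M1] T_right[OF Q1])
    then show ?thesis by (simp add: S_def T_K TR_cs)
  qed
  also have "TR 1 n (MP 0 n * (Qt * (V * X))) = TR 1 (l + j) (MP 0 n * (Qt * X))"
  proof -
    have M1: "MP 0 n \<in> E n" by (rule MP_E) simp
    have Q1: "Qt \<in> E n" by (rule Alg_E[OF Qt]) (simp add: n_def)
    have X1: "X \<in> E n" by (rule Alg_E[OF XA]) (simp add: n_def)
    have D: "desci l j \<in> E n" "desc l j \<in> E n"
      by (rule Alg_E[OF Alg_desci[OF order_refl order_refl]] Alg_E[OF Alg_desc[OF order_refl order_refl]]; simp add: n_def)+
    \<comment> \<open>Strand \<open>n\<close> enters \<open>V\<close> only through the single
      crossing \<open>R (l + j)\<close>, so closing it gives 1 and the two braids around that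
      crossing cancel.\<close>
    have "T n V = desci l j * (T n (R (l + j)) * desc l j)"
      unfolding V_def by (simp only: T_left[OF D(1)] T_right[OF D(2)])
    then have TV: "T n V = 1" using T_R[of "l + j"] by (simp add: n_def)
    have "T n (MP 0 n * (Qt * (V * X))) = MP 0 n * (Qt * (T n V * X))"
      by (simp only: T_left[OF M1] T_left[OF Q1] T_right[OF X1])
    then have "T n (MP 0 n * (Qt * (V * X))) = MP 0 n * (Qt * X)" by (simp only: TV mult_1_left)
    moreover have "TR 1 n x = TR 1 (l + j) (T n x)" for x by (simp add: n_def)
    ultimately show ?thesis by simp
  qed
  finally show ?thesis using mu0 by (simp add: S_def MM_def n_def X_def del: MP.simps)
qed

lemma pair_braid_asym:
  "pair_braid l (Suc i) * asym (Suc (Suc (Suc l))) i = asym (Suc l) i * pair_braid l (Suc i)"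
  using asym_intertwine[of "Suc l" i "pair_braid l (Suc i)" 2 0] pair_braid_shift[of l _ "Suc i"]
  by simp

text \<open>The antisymmetrizer is again opened at its left end, and \<open>G Y\<close> is the trace
  with \<open>Y\<close> in place of the Baxterized factor. Replacing \<open>K (Suc m) * R m\<close>
  by \<open>K (Suc m) * K m * Ri (Suc m)\<close> and sending the inverse crossing around the trace
  turns \<open>Y\<close> into an operator \<open>Z\<close> beyond the contracted pair. Then
  \<open>contraction_step\<close> removes the pair, lowers \<open>Z\<close> by two strands and
  releases \<open>g\<close>.\<close>

lemma bv_Suc:
  assumes i: "1 \<le> i" "Suc i \<le> k"
  shows "bv (Suc m) (Suc i) = ((inverse \<mu> * inverse q ^ i) *\<^sub>C (pw (Suc m) * ach i)
    + (lam - lam / dn i) *\<^sub>C av (Suc m) i - bv m i) * g"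
proof -
  define P where "P = asym (Suc (Suc (Suc m))) i"
  define P' where "P' = asym (Suc m) i"
  define X where "X = desc 0 m"
  define s where "s = Suc (Suc (m + i))"
  define G where "G Y = TR 1 s (MP 0 (Suc s) * (P * (Y * (K (Suc m) * (R m * X)))))" for Y
  define H where "H Z = TR 1 (m + i) (MP 0 (Suc (m + i)) * (P' * (Z * X))) * g" for Z
  have qn: "qnum q (Suc i) \<noteq> 0" using qnum0[of "Suc i"] i by simp
  have adjm: "adj m (Suc m)" "adj (Suc m) m" "adj (Suc (Suc m)) (Suc m)" "adj (Suc m) (Suc (Suc m))"
    by (auto simp: adj_def)
  have PA: "P \<in> Alg (Suc (Suc (Suc m))) s" unfolding P_def s_def by (rule Alg_asym) (use i in auto)
  have P'A: "P' \<in> Alg (Suc m) (m + i)" unfolding P'_def by (rule Alg_asym) (use i in auto)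
  have XA: "X \<in> Alg 0 m" unfolding X_def by (rule Alg_desc) auto
  have YA: "K (Suc m) * (R m * X) \<in> Alg 0 (Suc (Suc m))"
    by (intro Alg.mult Alg_K Alg.R Alg_mono[OF XA]) auto
  have RiA: "Ri (Suc m) \<in> Alg (Suc m) (Suc (Suc m))" by (rule Alg.Ri) auto
  have RiX: "X * Ri (Suc m) = Ri (Suc m) * X" by (rule Alg_far[OF XA RiA]) auto
  have RiP: "Ri (Suc m) * P = P * Ri (Suc m)" by (rule Alg_far[OF RiA PA]) auto
  have RiM: "MP 0 (Suc s) * Ri (Suc m) = Ri (Suc m) * MP 0 (Suc s)"
    by (rule Alg_MP[OF RiA]) (auto simp: s_def)
  have KR: "K (Suc m) * R m = K (Suc m) * (K m * Ri (Suc m))"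
    using arg_cong[OF KK_KRR[OF adjm(1)], of "\<lambda>z. z * Ri (Suc m)"] by (simp add: mult.assoc)
  have reduce: "G Y = TR 1 s (MP 0 (Suc s) * ((P * Z) * (K (Suc m) * (K m * X))))"
    if Z: "Ri (Suc m) * (Y * K (Suc m)) = Z * K (Suc m)" for Y Z
  proof -
    have "G Y = TR 1 s (MP 0 (Suc s) * (P * (Y * ((K (Suc m) * R m) * X))))" by (simp only: G_def mult.assoc)
    also have "\<dots> = TR 1 s ((MP 0 (Suc s) * (P * (Y * (K (Suc m) * (K m * X))))) * Ri (Suc m))"
      by (simp only: KR) (simp only: RiX mult.assoc)
    also have "\<dots> = TR 1 s (Ri (Suc m) * (MP 0 (Suc s) * (P * (Y * (K (Suc m) * (K m * X))))))"
      by (rule TR_cyc[OF RiA, symmetric]) (auto simp: s_def)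
    also have "\<dots> = TR 1 s (MP 0 (Suc s) * (P * ((Ri (Suc m) * (Y * K (Suc m))) * (K m * X))))"
      by (simp only: comm_left[OF RiM, symmetric] comm_left[OF RiP] mult.assoc)
    finally show ?thesis by (simp only: Z) (simp only: mult.assoc)
  qed
  have key: "TR 1 s (MP 0 (Suc s) * ((P * Z) * (K (Suc m) * (K m * X)))) = H Z'"
    if Z: "Z \<in> Alg (Suc (Suc m)) s" "Z' \<in> Alg m (m + i)"
      "pair_braid m (Suc i) * Z = Z' * pair_braid m (Suc i)" for Z Z'
  proof -
    have Q: "P * Z \<in> Alg (Suc (Suc m)) s" by (intro Alg.mult Z Alg_mono[OF PA]) auto
    have Q': "P' * Z' \<in> Alg m (m + i)" by (intro Alg.mult Z Alg_mono[OF P'A]) auto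
    have "pair_braid m (Suc i) * (P * Z) = (P' * pair_braid m (Suc i)) * Z"
      unfolding P_def P'_def by (simp only: pair_braid_asym flip: mult.assoc)
    also have "\<dots> = (P' * Z') * pair_braid m (Suc i)" by (simp only: Z(3) mult.assoc)
    finally show ?thesis
      using contraction_step[OF Q[unfolded s_def] Q'] by (simp only: H_def s_def X_def mult.assoc)
  qed
  have RR: "pair_braid m (Suc i) * R (Suc (Suc m)) = R m * pair_braid m (Suc i)"
    by (rule pair_braid_shift) (use i in auto)
  have G1: "G 1 = inverse \<mu> *\<^sub>C H 1"
  proof -
    have "G 1 = TR 1 s (MP 0 (Suc s) * ((P * (inverse \<mu> *\<^sub>C 1)) * (K (Suc m) * (K m * X))))"
      by (rule reduce) (simp add: Ri_K)
    also have "\<dots> = inverse \<mu> *\<^sub>C TR 1 s (MP 0 (Suc s) * ((P * 1) * (K (Suc m) * (K m * X))))"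
      by (simp add: TR_cs del: MP.simps)
    also have "\<dots> = inverse \<mu> *\<^sub>C H 1" by (subst key) (auto intro: Alg.one)
    finally show ?thesis .
  qed
  have GRi: "G (Ri (Suc (Suc m))) = H (K m)"
  proof -
    have "G (Ri (Suc (Suc m))) = TR 1 s (MP 0 (Suc s) * ((P * K (Suc (Suc m))) * (K (Suc m) * (K m * X))))"
      by (rule reduce) (use KK_RiRiK[OF adjm(4)] in simp)
    also have "\<dots> = H (K m)"
      by (rule key) (use i intertwine_K[OF RR] in \<open>auto intro!: Alg_K simp: s_def\<close>)
    finally show ?thesis .
  qed
  have GK: "G (K (Suc (Suc m))) = H (R m)"
  proof -
    have "Ri (Suc m) * (K (Suc (Suc m)) * K (Suc m)) = R (Suc (Suc m)) * K (Suc m)"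
      by (simp add: KK_RRK[OF adjm(4)])
    then have "G (K (Suc (Suc m))) = TR 1 s (MP 0 (Suc s) * ((P * R (Suc (Suc m))) * (K (Suc m) * (K m * X))))"
      by (rule reduce)
    also have "\<dots> = H (R m)"
      by (rule key) (use i RR in \<open>auto intro!: Alg.R simp: s_def\<close>)
    finally show ?thesis .
  qed
  have G_lin: "G (a + b) = G a + G b" "G (c *\<^sub>C a) = c *\<^sub>C G a" for a b c
    by (simp_all add: G_def distrib_left distrib_right TR_add TR_cs del: MP.simps)
  \<comment> \<open>The tangle relation used in \<open>reduce\<close> applies to the inverse
    crossing, so the crossing itself is rewritten through its inverse, 1 and
    \<open>K\<close>.\<close>
  have GR: "G (R (Suc (Suc m))) = H (K m) + lam *\<^sub>C (inverse \<mu> *\<^sub>C H 1) - lam *\<^sub>C H (R m)"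
  proof -
    have "R (Suc (Suc m)) = Ri (Suc (Suc m)) + lam *\<^sub>C 1 + (- lam) *\<^sub>C K (Suc (Suc m))"
      by (simp add: Ri_eq)
    then have "G (R (Suc (Suc m))) = G (Ri (Suc (Suc m))) + lam *\<^sub>C G 1 + (- lam) *\<^sub>C G (K (Suc (Suc m)))"
      by (simp only: G_lin)
    then show ?thesis by (simp add: GRi G1 GK)
  qed
  have H1: "H 1 = pw (Suc m) * ach i * g"
    unfolding H_def P'_def X_def mult_1_left TR_asym_split ..
  have HK: "qnum q i *\<^sub>C H (K m) = bv m i * g"
    by (simp add: H_def bv_def P'_def X_def del: MP.simps)
  have HR: "qnum q i *\<^sub>C H (R m) = av (Suc m) i * g"
    using i by (simp add: H_def av_def P'_def X_def del: MP.simps)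
  have "bv (Suc m) (Suc i) = (qnum q (Suc i) * cq i) *\<^sub>C
      TR 1 s (MP 0 (Suc s) * (P * (Sm (Suc (Suc m)) (xq i) * (P * (K (Suc m) * (R m * X))))))"
    unfolding bv_def using asym_rev[OF i(2,1), of "Suc (Suc m)"]
    by (simp add: TR_cs P_def X_def s_def mult.assoc del: MP.simps asym.simps)
  also have "\<dots> = q ^ i *\<^sub>C G (Sm (Suc (Suc m)) (xq i))"
  proof -
    have "P * (K (Suc m) * (R m * X)) = (K (Suc m) * (R m * X)) * P"
      using Alg_far[OF YA PA] by simp
    then show ?thesis
      unfolding q_cq[OF qn] G_def P_def
      by (subst TR_asym_expand) (use i in \<open>auto simp: s_def\<close>)
  qed
  also have "G (Sm (Suc (Suc m)) (xq i)) = G 1 + ((xq i - 1) / lam) *\<^sub>C G (R (Suc (Suc m)))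
      + ((xq i - 1) / dn i) *\<^sub>C G (K (Suc (Suc m)))"
    by (simp only: Sm_def dn_def G_lin)
  also have "q ^ i *\<^sub>C \<dots> = q ^ i *\<^sub>C G 1 + (- qnum q i) *\<^sub>C G (R (Suc (Suc m)))
      + (- (lam / dn i * qnum q i)) *\<^sub>C G (K (Suc (Suc m)))"
    by (simp only: cs_add_right cs_cs qnum_scale)
  also have "\<dots> = ((q ^ i - lam * qnum q i) * inverse \<mu>) *\<^sub>C H 1
      + (lam - lam / dn i) *\<^sub>C (qnum q i *\<^sub>C H (R m)) - qnum q i *\<^sub>C H (K m)"
    unfolding GR G1 GK
    by (simp add: cs_add_right cs.scale_right_diff_distrib cs_add_left cs.scale_left_diff_distrib algebra_simps)
  also have "q ^ i - lam * qnum q i = inverse q ^ i"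
    using lam0 by (simp add: qnum_def lam_def)
  finally show ?thesis
    unfolding H1 HK HR by (simp add: left_diff_distrib distrib_right mult_ac)
qed

lemma av_1: "av m 1 = pw (Suc m)"
proof -
  have "qnum q 1 = 1" using lam0 by (simp add: qnum_def lam_def)
  then show ?thesis by (simp add: av_def)
qed

text \<open>One strand more is traced here than in the definition of \<open>pw m\<close>. It carries
  no copy of \<open>M\<close> and is closed through the last crossing, which contributes 1.\<close>

lemma TR_MP_desc: "TR 1 m (MP 0 m * desc 0 m) = pw m"
proof (cases m)
  case (Suc m')
  have M1: "MP 0 (Suc m') \<in> E (Suc m')" by (rule MP_E) simp
  have D1: "desc 0 m' \<in> E (Suc m')" by (rule Alg_E[OF Alg_desc[OF order_refl order_refl]]) simp
  have "T (Suc m') (MP 0 (Suc m') * (R m' * desc 0 m')) = MP 0 (Suc m') * (T (Suc m') (R m') * desc 0 m')"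
    by (simp only: T_left[OF M1] T_right[OF D1])
  then show ?thesis by (simp add: Suc T_R del: MP.simps)
qed simp

lemma bv_1: "bv m 1 = inverse \<mu> *\<^sub>C (pw m * g)"
proof -
  have q1: "qnum q (Suc 0) = 1" using lam0 by (simp add: qnum_def lam_def)
  have gD: "g * desc 0 m = desc 0 m * g" by (rule Alg_E0[OF Alg_desc[OF order_refl order_refl] g_E])
  have M1: "MP 0 m \<in> E (Suc m)" by (rule MP_E) simp
  have D1: "desc 0 m \<in> E (Suc m)" by (rule Alg_E[OF Alg_desc[OF order_refl order_refl]]) simp
  have g1: "g \<in> E 1" by (rule E_mono[OF g_E]) simp
  have TK: "T (Suc m) (MP 0 m * (K m * desc 0 m)) = \<mu> *\<^sub>C (MP 0 m * desc 0 m)"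
    by (simp add: T_left[OF M1] T_right[OF D1] T_K)
  have "bv m 1 = TR 1 (Suc m) ((MP 0 (Suc (Suc m)) * K m) * desc 0 m)"
    by (simp add: bv_def q1 mult.assoc del: MP.simps TR.simps)
  also have "\<dots> = (inverse \<mu> * inverse \<mu>) *\<^sub>C TR 1 (Suc m) ((MP 0 m * (K m * desc 0 m)) * g)"
    unfolding MP_K_last by (simp add: TR_cs mult.assoc gD del: MP.simps TR.simps)
  also have "\<dots> = (inverse \<mu> * inverse \<mu>) *\<^sub>C (TR 1 m (T (Suc m) (MP 0 m * (K m * desc 0 m))) * g)"
    using TR_right[OF g1, of m] T_right[OF E_mono[OF g_E, of "Suc m"]] by (simp del: MP.simps)
  also have "\<dots> = (inverse \<mu> * inverse \<mu> * \<mu>) *\<^sub>C (pw m * g)"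
    unfolding TK using TR_MP_desc[of m] by (simp add: TR_cs)
  also have "inverse \<mu> * inverse \<mu> * \<mu> = inverse \<mu>" using mu0 by simp
  finally show ?thesis .
qed

text \<open>The coefficients \<open>al p s\<close> and \<open>bp p s\<close> solve the two-term recursion that results from
  eliminating \<open>av\<close> and \<open>bv\<close> level by level; \<open>p\<close> counts the levels down from \<open>k\<close>.\<close>

definition al :: "nat \<Rightarrow> nat \<Rightarrow> complex" where
  "al p s = (q ^ (2 * (p - s)) - 1) / (q ^ (2 * p) - 1)"

definition bp :: "nat \<Rightarrow> nat \<Rightarrow> complex" where
  "bp p s = q * (q ^ (2 * s) - 1) / (q ^ (2 * s) * (q ^ (2 * p) - 1))"

text \<open>In the symplectic case \<open>cc (Suc p)\<close> is the coefficient
  \<open>lam / dn (k - p)\<close> of both recursions, see \<open>cc_dn\<close>.\<close>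

definition cc :: "nat \<Rightarrow> complex" where "cc p = lam / (1 - q ^ (2 * p))"

text \<open>The first two identities describe how the coefficients change when \<open>av_Suc\<close>
  and \<open>bv_Suc\<close> are substituted at level \<open>p\<close>; the third gives the total
  weight of the product terms. All three are rational identities in \<open>q ^ (2 * s)\<close>,
  \<open>q ^ (2 * (p - s))\<close> and \<open>q * q\<close>.\<close>

lemma level_coeffs:
  assumes "s \<le> p" and n: "q ^ (2 * p) \<noteq> 1" "q ^ (2 * Suc p) \<noteq> 1"
  shows "al (Suc p) s = al p s + (lam - cc (Suc p)) * bp p s / (q * q)"
    "bp (Suc p) (Suc s) = bp p s / (q * q) - cc (Suc p) * al p s"
    "al p s + q ^ (2 * p) * bp p s / q = 1"
proof -
  define A where "A = q ^ (2 * s)"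
  define B where "B = q ^ (2 * (p - s))"
  define Q where "Q = q * q"
  have "2 * p = 2 * s + 2 * (p - s)" using assms(1) by simp
  then have p: "q ^ (2 * p) = A * B" by (simp only: A_def B_def power_add)
  have ps: "q ^ (2 * Suc p) = A * B * Q" "q ^ (2 * (Suc p - s)) = B * Q" "q ^ (2 * Suc s) = A * Q"
    using p assms(1) by (simp_all add: A_def B_def Q_def Suc_diff_le)
  have nz: "A \<noteq> 0" "B \<noteq> 0" "Q \<noteq> 0" using q0 by (simp_all add: A_def B_def Q_def)
  have n1: "A * B - 1 \<noteq> 0" "A * B * Q - 1 \<noteq> 0" "1 - A * B * Q \<noteq> 0" using n unfolding p ps by simp_all
  have l: "lam = (Q - 1) / q" using q0 by (simp add: lam_def Q_def field_simps)
  note defs = al_def bp_def cc_def p ps l A_def[symmetric] B_def[symmetric] Q_def[symmetric]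
  have l1: "(Q - 1) / q - (Q - 1) / q / (1 - A * B * Q) = (Q - 1) * (A * B * Q) / (q * (A * B * Q - 1))"
    using q0 n1 by (simp add: divide_simps) (simp add: algebra_simps)
  have e1: "(lam - cc (Suc p)) * bp p s / (q * q) = B * (Q - 1) * (A - 1) / ((A * B - 1) * (A * B * Q - 1))"
    unfolding defs l1 using q0 n1 nz by (simp add: divide_simps)
  show "al (Suc p) s = al p s + (lam - cc (Suc p)) * bp p s / (q * q)"
    unfolding e1 unfolding defs using n1 by (simp add: divide_simps) (simp add: algebra_simps)
  have e2: "cc (Suc p) * al p s = - ((Q - 1) * (B - 1) / (q * (A * B * Q - 1) * (A * B - 1)))"
    unfolding defs using q0 n1 by (simp add: divide_simps) (simp add: algebra_simps)
  have e3: "bp p s / (q * q) = (A - 1) / (q * A * (A * B - 1))"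
    unfolding defs using q0 n1 nz by (simp add: divide_simps Q_def)
  have e4: "bp (Suc p) (Suc s) = (A * Q - 1) / (q * A * (A * B * Q - 1))"
    unfolding defs using q0 n1 nz by (simp add: divide_simps Q_def)
  show "bp (Suc p) (Suc s) = bp p s / (q * q) - cc (Suc p) * al p s"
    unfolding e2 e3 e4 using q0 n1 nz by (simp add: divide_simps) (simp add: algebra_simps)
  have e5: "q ^ (2 * p) * bp p s / q = B * (A - 1) / (A * B - 1)"
    unfolding defs using q0 n1 nz by (simp add: divide_simps)
  show "al p s + q ^ (2 * p) * bp p s / q = 1"
    unfolding e5 unfolding defs using n1 by (simp add: divide_simps) (simp add: algebra_simps)
qed

end

section \<open>Downward elimination in the symplectic case\<close>

locale symplectic_quantum_matrix = quantum_matrix q \<mu> R Ri K k F Fi E T M0 g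
  for q \<mu> :: complex and R Ri K :: "nat \<Rightarrow> 'e::calgebra" and k F Fi E T M0 g +
  assumes mu_eq: "\<mu> = - (inverse q ^ (2 * k + 1))" and k1: "1 \<le> k"
    and vanish: "asym 1 k * (Sm 0 (xq k) * asym 1 k) = 0"
begin

lemma inv_mu: "inverse \<mu> = - (q ^ (2 * k + 1))"
  using q0 by (simp add: mu_eq power_inverse)

lemma dn_eq: assumes "p \<le> k" shows "dn (k - p) = 1 - q ^ (2 * Suc p)"
proof -
  have "q * q ^ (2 * k + 1) * inverse q ^ (2 * (k - p)) = q ^ (2 * Suc p) * (q ^ (2 * (k - p)) * inverse q ^ (2 * (k - p)))"
  proof -
    have "Suc (2 * k + 1) = 2 * Suc p + 2 * (k - p)" using assms by simp
    then show ?thesis by (metis power_Suc power_add mult.assoc)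
  qed
  also have "\<dots> = q ^ (2 * Suc p)" using q0 by (simp add: power_inverse)
  finally show ?thesis by (simp add: dn_def inv_mu xq_def)
qed

lemma cc_dn: "p \<le> k \<Longrightarrow> cc (Suc p) = lam / dn (k - p)"
  by (simp add: cc_def dn_eq)

lemma q_pow_ne: assumes "1 \<le> p" "p \<le> k" shows "q ^ (2 * p) \<noteq> 1"
  using den0[of "Suc k - p"] dn_eq[of "p - 1"] assms by (simp add: dn_def Suc_diff_le flip: power_Suc)

text \<open>Up to the factor \<open>(- q) ^ j\<close>, these are the terms of the final identity
  that contain \<open>ach j\<close>. At the upper limit \<open>s = k - j\<close> the power of
  \<open>M\<close> has dropped to \<open>j\<close>.\<close>

definition Hs :: "nat \<Rightarrow> 'e" where
  "Hs j = (\<Sum>s\<le>k - j. q ^ (2 * s) *\<^sub>C (pw (2 * k - j - 2 * s) * ach j * g ^ s))"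

text \<open>Level \<open>p\<close> works with antisymmetrizers on \<open>k + 1 - p\<close> strands.
  The indices are fixed by homogeneity: counting \<open>g\<close> as degree two, every term has
  degree \<open>2 * k\<close> in \<open>M\<close>.\<close>

definition term_s :: "nat \<Rightarrow> nat \<Rightarrow> 'e" where
  "term_s p s = q ^ (2 * s) *\<^sub>C ((al p s *\<^sub>C av (k + p - 1 - 2 * s) (k + 1 - p)
     - bp p (Suc s) *\<^sub>C bv (k + p - 2 - 2 * s) (k + 1 - p)) * g ^ s)"

definition Ssum :: "nat \<Rightarrow> 'e" where "Ssum p = (\<Sum>s<p. term_s p s)"

text \<open>The formulas for \<open>bv\<close> release one factor \<open>g\<close> more than those
  for \<open>av\<close>, so their contributions belong to the index \<open>Suc s\<close>. The
  boundary coefficients vanish, which lets both families share one range.\<close>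

lemma sum_shift_collect:
  fixes X Y :: "nat \<Rightarrow> 'e"
  assumes "X p = 0" "Y 0 = 0"
  shows "(\<Sum>s<p. X s - Y (Suc s)) = (\<Sum>s<Suc p. X s - Y s)"
proof -
  have "(\<Sum>s<p. X s) = (\<Sum>s<Suc p. X s)" using assms by simp
  moreover have "(\<Sum>s<p. Y (Suc s)) = (\<Sum>s<Suc p. Y s)"
    by (subst sum.lessThan_Suc_shift) (simp add: assms)
  ultimately show ?thesis by (simp only: sum_subtractf)
qed

lemma al_self [simp]: "al p p = 0" and bp_0 [simp]: "bp p 0 = 0"
  by (simp_all add: al_def bp_def)

lemma bp_pow: "q ^ (2 * s) * bp p (Suc s) = q ^ (2 * Suc s) * (bp p (Suc s) / (q * q))"
  using q0 by simp

lemma mu_pow: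
  assumes "p \<le> k"
  shows "inverse \<mu> * inverse q ^ (k - p) = - (q ^ (k - p) * q ^ (2 * p) * q)"
proof -
  have "q ^ (2 * k + 1) * inverse q ^ (k - p) = q ^ (k - p) * q ^ (2 * p) * q * (q ^ (k - p) * inverse q ^ (k - p))"
  proof -
    have "2 * k + 1 = (k - p) + 2 * p + 1 + (k - p)" using assms by simp
    then have "q ^ (2 * k + 1) = q ^ (k - p) * q ^ (2 * p) * q ^ 1 * q ^ (k - p)" by (metis power_add)
    then show ?thesis using q0 by (simp add: mult_ac)
  qed
  also have "\<dots> = q ^ (k - p) * q ^ (2 * p) * q" using q0 by (simp add: power_inverse)
  finally show ?thesis by (simp add: inv_mu)
qed

text \<open>Both recursions contribute the same product of \<open>pw\<close>, \<open>ach\<close> and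
  powers of \<open>g\<close>. The value of \<open>\<mu>\<close> makes the two weights comparable,
  and they add up as in the third identity of \<open>level_coeffs\<close>.\<close>

lemma pw_coeff:
  assumes "s \<le> p" "1 \<le> p" "p \<le> k"
  shows "al p s * q ^ (k - p) - bp p s / (q * q) * (inverse \<mu> * inverse q ^ (k - p)) = q ^ (k - p)"
proof -
  have n: "q ^ (2 * p) \<noteq> 1" using assms q_pow_ne by blast
  have "al p s + q ^ (2 * p) * bp p s / q = 1"
  proof (cases "p = k")
    case False
    then show ?thesis using level_coeffs(3)[of s p] n q_pow_ne[of "Suc p"] assms by simp
  next
    \<comment> \<open>The hypothesis \<open>q ^ (2 * Suc p) \<noteq> 1\<close> of
      \<open>level_coeffs\<close> is not at hand for \<open>p = k\<close>. The identity needed here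
      involves only \<open>q ^ (2 * p)\<close> and is computed directly.\<close>
    case True
    define A where "A = q ^ (2 * s)"
    define B where "B = q ^ (2 * (p - s))"
    have "2 * p = 2 * s + 2 * (p - s)" using assms(1) by simp
    then have p: "q ^ (2 * p) = A * B" by (simp only: A_def B_def power_add)
    have "A \<noteq> 0" "A * B \<noteq> 1" using q0 n p by (simp_all add: A_def)
    then show ?thesis unfolding al_def bp_def p unfolding A_def[symmetric] B_def[symmetric]
      using q0 by (simp add: divide_simps) (simp add: algebra_simps)
  qed
  then have "q ^ (k - p) * (al p s + q ^ (2 * p) * bp p s / q) = q ^ (k - p)" by simp
  moreover have "bp p s / (q * q) * (q ^ (k - p) * q ^ (2 * p) * q) = q ^ (k - p) * (q ^ (2 * p) * bp p s / q)"
    using q0 by (simp add: field_simps)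
  ultimately show ?thesis unfolding mu_pow[OF assms(3)] by (simp add: distrib_left mult_ac)
qed

text \<open>After the recursions are substituted, the product terms collect into \<open>Hs\<close>,
  and the remaining \<open>av\<close> and \<open>bv\<close> terms have, with the opposite sign,
  exactly the coefficients of the next level.\<close>

lemma Ssum_step:
  assumes p: "1 \<le> p" "p < k"
  shows "Ssum p = q ^ (k - p) *\<^sub>C Hs (k - p) - Ssum (Suc p)"
proof -
  define i where "i = k - p"
  define c where "c = cc (Suc p)"
  define w where "w = inverse \<mu> * inverse q ^ i"
  define U where "U s = pw (k + p - 2 * s) * ach i * g ^ s" for s
  define A where "A s = av (k + p - 2 * s) i * g ^ s" for s
  define B where "B s = bv (k + p - 1 - 2 * s) i * g ^ s" for s
  define X where "X s = (q ^ (2 * s) * al p s) *\<^sub>C (q ^ i *\<^sub>C U s - A s - c *\<^sub>C B s)" for s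
  define Y where "Y s = (q ^ (2 * s) * (bp p s / (q * q))) *\<^sub>C (w *\<^sub>C U s + (lam - c) *\<^sub>C A s - B s)" for s
  have i: "1 \<le> i" "Suc i \<le> k" "k + 1 - p = Suc i" using p by (auto simp: i_def)
  have c: "c = lam / dn i" using cc_dn[of p] p by (simp add: c_def i_def)
  have "term_s p s = X s - Y (Suc s)" if s: "s < p" for s
  proof -
    have "av (k + p - 1 - 2 * s) (Suc i) * g ^ s = q ^ i *\<^sub>C U s - A s - c *\<^sub>C B s"
    proof -
      have e: "Suc (k + p - 1 - 2 * s) = k + p - 2 * s" using s p by auto
      show ?thesis
        unfolding av_Suc[OF i(1,2)] e U_def A_def B_def c by (simp add: left_diff_distrib)
    qed
    moreover have "bv (k + p - 2 - 2 * s) (Suc i) * g ^ s = w *\<^sub>C U (Suc s) + (lam - c) *\<^sub>C A (Suc s) - B (Suc s)"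
    proof -
      define m where "m = k + p - 1 - 2 * Suc s"
      have e: "k + p - 2 - 2 * s = Suc m" "k + p - 2 * Suc s = Suc m" using s p by (auto simp: m_def)
      show ?thesis
        unfolding U_def A_def B_def c w_def e m_def[symmetric] bv_Suc[OF i(1,2)] power_Suc
        by (simp add: left_diff_distrib distrib_right mult.assoc)
    qed
    moreover have "term_s p s = (q ^ (2 * s) * al p s) *\<^sub>C (av (k + p - 1 - 2 * s) (Suc i) * g ^ s)
        - (q ^ (2 * s) * bp p (Suc s)) *\<^sub>C (bv (k + p - 2 - 2 * s) (Suc i) * g ^ s)"
      unfolding term_s_def i by (simp add: left_diff_distrib cs.scale_right_diff_distrib)
    ultimately show ?thesis unfolding X_def Y_def bp_pow by simp
  qed
  then have "Ssum p = (\<Sum>s<p. X s - Y (Suc s))" by (simp add: Ssum_def)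
  also have "\<dots> = (\<Sum>s<Suc p. X s - Y s)"
    by (rule sum_shift_collect) (simp_all add: X_def Y_def)
  also have "\<dots> = (\<Sum>s<Suc p. (q ^ (2 * s) * q ^ i) *\<^sub>C U s - term_s (Suc p) s)"
  proof (rule sum.cong[OF refl])
    fix s assume "s \<in> {..<Suc p}"
    then have s: "s \<le> p" by simp
    have n: "q ^ (2 * p) \<noteq> 1" "q ^ (2 * Suc p) \<noteq> 1" using q_pow_ne[of p] q_pow_ne[of "Suc p"] p by auto
    note lc = level_coeffs[OF s n, folded c_def]
    have k: "k + Suc p - 1 - 2 * s = k + p - 2 * s" "k + Suc p - 2 - 2 * s = k + p - 1 - 2 * s"
      "k + 1 - Suc p = i" using p by (auto simp: i_def)
    define b where "b = bp p s / (q * q)"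
    have lc': "al (Suc p) s = al p s + (lam - c) * b" "bp (Suc p) (Suc s) = b - c * al p s"
      using lc by (simp_all add: b_def)
    have "X s - Y s = (q ^ (2 * s) * (al p s * q ^ i - b * w)) *\<^sub>C U s
        - (q ^ (2 * s) * (al p s + (lam - c) * b)) *\<^sub>C A s
        + (q ^ (2 * s) * (b - c * al p s)) *\<^sub>C B s"
      unfolding X_def Y_def b_def[symmetric]
      by (simp add: cs_add_left cs_add_right cs.scale_left_diff_distrib cs.scale_right_diff_distrib algebra_simps)
    also have "al p s * q ^ i - b * w = q ^ i"
      unfolding w_def i_def b_def by (rule pw_coeff) (use s p in auto)
    finally have "X s - Y s = (q ^ (2 * s) * q ^ i) *\<^sub>C U s - (q ^ (2 * s) * al (Suc p) s) *\<^sub>C A s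
        + (q ^ (2 * s) * bp (Suc p) (Suc s)) *\<^sub>C B s" unfolding lc' .
    then show "X s - Y s = (q ^ (2 * s) * q ^ i) *\<^sub>C U s - term_s (Suc p) s"
      unfolding term_s_def k A_def B_def by (simp add: left_diff_distrib cs.scale_right_diff_distrib)
  qed
  also have "\<dots> = q ^ i *\<^sub>C Hs i - Ssum (Suc p)"
  proof -
    have "2 * k - i - 2 * s = k + p - 2 * s" for s using p by (auto simp: i_def)
    moreover have "k - i = p" using p by (auto simp: i_def)
    ultimately have "q ^ i *\<^sub>C Hs i = (\<Sum>s<Suc p. (q ^ (2 * s) * q ^ i) *\<^sub>C U s)"
      unfolding Hs_def U_def by (simp add: cs.scale_sum_right lessThan_Suc_atMost mult_ac)
    then show ?thesis by (simp only: sum_subtractf Ssum_def)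
  qed
  finally show ?thesis by (simp add: i_def)
qed

text \<open>The elimination starts from the vanishing relation: \<open>av_top\<close> is this
  equation, because \<open>lam / dn k\<close> equals \<open>- inverse q\<close>.\<close>

lemma Ssum_base: "Ssum 1 = q ^ k *\<^sub>C Hs k"
proof -
  have n: "q * q - 1 \<noteq> 0" using q_sq by simp
  have a: "al 1 0 = 1" "bp 1 1 = inverse q" using n q0 by (simp_all add: al_def bp_def power2_eq_square field_simps)
  have c: "lam / dn k = - inverse q"
  proof -
    have "dn k = 1 - q * q" using dn_eq[of 0] by (simp add: power2_eq_square)
    moreover have "lam = (q * q - 1) / q" using q0 by (simp add: lam_def field_simps)
    moreover have "1 - q * q \<noteq> 0" using n by simp
    ultimately show ?thesis using q0 by (simp add: divide_simps)
  qed
  have "q ^ k *\<^sub>C (pw (Suc (k - 1)) * ach k) - av (Suc (k - 1)) k - (lam / dn k) *\<^sub>C bv (k - 1) k = 0"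
    by (rule av_top[OF vanish k1])
  then have "q ^ k *\<^sub>C (pw k * ach k) = av k k - inverse q *\<^sub>C bv (k - 1) k"
    using k1 by (simp add: c algebra_simps del: pw.simps)
  moreover have "Ssum 1 = av k k - inverse q *\<^sub>C bv (k - 1) k"
    using a by (simp add: Ssum_def term_s_def)
  ultimately show ?thesis by (simp add: Hs_def)
qed

text \<open>At level \<open>k\<close> the antisymmetrizer has a single strand, so
  \<open>av_1\<close> and \<open>bv_1\<close> leave powers of \<open>M\<close> and \<open>g\<close>
  only and the elimination ends.\<close>

lemma Ssum_top: "Ssum k = Hs 0"
proof -
  define w where "w = inverse \<mu>"
  define U where "U s = pw (2 * k - 2 * s) * g ^ s" for s
  define X where "X s = (q ^ (2 * s) * al k s) *\<^sub>C U s" for s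
  define Y where "Y s = (q ^ (2 * s) * (bp k s / (q * q)) * w) *\<^sub>C U s" for s
  have "term_s k s = X s - Y (Suc s)" if s: "s < k" for s
  proof -
    have e: "k + 1 - k = 1" "Suc (k + k - 1 - 2 * s) = 2 * k - 2 * s" "k + k - 2 - 2 * s = 2 * k - 2 * Suc s"
      using s by auto
    have "term_s k s = (q ^ (2 * s) * al k s) *\<^sub>C (pw (2 * k - 2 * s) * g ^ s)
        - (q ^ (2 * s) * bp k (Suc s) * w) *\<^sub>C (pw (2 * k - 2 * Suc s) * (g * g ^ s))"
      unfolding term_s_def e(1) av_1 bv_1 e(2,3) w_def
      by (simp add: left_diff_distrib cs.scale_right_diff_distrib mult.assoc del: pw.simps)
    then show ?thesis unfolding X_def Y_def U_def bp_pow by (simp add: mult.assoc)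
  qed
  then have "Ssum k = (\<Sum>s<k. X s - Y (Suc s))" by (simp add: Ssum_def)
  also have "\<dots> = (\<Sum>s<Suc k. X s - Y s)"
    by (rule sum_shift_collect) (simp_all add: X_def Y_def)
  also have "\<dots> = (\<Sum>s<Suc k. q ^ (2 * s) *\<^sub>C U s)"
  proof (rule sum.cong[OF refl])
    fix s assume "s \<in> {..<Suc k}"
    then have "al k s - bp k s / (q * q) * w = 1"
      using pw_coeff[of s k] k1 by (simp add: w_def)
    then have "q ^ (2 * s) * al k s - q ^ (2 * s) * (bp k s / (q * q)) * w = q ^ (2 * s)"
      by (metis mult.assoc mult.right_neutral right_diff_distrib)
    then show "X s - Y s = q ^ (2 * s) *\<^sub>C U s"
      unfolding X_def Y_def by (simp flip: cs.scale_left_diff_distrib)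
  qed
  finally show ?thesis by (simp add: Hs_def U_def ach_def lessThan_Suc_atMost)
qed

text \<open>By \<open>Ssum_step\<close> each \<open>Hs\<close>, up to a power of \<open>q\<close>,
  is a sum of two neighbouring \<open>Ssum\<close>; the alternating sum therefore
  telescopes.\<close>

lemma Hs_partial:
  assumes "1 \<le> p" "p \<le> k"
  shows "(\<Sum>j\<in>{k + 1 - p..k}. (- q) ^ j *\<^sub>C Hs j) = (- 1) ^ (k + p + 1) *\<^sub>C Ssum p"
  using assms
proof (induction p rule: nat_induct_at_least)
  case base
  show ?case unfolding Ssum_base by (simp add: power_minus[of q])
next
  case (Suc p)
  have e: "{k + 1 - Suc p..k} = insert (k - p) {k + 1 - p..k}" "k - p \<notin> {k + 1 - p..k}"
    using Suc.prems by auto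
  have "even (k - p) = even (k + p)" using Suc.prems by simp
  then have s: "(- 1) ^ (k + p) = ((- 1) ^ (k - p) :: complex)" by (simp add: minus_one_power_iff)
  show ?case
    unfolding e(1) using e(2) Suc Ssum_step[of p]
    by (simp add: power_minus[of q] s cs.scale_right_diff_distrib)
qed

theorem cayley_hamilton_Hs: "(\<Sum>j\<le>k. (- q) ^ j *\<^sub>C Hs j) = 0"
proof -
  have "{..k} = insert 0 {k + 1 - k..k}" by auto
  then have "(\<Sum>j\<le>k. (- q) ^ j *\<^sub>C Hs j) = Hs 0 + (\<Sum>j\<in>{k + 1 - k..k}. (- q) ^ j *\<^sub>C Hs j)"
    by simp
  also have "\<dots> = 0" unfolding Hs_partial[OF k1 order_refl] Ssum_top by simp
  finally show ?thesis .
qed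

definition ep :: "nat \<Rightarrow> 'e" where
  "ep i = (\<Sum>j\<le>i div 2. ach (i - 2 * j) * g ^ j)"

theorem cayley_hamilton:
  "(\<Sum>i\<le>2 * k. (- q) ^ i *\<^sub>C (pw (2 * k - i) * (if i \<le> k then ep i else ep (2 * k - i) * g ^ (i - k)))) = 0"
proof -
  \<comment> \<open>\<open>S\<close> is indexed by the degree \<open>i\<close> and the summation
    index inside \<open>ep\<close>, while \<open>S'\<close> is indexed by the \<open>j\<close> of
    \<open>ach j\<close> and the total power \<open>s\<close> of \<open>g\<close>. In both halves
    \<open>i = j + 2 * s\<close>; for \<open>i > k\<close> the reflected coefficient contributes the
    additional power \<open>i - k\<close>. The inverse \<open>h'\<close> recognizes the half by
    comparing \<open>j + 2 * s\<close> with \<open>k\<close>.\<close>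
  define S where "S = (SIGMA i:{..2 * k}. {..(if i \<le> k then i else 2 * k - i) div 2})"
  define S' where "S' = (SIGMA j:{..k}. {..k - j})"
  define h where "h = (\<lambda>(i, t). if i \<le> k then (i - 2 * t, t) else (2 * k - i - 2 * t, t + i - k))"
  define h' where "h' = (\<lambda>(j, s). (j + 2 * s, if j + 2 * s \<le> k then s else k - j - s))"
  define f where "f = (\<lambda>(j, s). ((- q) ^ j * q ^ (2 * s)) *\<^sub>C (pw (2 * k - j - 2 * s) * (ach j * g ^ s)))"
  have "(- q) ^ i *\<^sub>C (pw (2 * k - i) * (if i \<le> k then ep i else ep (2 * k - i) * g ^ (i - k)))
      = (\<Sum>t\<le>(if i \<le> k then i else 2 * k - i) div 2. f (h (i, t)))" if "i \<le> 2 * k" for i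
  proof (cases "i \<le> k")
    case True
    have "(- q) ^ i = (- q) ^ (i - 2 * t) * q ^ (2 * t)" "2 * k - (i - 2 * t) - 2 * t = 2 * k - i" if "t \<le> i div 2" for t
    proof -
      have "i = (i - 2 * t) + 2 * t" using that by auto
      then have "(- q) ^ i = (- q) ^ (i - 2 * t) * (- q) ^ (2 * t)" by (metis power_add)
      then show "(- q) ^ i = (- q) ^ (i - 2 * t) * q ^ (2 * t)" by simp
    qed (use that in auto)
    then show ?thesis using True
      by (auto simp: ep_def sum_distrib_left cs.scale_sum_right f_def h_def intro!: sum.cong)
  next
    case False
    have "(- q) ^ i = (- q) ^ (2 * k - i - 2 * t) * q ^ (2 * (t + i - k))"
      "2 * k - (2 * k - i - 2 * t) - 2 * (t + i - k) = 2 * k - i" if "t \<le> (2 * k - i) div 2" for t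
    proof -
      have "i = (2 * k - i - 2 * t) + 2 * (t + i - k)" using that False \<open>i \<le> 2 * k\<close> by auto
      then have "(- q) ^ i = (- q) ^ (2 * k - i - 2 * t) * (- q) ^ (2 * (t + i - k))" by (metis power_add)
      then show "(- q) ^ i = (- q) ^ (2 * k - i - 2 * t) * q ^ (2 * (t + i - k))" by simp
    qed (use that False \<open>i \<le> 2 * k\<close> in auto)
    moreover have "g ^ t * g ^ (i - k) = g ^ (t + i - k)" for t
      using False by (simp flip: power_add)
    ultimately show ?thesis using False
      by (auto simp: ep_def sum_distrib_left sum_distrib_right cs.scale_sum_right f_def h_def mult.assoc intro!: sum.cong)
  qed
  then have "(\<Sum>i\<le>2 * k. (- q) ^ i *\<^sub>C (pw (2 * k - i) * (if i \<le> k then ep i else ep (2 * k - i) * g ^ (i - k))))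
      = (\<Sum>i\<le>2 * k. \<Sum>t\<le>(if i \<le> k then i else 2 * k - i) div 2. f (h (i, t)))"
    by (intro sum.cong) auto
  also have "\<dots> = (\<Sum>x\<in>S. f (h x))"
    unfolding S_def by (subst sum.Sigma) (auto intro!: sum.cong)
  also have "\<dots> = sum f S'"
    by (rule sum.reindex_bij_witness[where i = h' and j = h]) (auto simp: S_def S'_def h_def h'_def split: if_splits)
  also have "\<dots> = (\<Sum>j\<le>k. (- q) ^ j *\<^sub>C Hs j)"
  proof -
    have "(- q) ^ j *\<^sub>C Hs j = (\<Sum>s\<le>k - j. f (j, s))" for j
      by (simp add: f_def Hs_def cs.scale_sum_right mult.assoc)
    then show ?thesis unfolding S'_def by (simp add: sum.Sigma split_def)
  qed
  finally show ?thesis using cayley_hamilton_Hs by simp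
qed

end

section \<open>Row-finite matrices and local operators\<close>

text \<open>
  With rows and columns indexed by infinite words, the operators on all tensor powers live in one
  ring, and \<open>X\<close> is identified with \<open>X\<close> tensored with the identity.
\<close>

typedef (overloaded) ('i, 'a::zero) rfm = "{A :: 'i \<Rightarrow> 'i \<Rightarrow> 'a. \<forall>u. finite {v. A u v \<noteq> 0}}"
  morphisms ent Rfm
  by (rule exI[of _ "\<lambda>u v. 0"]) simp

lemma finite_ent: "finite {v. ent A u v \<noteq> 0}"
  using ent[of A] by simp

lemma rfm_eqI: "(\<And>u v. ent A u v = ent B u v) \<Longrightarrow> A = B"
  by (metis ent_inject ext)

lemma ent_Rfm: "(\<And>u. finite {v. A u v \<noteq> 0}) \<Longrightarrow> ent (Rfm A) u v = A u v"
  by (subst Rfm_inverse) auto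

instantiation rfm :: (type, ring_1) ring_1
begin

definition zero_rfm :: "('a, 'b) rfm" where "zero_rfm = Rfm (\<lambda>u v. 0)"
definition one_rfm :: "('a, 'b) rfm" where "one_rfm = Rfm (\<lambda>u v. if u = v then 1 else 0)"
definition plus_rfm :: "('a, 'b) rfm \<Rightarrow> ('a, 'b) rfm \<Rightarrow> ('a, 'b) rfm" where
  "plus_rfm A B = Rfm (\<lambda>u v. ent A u v + ent B u v)"
definition uminus_rfm :: "('a, 'b) rfm \<Rightarrow> ('a, 'b) rfm" where
  "uminus_rfm A = Rfm (\<lambda>u v. - ent A u v)"
definition minus_rfm :: "('a, 'b) rfm \<Rightarrow> ('a, 'b) rfm \<Rightarrow> ('a, 'b) rfm" where
  "minus_rfm A B = Rfm (\<lambda>u v. ent A u v - ent B u v)"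
definition times_rfm :: "('a, 'b) rfm \<Rightarrow> ('a, 'b) rfm \<Rightarrow> ('a, 'b) rfm" where
  "times_rfm A B = Rfm (\<lambda>u v. \<Sum>w | ent A u w \<noteq> 0. ent A u w * ent B w v)"

lemma ent_basic:
  shows ent_zero: "ent (0 :: ('a, 'b) rfm) u v = 0"
    and ent_one: "ent (1 :: ('a, 'b) rfm) u v = (if u = v then 1 else 0)"
    and ent_add: "ent (A + B :: ('a, 'b) rfm) u v = ent A u v + ent B u v"
    and ent_uminus: "ent (- A :: ('a, 'b) rfm) u v = - ent A u v"
    and ent_diff: "ent (A - B :: ('a, 'b) rfm) u v = ent A u v - ent B u v"
    and ent_times: "ent (A * B :: ('a, 'b) rfm) u v = (\<Sum>w | ent A u w \<noteq> 0. ent A u w * ent B w v)"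
proof -
  show "ent (0 :: ('a, 'b) rfm) u v = 0" "ent (1 :: ('a, 'b) rfm) u v = (if u = v then 1 else 0)"
    by (simp_all add: zero_rfm_def one_rfm_def ent_Rfm)
  show "ent (A + B :: ('a, 'b) rfm) u v = ent A u v + ent B u v"
    unfolding plus_rfm_def
  proof (rule ent_Rfm)
    fix u show "finite {v. ent A u v + ent B u v \<noteq> 0}"
      by (rule finite_subset[OF _ finite_UnI[OF finite_ent[of A u] finite_ent[of B u]]]) auto
  qed
  show "ent (A - B :: ('a, 'b) rfm) u v = ent A u v - ent B u v"
    unfolding minus_rfm_def
  proof (rule ent_Rfm)
    fix u show "finite {v. ent A u v - ent B u v \<noteq> 0}"
      by (rule finite_subset[OF _ finite_UnI[OF finite_ent[of A u] finite_ent[of B u]]]) auto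
  qed
  show "ent (- A :: ('a, 'b) rfm) u v = - ent A u v"
    unfolding uminus_rfm_def by (rule ent_Rfm) (simp add: finite_ent)
  show "ent (A * B :: ('a, 'b) rfm) u v = (\<Sum>w | ent A u w \<noteq> 0. ent A u w * ent B w v)"
    unfolding times_rfm_def
  proof (rule ent_Rfm)
    fix u
    show "finite {v. (\<Sum>w | ent A u w \<noteq> 0. ent A u w * ent B w v) \<noteq> 0}"
    proof (rule finite_subset)
      show "{v. (\<Sum>w | ent A u w \<noteq> 0. ent A u w * ent B w v) \<noteq> 0}
          \<subseteq> (\<Union>w\<in>{w. ent A u w \<noteq> 0}. {v. ent B w v \<noteq> 0})"
      proof
        fix v assume "v \<in> {v. (\<Sum>w | ent A u w \<noteq> 0. ent A u w * ent B w v) \<noteq> 0}"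
        then obtain w where "ent A u w \<noteq> 0" "ent A u w * ent B w v \<noteq> 0"
          by (auto elim: sum.not_neutral_contains_not_neutral)
        then show "v \<in> (\<Union>w\<in>{w. ent A u w \<noteq> 0}. {v. ent B w v \<noteq> 0})" by auto
      qed
    qed (auto simp: finite_ent)
  qed
qed

lemma ent_times_on:
  assumes "finite S" "\<And>w. ent A u w * ent B w v \<noteq> 0 \<Longrightarrow> w \<in> S"
  shows "ent (A * B :: ('a, 'b) rfm) u v = (\<Sum>w\<in>S. ent A u w * ent B w v)"
proof -
  have "ent (A * B) u v = (\<Sum>w\<in>S \<inter> {w. ent A u w \<noteq> 0}. ent A u w * ent B w v)"
    unfolding ent_times using assms by (intro sum.mono_neutral_right) (auto simp: finite_ent)
  also have "\<dots> = (\<Sum>w\<in>S. ent A u w * ent B w v)"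
    using assms by (intro sum.mono_neutral_left) auto
  finally show ?thesis .
qed

instance
proof
  fix A B C :: "('a, 'b) rfm"
  show "A * B * C = A * (B * C)"
  proof (rule rfm_eqI)
    fix u v
    define S where "S = {w. ent A u w \<noteq> 0}"
    define S' where "S' = (\<Union>w\<in>S. {x. ent B w x \<noteq> 0})"
    have fin: "finite S" "finite S'" by (auto simp: S_def S'_def finite_ent)
    have AB: "ent (A * B) u x = (\<Sum>w\<in>S. ent A u w * ent B w x)" for x by (simp add: ent_times S_def)
    have BC: "ent (B * C) w v = (\<Sum>x\<in>S'. ent B w x * ent C x v)" if "w \<in> S" for w
      by (rule ent_times_on[OF fin(2)]) (use that in \<open>auto simp: S'_def intro!: bexI[of _ w]\<close>)
    have "ent (A * B * C) u v = (\<Sum>x\<in>S'. ent (A * B) u x * ent C x v)"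
    proof (rule ent_times_on)
      fix x assume "ent (A * B) u x * ent C x v \<noteq> 0"
      then have "(\<Sum>w\<in>S. ent A u w * ent B w x) \<noteq> 0" by (auto simp: AB)
      then obtain w where "w \<in> S" "ent A u w * ent B w x \<noteq> 0"
        by (rule sum.not_neutral_contains_not_neutral)
      then show "x \<in> S'" by (auto simp: S'_def intro!: bexI[of _ w])
    qed (rule fin)
    also have "\<dots> = (\<Sum>x\<in>S'. \<Sum>w\<in>S. ent A u w * (ent B w x * ent C x v))"
      by (simp add: AB sum_distrib_right mult.assoc)
    also have "\<dots> = (\<Sum>w\<in>S. ent A u w * ent (B * C) w v)"
      by (subst sum.swap) (simp add: BC sum_distrib_left)
    also have "\<dots> = ent (A * (B * C)) u v"
      by (rule ent_times_on[symmetric]) (use fin in \<open>auto simp: S_def\<close>)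
    finally show "ent (A * B * C) u v = ent (A * (B * C)) u v" .
  qed
  show "1 * A = A"
  proof (rule rfm_eqI)
    fix u v
    show "ent (1 * A) u v = ent A u v"
      by (subst ent_times_on[of "{u}"]) (auto simp: ent_one split: if_splits)
  qed
  show "A * 1 = A"
  proof (rule rfm_eqI)
    fix u v
    show "ent (A * 1) u v = ent A u v"
      by (subst ent_times_on[of "{v}"]) (auto simp: ent_one split: if_splits)
  qed
  show "(A + B) * C = A * C + B * C"
  proof (rule rfm_eqI)
    fix u v
    let ?S = "{w. ent A u w \<noteq> 0} \<union> {w. ent B u w \<noteq> 0}"
    have "finite ?S" by (simp add: finite_ent)
    then show "ent ((A + B) * C) u v = ent (A * C + B * C) u v"
      by (simp only: ent_add, subst (1 2 3) ent_times_on[of ?S])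
        (auto simp: ent_add distrib_right sum.distrib)
  qed
  show "A * (B + C) = A * B + A * C"
    by (rule rfm_eqI) (simp add: ent_times ent_add distrib_left sum.distrib)
  show "(0 :: ('a, 'b) rfm) \<noteq> 1"
  proof
    assume "(0 :: ('a, 'b) rfm) = 1"
    then have "ent (0 :: ('a, 'b) rfm) undefined undefined = ent 1 undefined undefined" by simp
    then show False by (simp add: ent_zero ent_one)
  qed
qed (rule rfm_eqI; simp add: ent_add ent_zero ent_uminus ent_diff add_ac)+

end

instantiation rfm :: (type, calgebra) calgebra
begin

definition cs_rfm :: "complex \<Rightarrow> ('a, 'b) rfm \<Rightarrow> ('a, 'b) rfm" where
  "cs_rfm c A = Rfm (\<lambda>u v. c *\<^sub>C ent A u v)"

lemma ent_cs: "ent (c *\<^sub>C A :: ('a, 'b) rfm) u v = c *\<^sub>C ent A u v"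
  unfolding cs_rfm_def
proof (rule ent_Rfm)
  fix u show "finite {v. c *\<^sub>C ent A u v \<noteq> 0}"
    by (rule finite_subset[OF _ finite_ent[of A u]]) auto
qed

instance
proof
  fix A B :: "('a, 'b) rfm" and c d
  show "(c *\<^sub>C A) * B = c *\<^sub>C (A * B)"
  proof (rule rfm_eqI)
    fix u v
    show "ent ((c *\<^sub>C A) * B) u v = ent (c *\<^sub>C (A * B)) u v"
      by (subst ent_times_on[of "{w. ent A u w \<noteq> 0}"])
        (auto simp: finite_ent ent_cs ent_times cs.scale_sum_right)
  qed
  show "A * (c *\<^sub>C B) = c *\<^sub>C (A * B)"
    by (rule rfm_eqI) (simp add: ent_times ent_cs cs.scale_sum_right)
qed (rule rfm_eqI; simp add: ent_cs ent_add cs_add_left cs_add_right)+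

end

subsection \<open>Operators supported on a window of strands\<close>

definition agree :: "nat \<Rightarrow> nat \<Rightarrow> (nat \<Rightarrow> 'n) \<Rightarrow> (nat \<Rightarrow> 'n) \<Rightarrow> bool" where
  "agree m n u v \<longleftrightarrow> (\<forall>i. i < m \<or> m + n \<le> i \<longrightarrow> u i = v i)"

definition win :: "nat \<Rightarrow> nat \<Rightarrow> (nat \<Rightarrow> 'n) \<Rightarrow> 'n list" where
  "win m n u = map (\<lambda>i. u (m + i)) [0..<n]"

definition put :: "nat \<Rightarrow> (nat \<Rightarrow> 'n) \<Rightarrow> 'n list \<Rightarrow> nat \<Rightarrow> 'n" where
  "put m u s = (\<lambda>i. if m \<le> i \<and> i < m + length s then s ! (i - m) else u i)"

lemma length_win [simp]: "length (win m n u) = n" by (simp add: win_def)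

lemma nth_win [simp]: "i < n \<Longrightarrow> win m n u ! i = u (m + i)" by (simp add: win_def)

lemma win_put [simp]: "length s = n \<Longrightarrow> win m n (put m u s) = s"
  by (auto intro!: nth_equalityI simp: put_def)

lemma agree_put: "length s = n \<Longrightarrow> agree m n u (put m u s)" "length s = n \<Longrightarrow> agree m n (put m u s) u"
  by (auto simp: agree_def put_def)

lemma put_win: "agree m n u v \<Longrightarrow> put m u (win m n v) = v"
  by (auto simp: agree_def put_def fun_eq_iff)

lemma agree_sym: "agree m n u v = agree m n v u"
  by (auto simp: agree_def)

lemma finite_basis_words [simp]: "finite (basis_words n :: 'n::finite list set)"
  using finite_lists_length_eq[of "UNIV :: 'n set" n] by (simp add: basis_words_def)

lemma agree_set: "{v. agree m n u v} = put m u ` basis_words n"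
proof (intro equalityI subsetI)
  fix v assume "v \<in> {v. agree m n u v}"
  then have "v = put m u (win m n v)" by (simp add: put_win)
  then show "v \<in> put m u ` basis_words n" by (rule image_eqI) (simp add: basis_words_def)
qed (auto simp: basis_words_def agree_put)

lemma finite_agree:
  fixes u :: "nat \<Rightarrow> 'n::finite"
  shows "finite {v. agree m n u v}" "finite {v. agree m n v u}"
  by (simp_all add: agree_set agree_sym[of m n _ u])

lemma if_if_conj: "(if A then (if B then x else y) else y) = (if A \<and> B then x else y)"
  by simp

lemma inj_put: "inj_on (put m u) (basis_words n)"
  by (rule inj_on_inverseI[where g = "win m n"]) (simp add: basis_words_def)

definition lemb :: "nat \<Rightarrow> nat \<Rightarrow> ('n::finite, 'a::zero) op \<Rightarrow> (nat \<Rightarrow> 'n, 'a) rfm" where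
  "lemb m n X = Rfm (\<lambda>u v. if agree m n u v then X (win m n u) (win m n v) else 0)"

lemma ent_lemb:
  fixes X :: "('n::finite, 'a::zero) op"
  shows "ent (lemb m n X) u v = (if agree m n u v then X (win m n u) (win m n v) else 0)"
  unfolding lemb_def
proof (rule ent_Rfm)
  fix u :: "nat \<Rightarrow> 'n"
  have "finite {v. agree m n u v}" by (simp add: agree_set)
  then show "finite {v. (if agree m n u v then X (win m n u) (win m n v) else 0) \<noteq> 0}"
    by (rule rev_finite_subset) auto
qed

lemma ent_lemb_times:
  fixes X :: "('n::finite, 'a::ring_1) op"
  shows "ent (lemb m n X * B) u v = (\<Sum>s\<in>basis_words n. X (win m n u) s * ent B (put m u s) v)"
proof -
  have "ent (lemb m n X * B) u v = (\<Sum>w\<in>put m u ` basis_words n. ent (lemb m n X) u w * ent B w v)"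
    by (rule ent_times_on) (auto simp: ent_lemb finite_agree agree_set[symmetric] split: if_splits)
  also have "\<dots> = (\<Sum>s\<in>basis_words n. X (win m n u) s * ent B (put m u s) v)"
    by (subst sum.reindex[OF inj_put]) (auto intro!: sum.cong simp: ent_lemb agree_put basis_words_def)
  finally show ?thesis .
qed

lemma ent_times_lemb:
  fixes X :: "('n::finite, 'a::ring_1) op"
  shows "ent (B * lemb m n X) u v = (\<Sum>s\<in>basis_words n. ent B u (put m v s) * X s (win m n v))"
proof -
  have "ent (B * lemb m n X) u v = (\<Sum>w\<in>put m v ` basis_words n. ent B u w * ent (lemb m n X) w v)"
    by (rule ent_times_on) (auto simp: ent_lemb finite_agree agree_set[symmetric] agree_sym[of m n v] split: if_splits)
  also have "\<dots> = (\<Sum>s\<in>basis_words n. ent B u (put m v s) * X s (win m n v))"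
    by (subst sum.reindex[OF inj_put]) (auto intro!: sum.cong simp: ent_lemb agree_put basis_words_def)
  finally show ?thesis .
qed

lemma lemb_mult:
  fixes X Y :: "('n::finite, 'a::ring_1) op"
  shows "lemb m n X * lemb m n Y = lemb m n (op_mult n X Y)"
proof (rule rfm_eqI)
  fix u v :: "nat \<Rightarrow> 'n"
  have "agree m n (put m u s) v = agree m n u v" if "length s = n" for s
    using that by (auto simp: agree_def put_def)
  then show "ent (lemb m n X * lemb m n Y) u v = ent (lemb m n (op_mult n X Y)) u v"
    by (auto simp: ent_lemb_times ent_lemb op_mult_def basis_words_def intro!: sum.cong sum.neutral)
qed

lemma lemb_one: "lemb m n op_id = 1"
proof (rule rfm_eqI)
  fix u v :: "nat \<Rightarrow> 'a"
  have "u = v" if "agree m n u v" "win m n u = win m n v"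
    using put_win[OF that(1)] put_win[of m n u u] that(2) by (simp add: agree_def)
  then show "ent (lemb m n op_id) u v = ent 1 u v"
    by (auto simp: ent_lemb ent_one op_id_def agree_def)
qed

lemma lemb_cong: "op_eq n X Y \<Longrightarrow> lemb m n X = lemb m n Y"
  by (rule rfm_eqI) (auto simp: ent_lemb op_eq_def basis_words_def)

lemma lemb_inj:
  assumes "lemb m n X = lemb m n Y" shows "op_eq n X Y"
  unfolding op_eq_def
proof (intro ballI)
  fix s t :: "'a list" assume st: "s \<in> basis_words n" "t \<in> basis_words n"
  define u where "u = put m (\<lambda>i. undefined) s"
  define v where "v = put m (\<lambda>i. undefined) t"
  have "ent (lemb m n X) u v = ent (lemb m n Y) u v" using assms by simp
  moreover have "agree m n u v" using st by (auto simp: agree_def u_def v_def put_def basis_words_def)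
  moreover have "win m n u = s" "win m n v = t" using st by (simp_all add: u_def v_def basis_words_def)
  ultimately show "X s t = Y s t" by (simp add: ent_lemb)
qed

lemma lemb_add: "lemb m n (\<lambda>u v. X u v + Y u v) = lemb m n X + lemb m n (Y :: ('n::finite, 'a::ring_1) op)"
  by (rule rfm_eqI) (simp add: ent_lemb ent_add)

lemma lemb_cs: "lemb m n (\<lambda>u v. c *\<^sub>C X u v) = c *\<^sub>C lemb m n (X :: ('n::finite, 'a::calgebra) op)"
  by (rule rfm_eqI) (simp add: ent_lemb ent_cs)

lemma lemb_zero: "lemb m n op_zero = (0 :: (nat \<Rightarrow> 'n::finite, 'a::ring_1) rfm)"
  by (rule rfm_eqI) (simp add: ent_lemb ent_zero op_zero_def)

text \<open>The intermediate word is forced: it takes the letters of \<open>v\<close> on the first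
  window and those of \<open>u\<close> elsewhere. The sum has one term, in which the coefficients
  keep their order.\<close>

lemma ent_disjoint:
  fixes X :: "('n::finite, 'a::ring_1) op"
  assumes "m + n \<le> a \<or> a + b \<le> m"
  shows "ent (lemb m n X * lemb a b Z) u v
    = (if \<forall>i. \<not> (m \<le> i \<and> i < m + n) \<and> \<not> (a \<le> i \<and> i < a + b) \<longrightarrow> u i = v i
       then X (win m n u) (win m n v) * Z (win a b u) (win a b v) else 0)"
proof -
  define w where "w = put m u (win m n v)"
  have uniq: "x = w" if x: "agree m n u x" "agree a b x v" for x
  proof
    fix i show "x i = w i"
      using x assms by (auto simp: w_def put_def agree_def)
  qed
  have e: "ent (lemb m n X * lemb a b Z) u v = (\<Sum>x\<in>{w}. ent (lemb m n X) u x * ent (lemb a b Z) x v)"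
    by (rule ent_times_on) (use uniq in \<open>auto simp: ent_lemb split: if_splits\<close>)
  have 1: "agree m n u w" unfolding w_def by (rule agree_put) simp
  have 2: "agree a b w v \<longleftrightarrow> (\<forall>i. \<not> (m \<le> i \<and> i < m + n) \<and> \<not> (a \<le> i \<and> i < a + b) \<longrightarrow> u i = v i)"
    using assms by (auto simp: w_def put_def agree_def)
  have 3: "win m n w = win m n v" by (simp add: w_def)
  have 4: "win a b w = win a b u"
    using assms by (auto intro!: nth_equalityI simp: w_def put_def)
  have 5: "x * (if P then y else 0) = (if P then x * y else 0)" for x y :: 'a and P by simp
  show ?thesis unfolding e by (simp only: sum.insert finite.emptyI empty_iff not_False_eq_True sum.empty add_0_right
    ent_lemb 1 2 3 4 5 if_True)
qed

definition scal :: "('n, complex) op \<Rightarrow> ('n, 'a::calgebra) op" where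
  "scal X u v = X u v *\<^sub>C 1"

lemma op_mult_scal: "op_mult n (scal X) (scal Y) = scal (op_mult n X Y)"
  by (simp add: fun_eq_iff op_mult_def scal_def cs.scale_sum_left mult.commute)

definition sl :: "nat \<Rightarrow> nat \<Rightarrow> ('n::finite, complex) op \<Rightarrow> (nat \<Rightarrow> 'n, 'a::calgebra) rfm" where
  "sl m n X = lemb m n (scal X)"

lemma sl_mult: "sl m n X * sl m n Y = sl m n (op_mult n X Y)"
  by (simp add: sl_def lemb_mult op_mult_scal)

lemma sl_one: "(sl m n op_id :: (nat \<Rightarrow> 'n::finite, 'a::calgebra) rfm) = 1"
proof -
  have "scal op_id = (op_id :: ('n, 'a::calgebra) op)" by (simp add: fun_eq_iff scal_def op_id_def)
  then show ?thesis by (simp add: sl_def lemb_one)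
qed

lemma sl_cong: "op_eq n X Y \<Longrightarrow> sl m n X = sl m n Y"
  unfolding sl_def by (rule lemb_cong) (simp add: op_eq_def scal_def)

lemma sl_add: "sl m n (\<lambda>u v. X u v + Y u v) = sl m n X + sl m n Y"
  by (simp add: sl_def scal_def[abs_def] cs_add_left lemb_add)

lemma sl_cs: "sl m n (\<lambda>u v. c * X u v) = c *\<^sub>C sl m n X"
  unfolding sl_def lemb_cs[symmetric] by (simp add: scal_def[abs_def])

lemma sl_inj:
  assumes "(sl m n X :: (nat \<Rightarrow> 'n::finite, 'a::calgebra) rfm) = sl m n Y" shows "op_eq n X Y"
proof -
  have inj: "c = d" if "c *\<^sub>C (1 :: 'a) = d *\<^sub>C 1" for c d :: complex
  proof (rule ccontr)
    assume "c \<noteq> d"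
    then have "(1 :: 'a) = inverse (c - d) *\<^sub>C ((c - d) *\<^sub>C 1)" by simp
    also have "(c - d) *\<^sub>C (1 :: 'a) = 0" using that by (simp only: cs.scale_left_diff_distrib) simp
    finally show False by simp
  qed
  have "op_eq n (scal X :: ('n, 'a) op) (scal Y)" using assms unfolding sl_def by (rule lemb_inj)
  then show ?thesis by (auto simp: op_eq_def scal_def dest: inj)
qed

text \<open>Over noncommutative coefficients disjoint windows alone do not give commutation; it
  holds here because the entries of one operator are scalars.\<close>

lemma sl_disjoint:
  fixes X :: "('n::finite, 'a::calgebra) op"
  assumes "m + n \<le> a \<or> a + b \<le> m"
  shows "lemb m n X * sl a b Y = sl a b Y * lemb m n X"
proof (rule rfm_eqI)
  fix u v :: "nat \<Rightarrow> 'n"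
  have "a + b \<le> m \<or> m + n \<le> a" using assms by auto
  note d = ent_disjoint[OF assms] ent_disjoint[OF this]
  have c: "(\<forall>i. \<not> (m \<le> i \<and> i < m + n) \<and> \<not> (a \<le> i \<and> i < a + b) \<longrightarrow> u i = v i)
      \<longleftrightarrow> (\<forall>i. \<not> (a \<le> i \<and> i < a + b) \<and> \<not> (m \<le> i \<and> i < m + n) \<longrightarrow> u i = v i)"
    by blast
  show "ent (lemb m n X * sl a b Y) u v = ent (sl a b Y * lemb m n X) u v"
    unfolding sl_def d c by (simp only: scal_def mult_cs_left mult_cs_right mult_1_left mult_1_right)
qed

lemma lemb_reindex:
  assumes "a \<le> m" "m + n \<le> a + b"
  shows "lemb m n X = lemb a b (\<lambda>u v. if \<forall>i<b. i < m - a \<or> m - a + n \<le> i \<longrightarrow> u ! i = v ! i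
    then X (take n (drop (m - a) u)) (take n (drop (m - a) v)) else 0)"
proof (rule rfm_eqI)
  fix u v :: "nat \<Rightarrow> 'a"
  have t: "take n (drop (m - a) (win a b x)) = win m n x" for x :: "nat \<Rightarrow> 'a"
    using assms by (auto intro!: nth_equalityI)
  have "agree m n u v \<longleftrightarrow> agree a b u v \<and> (\<forall>i<b. i < m - a \<or> m - a + n \<le> i \<longrightarrow> win a b u ! i = win a b v ! i)"
  proof
    assume "agree a b u v \<and> (\<forall>i<b. i < m - a \<or> m - a + n \<le> i \<longrightarrow> win a b u ! i = win a b v ! i)"
    then have 1: "\<And>i. i < a \<or> a + b \<le> i \<Longrightarrow> u i = v i"
      and 2: "\<And>i. i < b \<Longrightarrow> i < m - a \<or> m - a + n \<le> i \<Longrightarrow> u (a + i) = v (a + i)"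
      by (auto simp: agree_def)
    show "agree m n u v" unfolding agree_def
    proof (intro allI impI)
      fix i assume "i < m \<or> m + n \<le> i"
      show "u i = v i"
      proof (cases "i < a \<or> a + b \<le> i")
        case False
        then have "i - a < b" "i - a < m - a \<or> m - a + n \<le> i - a" "a + (i - a) = i"
          using \<open>i < m \<or> m + n \<le> i\<close> assms by linarith+
        then show ?thesis using 2[of "i - a"] by metis
      qed (use 1 in auto)
    qed
  qed (use assms in \<open>auto simp: agree_def\<close>)
  note h = this
  show "ent (lemb m n X) u v = ent (lemb a b (\<lambda>u v. if \<forall>i<b. i < m - a \<or> m - a + n \<le> i \<longrightarrow> u ! i = v ! i
    then X (take n (drop (m - a) u)) (take n (drop (m - a) v)) else 0)) u v"
    by (simp only: ent_lemb t if_if_conj h)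
qed

lemma lemb_at1:
  assumes "1 \<le> i" "i \<le> n"
  shows "lemb m n (at1 Y i) = lemb (m + i - 1) 1 (at1 Y 1)"
proof -
  have "op_eq n (at1 Y i) (\<lambda>u v. if \<forall>j<n. j < m + i - 1 - m \<or> m + i - 1 - m + 1 \<le> j \<longrightarrow> u ! j = v ! j
    then at1 Y 1 (take 1 (drop (m + i - 1 - m) u)) (take 1 (drop (m + i - 1 - m) v)) else 0)"
    using assms by (auto simp: op_eq_def at1_def basis_words_def)
  from lemb_cong[OF this] show ?thesis by (subst lemb_reindex[of m "m + i - 1" 1 n]) (use assms in auto)
qed

lemma lemb_at2:
  assumes "1 \<le> i" "Suc i \<le> n"
  shows "lemb m n (at2 X i (Suc i)) = lemb (m + i - 1) 2 (at2 X 1 2)"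
proof -
  have "op_eq n (at2 X i (Suc i)) (\<lambda>u v. if \<forall>j<n. j < m + i - 1 - m \<or> m + i - 1 - m + 2 \<le> j \<longrightarrow> u ! j = v ! j
    then at2 X 1 2 (take 2 (drop (m + i - 1 - m) u)) (take 2 (drop (m + i - 1 - m) v)) else 0)"
  proof -
    have "(j \<noteq> i - 1 \<and> j \<noteq> i) = (j < i - 1 \<or> i - 1 + 2 \<le> j)" for j using assms by auto
    moreover have "\<not> (j \<noteq> 0 \<and> j \<noteq> 1)" if "j < 2" for j :: nat using that by auto
    ultimately show ?thesis
      using assms by (auto simp: op_eq_def at2_def basis_words_def numeral_2_eq_2)
  qed
  from lemb_cong[OF this] show ?thesis by (subst lemb_reindex[of m "m + i - 1" 2 n]) (use assms in auto)
qed

definition Eset :: "nat \<Rightarrow> (nat \<Rightarrow> 'n::finite, 'a::calgebra) rfm set" where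
  "Eset n = range (lemb 0 n)"

lemma lemb_Eset: "m + n \<le> b \<Longrightarrow> lemb m n X \<in> Eset b"
  unfolding Eset_def by (subst lemb_reindex[of 0 m n b]) auto

lemma Eset_add: "x \<in> Eset n \<Longrightarrow> y \<in> Eset n \<Longrightarrow> x + y \<in> Eset n"
  by (auto simp: Eset_def simp flip: lemb_add)

lemma Eset_mult: "x \<in> Eset n \<Longrightarrow> y \<in> Eset n \<Longrightarrow> x * y \<in> Eset n"
  by (auto simp: Eset_def lemb_mult)

lemma Eset_cs: "x \<in> Eset n \<Longrightarrow> c *\<^sub>C x \<in> Eset n"
  by (auto simp: Eset_def simp flip: lemb_cs)

lemma Eset_one: "1 \<in> Eset n"
  unfolding Eset_def lemb_one[of 0 n, symmetric] by simp

lemma Eset_Suc: "x \<in> Eset n \<Longrightarrow> x \<in> Eset (Suc n)"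
  using lemb_Eset[of 0 n "Suc n"] by (auto simp: Eset_def)

subsection \<open>Partial traces\<close>

text \<open>Unlike \<open>ptrace\<close>, which deletes a tensor factor, this keeps the strand and
  acts on it as the identity. The trace thus stays inside one ring and no strand is
  renumbered.\<close>

definition Tp :: "nat \<Rightarrow> (nat \<Rightarrow> 'n::finite, 'a::ring_1) rfm \<Rightarrow> (nat \<Rightarrow> 'n, 'a) rfm" where
  "Tp n A = Rfm (\<lambda>u v. if u n = v n then \<Sum>c\<in>UNIV. ent A (u(n := c)) (v(n := c)) else 0)"

lemma ent_Tp:
  fixes A :: "(nat \<Rightarrow> 'n::finite, 'a::ring_1) rfm"
  shows "ent (Tp n A) u v = (if u n = v n then \<Sum>c\<in>UNIV. ent A (u(n := c)) (v(n := c)) else 0)"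
  unfolding Tp_def
proof (rule ent_Rfm)
  fix u :: "nat \<Rightarrow> 'n"
  show "finite {v. (if u n = v n then \<Sum>c\<in>UNIV. ent A (u(n := c)) (v(n := c)) else 0) \<noteq> 0}"
  proof (rule finite_subset)
    show "{v. (if u n = v n then \<Sum>c\<in>UNIV. ent A (u(n := c)) (v(n := c)) else 0) \<noteq> 0}
        \<subseteq> (\<Union>c\<in>UNIV. (\<lambda>w. w(n := u n)) ` {w. ent A (u(n := c)) w \<noteq> 0})"
    proof
      fix v assume "v \<in> {v. (if u n = v n then \<Sum>c\<in>UNIV. ent A (u(n := c)) (v(n := c)) else 0) \<noteq> 0}"
      then have uv: "u n = v n" and "(\<Sum>c\<in>UNIV. ent A (u(n := c)) (v(n := c))) \<noteq> 0"
        by (auto split: if_splits)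
      then obtain c where "ent A (u(n := c)) (v(n := c)) \<noteq> 0"
        by (auto elim: sum.not_neutral_contains_not_neutral)
      moreover have "v = (v(n := c))(n := u n)" using uv by auto
      ultimately show "v \<in> (\<Union>c\<in>UNIV. (\<lambda>w. w(n := u n)) ` {w. ent A (u(n := c)) w \<noteq> 0})" by blast
    qed
  qed (simp add: finite_ent)
qed

lemma Tp_add: "Tp n (x + y) = Tp n x + Tp n y"
  by (rule rfm_eqI) (simp add: ent_Tp ent_add sum.distrib)

lemma Tp_cs: "Tp n (c *\<^sub>C x) = c *\<^sub>C Tp n (x :: (nat \<Rightarrow> 'n::finite, 'a::calgebra) rfm)"
  by (rule rfm_eqI) (simp add: ent_Tp ent_cs cs.scale_sum_right)

lemma win_upd: "win 0 n (u(n := c)) = win 0 n u"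
  by (auto intro!: nth_equalityI)

lemma put_upd: "length s = n \<Longrightarrow> put 0 (u(n := c)) s = (put 0 u s)(n := c)"
  by (auto simp: put_def)

lemma put_last: "length s = n \<Longrightarrow> put 0 u s n = u n"
  by (simp add: put_def)

lemma Tp_left:
  fixes x :: "(nat \<Rightarrow> 'n::finite, 'a::calgebra) rfm"
  assumes "x \<in> Eset n"
  shows "Tp n (x * y) = x * Tp n y"
proof -
  obtain X where x: "x = lemb 0 n X" using assms by (auto simp: Eset_def)
  show ?thesis
  proof (rule rfm_eqI)
    fix u v :: "nat \<Rightarrow> 'n"
    show "ent (Tp n (x * y)) u v = ent (x * Tp n y) u v"
    proof (cases "u n = v n")
      case True
      have "ent (Tp n (x * y)) u v
          = (\<Sum>c\<in>UNIV. \<Sum>s\<in>basis_words n. X (win 0 n u) s * ent y ((put 0 u s)(n := c)) (v(n := c)))"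
        using True by (auto simp: ent_Tp x ent_lemb_times win_upd basis_words_def put_upd intro!: sum.cong)
      also have "\<dots> = (\<Sum>s\<in>basis_words n. X (win 0 n u) s * (\<Sum>c\<in>UNIV. ent y ((put 0 u s)(n := c)) (v(n := c))))"
        by (subst sum.swap) (simp add: sum_distrib_left)
      also have "\<dots> = ent (x * Tp n y) u v"
        using True by (auto simp: ent_Tp x ent_lemb_times basis_words_def put_last intro!: sum.cong)
      finally show ?thesis .
    qed (auto simp: ent_Tp x ent_lemb_times basis_words_def put_last intro!: sum.neutral)
  qed
qed

lemma Tp_right:
  fixes x :: "(nat \<Rightarrow> 'n::finite, 'a::calgebra) rfm"
  assumes "x \<in> Eset n"
  shows "Tp n (y * x) = Tp n y * x"
proof -
  obtain X where x: "x = lemb 0 n X" using assms by (auto simp: Eset_def)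
  show ?thesis
  proof (rule rfm_eqI)
    fix u v :: "nat \<Rightarrow> 'n"
    show "ent (Tp n (y * x)) u v = ent (Tp n y * x) u v"
    proof (cases "u n = v n")
      case True
      have "ent (Tp n (y * x)) u v
          = (\<Sum>c\<in>UNIV. \<Sum>s\<in>basis_words n. ent y (u(n := c)) ((put 0 v s)(n := c)) * X s (win 0 n v))"
        using True by (auto simp: ent_Tp x ent_times_lemb win_upd basis_words_def put_upd intro!: sum.cong)
      also have "\<dots> = (\<Sum>s\<in>basis_words n. (\<Sum>c\<in>UNIV. ent y (u(n := c)) ((put 0 v s)(n := c))) * X s (win 0 n v))"
        by (subst sum.swap) (simp add: sum_distrib_right)
      also have "\<dots> = ent (Tp n y * x) u v"
        using True by (auto simp: ent_Tp x ent_times_lemb basis_words_def put_last intro!: sum.cong)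
      finally show ?thesis .
    qed (auto simp: ent_Tp x ent_times_lemb basis_words_def put_last intro!: sum.neutral)
  qed
qed

lemma Tp_lemb:
  fixes X :: "('n::finite, 'a::ring_1) op"
  shows "Tp (m + n) (lemb m (Suc n) X) = lemb m n (ptrace (Suc n) X)"
proof (rule rfm_eqI)
  fix u v :: "nat \<Rightarrow> 'n"
  have w: "win m (Suc n) (x(m + n := c)) = insert_at (Suc n) c (win m n x)" for x :: "nat \<Rightarrow> 'n" and c
    by (simp add: insert_at_def) (auto intro!: nth_equalityI simp: nth_append less_Suc_eq)
  have "u (m + n) = v (m + n) \<and> agree m (Suc n) (u(m + n := c)) (v(m + n := c)) \<longleftrightarrow> agree m n u v" for c
    by (auto simp: agree_def) (metis Suc_leI add_Suc_right le_neq_implies_less)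
  then show "ent (Tp (m + n) (lemb m (Suc n) X)) u v = ent (lemb m n (ptrace (Suc n) X)) u v"
    by (auto simp: ent_Tp ent_lemb ptrace_def w intro!: sum.cong sum.neutral)
qed

lemma Tp_Eset: "x \<in> Eset (Suc n) \<Longrightarrow> Tp n x \<in> Eset n"
  using Tp_lemb[of 0 n] by (auto simp: Eset_def)

lemma sum_words1: "(\<Sum>s\<in>basis_words 1. f s) = (\<Sum>c\<in>UNIV. f [c :: 'n::finite])"
proof -
  have "basis_words 1 = (\<lambda>c :: 'n. [c]) ` UNIV" by (auto simp: basis_words_def length_Suc_conv)
  then show ?thesis by (simp add: sum.reindex inj_on_def)
qed

lemma sum_words2: "(\<Sum>s\<in>basis_words 2. f s) = (\<Sum>c\<in>UNIV. \<Sum>d\<in>UNIV. f [c, d :: 'n::finite])"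
proof -
  have "basis_words 2 = (\<lambda>(c, d :: 'n). [c, d]) ` (UNIV \<times> UNIV)"
    by (auto simp: basis_words_def length_Suc_conv numeral_2_eq_2)
  then have "(\<Sum>s\<in>basis_words 2. f s) = (\<Sum>(c, d)\<in>UNIV \<times> UNIV. f [c, d])"
    by (simp add: sum.reindex inj_on_def split_def)
  then show ?thesis by (simp add: sum.cartesian_product)
qed

lemma put2: "put i u [c, d] = (u(i := c))(Suc i := d)"
  by (auto simp: put_def fun_eq_iff less_Suc_eq nth_Cons')

lemma ent_Tp_Tp:
  "ent (Tp i (Tp (Suc i) A)) u v = (if u i = v i \<and> u (Suc i) = v (Suc i)
     then \<Sum>s\<in>basis_words 2. ent A (put i u s) (put i v s) else 0)"
  by (simp add: ent_Tp sum_words2 put2)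

text \<open>The entries of \<open>y\<close> need not commute with each other, but those of
  \<open>sl i 2 X\<close> are scalars, so exchanging the two summation words suffices.\<close>

lemma Tp_cyc:
  fixes y :: "(nat \<Rightarrow> 'n::finite, 'a::calgebra) rfm"
  shows "Tp i (Tp (Suc i) (sl i 2 X * y)) = Tp i (Tp (Suc i) (y * sl i 2 X))"
proof (rule rfm_eqI)
  fix u v :: "nat \<Rightarrow> 'n"
  have p: "put i (put i w s) t = put i w t" if "length s = 2" "length t = 2" for w :: "nat \<Rightarrow> 'n" and s t
    using that by (auto simp: put_def)
  have "(\<Sum>s\<in>basis_words 2. \<Sum>t\<in>basis_words 2. scal X s t * ent y (put i u t) (put i v s))
      = (\<Sum>s\<in>basis_words 2. \<Sum>t\<in>basis_words 2. ent y (put i u s) (put i v t) * scal X t s)"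
    by (subst sum.swap) (simp add: scal_def)
  then have "(\<Sum>s\<in>basis_words 2. ent (sl i 2 X * y) (put i u s) (put i v s))
      = (\<Sum>s\<in>basis_words 2. ent (y * sl i 2 X) (put i u s) (put i v s))"
    by (simp add: sl_def ent_lemb_times ent_times_lemb basis_words_def p)
  then show "ent (Tp i (Tp (Suc i) (sl i 2 X * y))) u v = ent (Tp i (Tp (Suc i) (y * sl i 2 X))) u v"
    by (simp add: ent_Tp_Tp)
qed

section \<open>Local operators of R-matrices\<close>

text \<open>With complex coefficients, operator identities can be read back as identities between
  numerical matrices, for instance in \<open>Gc_eval\<close> and
  \<open>nondegenerate_right\<close>.\<close>

instantiation complex :: calgebra
begin
definition cs_complex :: "complex \<Rightarrow> complex \<Rightarrow> complex" where "cs_complex c x = c * x"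
instance by standard (simp_all add: cs_complex_def algebra_simps)
end

definition m1 :: "complex^'n::finite^'n \<Rightarrow> nat \<Rightarrow> (nat \<Rightarrow> 'n, 'a::calgebra) rfm" where
  "m1 Y i = sl i 1 (at1 Y 1)"

definition m2 :: "complex^('n::finite \<times> 'n)^('n \<times> 'n) \<Rightarrow> nat \<Rightarrow> (nat \<Rightarrow> 'n, 'a::calgebra) rfm" where
  "m2 X i = sl i 2 (at2 X 1 2)"

lemma at1_single [simp]: "at1 Y (Suc 0) [a] [b] = Y $ a $ b"
  by (simp add: at1_def)

lemma at2_pair [simp]: "at2 X (Suc 0) 2 [a, b] [c, d] = X $ (a, b) $ (c, d)"
  by (simp add: at2_def less_Suc_eq)

lemma scal_at1: "scal (at1 Y i) = at1 (\<chi> a b. Y $ a $ b *\<^sub>C 1) i"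
  by (intro ext) (auto simp: scal_def at1_def)

lemma scal_at2: "scal (at2 X i j) = at2 (\<chi> s t. X $ s $ t *\<^sub>C 1) i j"
  by (intro ext) (auto simp: scal_def at2_def)

lemma sl_at1: "1 \<le> i \<Longrightarrow> i \<le> n \<Longrightarrow> sl m n (at1 Y i) = m1 Y (m + i - 1)"
  unfolding m1_def sl_def scal_at1 by (rule lemb_at1)

lemma sl_at2: "1 \<le> i \<Longrightarrow> Suc i \<le> n \<Longrightarrow> sl m n (at2 X i (Suc i)) = m2 X (m + i - 1)"
  unfolding m2_def sl_def scal_at2 by (rule lemb_at2)

lemma sl_op_prod: "sl m n (op_prod n As) = prod_list (map (sl m n) As)"
proof (induction As)
  case (Cons A As)
  have "op_prod n (A # As) = op_mult n A (op_prod n As)" by (simp add: op_prod_def)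
  then show ?case using Cons by (simp flip: sl_mult)
qed (simp add: op_prod_def sl_one)

lemma words2: "s \<in> basis_words 2 \<Longrightarrow> \<exists>a b. s = [a, b]"
  by (auto simp: basis_words_def length_Suc_conv numeral_2_eq_2)

lemma words1: "s \<in> basis_words 1 \<Longrightarrow> \<exists>a. s = [a]"
  by (auto simp: basis_words_def length_Suc_conv)

lemma op_eq_2I: "(\<And>a b c d. X [a, b] [c, d] = Y [a, b] [c, d]) \<Longrightarrow> op_eq 2 X Y"
  unfolding op_eq_def by (metis words2)

lemma op_eq_1I: "(\<And>a b. X [a] [b] = Y [a] [b]) \<Longrightarrow> op_eq 1 X Y"
  unfolding op_eq_def by (metis words1)

lemma sum_UNIV_pair: "(\<Sum>x\<in>UNIV. f x) = (\<Sum>a\<in>UNIV. \<Sum>b\<in>UNIV. f (a :: 'n::finite, b :: 'n))"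
  by (simp add: sum.cartesian_product flip: UNIV_Times_UNIV)

lemma m2_mult: "m2 X i * m2 Y i = m2 (X ** Y) i"
  unfolding m2_def sl_mult
  by (rule sl_cong, rule op_eq_2I) (simp add: op_mult_def sum_words2 matrix_matrix_mult_def sum_UNIV_pair)

lemma m2_add: "m2 (X + Y) i = m2 X i + m2 Y i"
  unfolding m2_def sl_add[symmetric] by (rule sl_cong, rule op_eq_2I) simp

lemma m2_mat: "m2 (mat c) i = c *\<^sub>C 1"
  unfolding m2_def sl_one[of i 2, symmetric] sl_cs[symmetric]
  by (rule sl_cong, rule op_eq_2I) (simp add: mat_def op_id_def)

lemma m2_diff: "m2 (X - Y) i = (m2 X i - m2 Y i :: (nat \<Rightarrow> 'n::finite, 'a::calgebra) rfm)"
proof -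
  have "m2 (X - Y) i + m2 Y i = (m2 X i :: (nat \<Rightarrow> 'n, 'a) rfm)" unfolding m2_add[symmetric] by simp
  then show ?thesis by (simp add: eq_diff_eq)
qed

lemma m2_zero: "m2 0 i = 0"
  using m2_diff[of 0 0 i] by simp

lemma m2_sum: "m2 (sum f A) i = (\<Sum>x\<in>A. m2 (f x) i)"
  by (induction A rule: infinite_finite_induct) (simp_all add: m2_zero m2_add)

lemma m2_inv:
  assumes "invertible X"
  shows "m2 X i * m2 (matrix_inv X) i = 1" "m2 (matrix_inv X) i * m2 X i = 1"
proof -
  have "X ** matrix_inv X = mat 1" "matrix_inv X ** X = mat 1"
    using assms unfolding matrix_inv_def invertible_def by (metis (mono_tags, lifting) someI_ex)+
  then show "m2 X i * m2 (matrix_inv X) i = 1" "m2 (matrix_inv X) i * m2 X i = 1"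
    by (simp_all add: m2_mult m2_mat)
qed

lemma m2_far: "Suc i < j \<Longrightarrow> m2 X i * m2 Y j = m2 Y j * m2 X i"
  unfolding m2_def using sl_disjoint[of i 2 j 2 "scal (at2 X 1 2)"] by (simp add: sl_def)

lemma m2_rel3:
  assumes "op_eq 3 (op_prod 3 As) (op_prod 3 Bs)"
  shows "prod_list (map (sl i 3) As) = prod_list (map (sl i 3) Bs)"
  unfolding sl_op_prod[symmetric] by (rule sl_cong[OF assms])

lemma sl3: "sl i 3 (at2 X 1 2) = m2 X i" "sl i 3 (at2 X (Suc 0) 2) = m2 X i" "sl i 3 (at2 X 2 3) = m2 X (Suc i)"
  using sl_at2[of 1 3 i X] sl_at2[of 2 3 i X] by (simp_all add: numeral_2_eq_2 numeral_3_eq_3)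

lemma pe_aux:
  fixes x :: "'a::calgebra"
  assumes "degree p \<le> n"
  shows "(\<Sum>j\<le>degree p. coeff p j *\<^sub>C x ^ j) = (\<Sum>j\<le>n. coeff p j *\<^sub>C x ^ j)"
  using assms by (intro sum.mono_neutral_left) (auto simp: coeff_eq_0)

lemma m2_poly_mat:
  "m2 (poly_mat p A) i = (\<Sum>j\<le>degree p. coeff p j *\<^sub>C (m2 A i :: (nat \<Rightarrow> 'n::finite, 'a::calgebra) rfm) ^ j)"
proof -
  have "m2 (((**) A ^^ j) (mat 1)) i = (m2 A i :: (nat \<Rightarrow> 'n, 'a) rfm) ^ j" for j
    by (induction j) (simp_all add: m2_mat flip: m2_mult)
  then show ?thesis
    unfolding poly_mat_def m2_sum by (simp add: m2_mat flip: m2_mult)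
qed

lemma BMW_bmw_algebra:
  assumes "BMW_type q \<mu> R"
  shows "bmw_algebra q \<mu> (m2 R) (m2 (matrix_inv R)) (m2 (K_mat q \<mu> R) :: nat \<Rightarrow> (nat \<Rightarrow> 'n::finite, 'a::calgebra) rfm)"
    and "BMW_eta q \<mu> \<noteq> 0"
    and "m2 (K_mat q \<mu> R) i * m2 (K_mat q \<mu> R) i = BMW_eta q \<mu> *\<^sub>C (m2 (K_mat q \<mu> R) i :: (nat \<Rightarrow> 'n::finite, 'a) rfm)"
proof -
  have q: "q \<noteq> 0" "q \<noteq> 1" "q \<noteq> - 1" and mu: "\<mu> \<noteq> 0" "\<mu> \<noteq> q" "\<mu> \<noteq> - inverse q"
    and Rm: "R_matrix R" and mp: "poly_mat ([:q, -1:] * [:inverse q, 1:] * [:\<mu>, -1:]) R = 0"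
    using assms by (auto simp: BMW_type_def is_minimal_poly_def)
  note rel = assms[unfolded BMW_type_def Let_def]
  have inv: "invertible R" using Rm by (simp add: R_matrix_def)
  have qq: "q * q \<noteq> 1" using q by (metis mult_cancel_right2 power2_eq_1_iff power2_eq_square)
  define l where "l = q - inverse q"
  have l0: "l \<noteq> 0" using q qq by (simp add: l_def field_simps)
  let ?r = "m2 R :: nat \<Rightarrow> (nat \<Rightarrow> 'n, 'a) rfm"
  let ?ri = "m2 (matrix_inv R) :: nat \<Rightarrow> (nat \<Rightarrow> 'n, 'a) rfm"
  let ?k = "m2 (K_mat q \<mu> R) :: nat \<Rightarrow> (nat \<Rightarrow> 'n, 'a) rfm"
  have k: "?k i = (inverse \<mu> * inverse l) *\<^sub>C ((q *\<^sub>C 1 - ?r i) * (inverse q *\<^sub>C 1 + ?r i))" for i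
    by (simp add: K_mat_def m2_mat m2_diff m2_add l_def flip: m2_mult)
  have cubic: "(q *\<^sub>C 1 - ?r i) * (inverse q *\<^sub>C 1 + ?r i) * (\<mu> *\<^sub>C 1 - ?r i) = 0" for i
  proof -
    define p where "p = [:q, -1:] * [:inverse q, 1:] * [:\<mu>, -1:]"
    have p: "p = [:\<mu>, \<mu> * l - 1, - l - \<mu>, 1:]"
      using q by (simp add: p_def l_def algebra_simps)
    have "0 = (\<Sum>j\<le>degree p. coeff p j *\<^sub>C ?r i ^ j)"
      unfolding m2_poly_mat[symmetric] using mp by (simp add: p_def m2_zero)
    also have "\<dots> = (\<Sum>j\<le>3. coeff p j *\<^sub>C ?r i ^ j)" by (rule pe_aux) (simp add: p)
    also have "\<dots> = \<mu> *\<^sub>C 1 + (\<mu> * l - 1) *\<^sub>C ?r i + (- l - \<mu>) *\<^sub>C (?r i * ?r i) + ?r i * (?r i * ?r i)"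
      by (simp add: p numeral_3_eq_3 numeral_2_eq_2 sum.atMost_Suc)
    also have "\<dots> = (q *\<^sub>C 1 - ?r i) * (inverse q *\<^sub>C 1 + ?r i) * (\<mu> *\<^sub>C 1 - ?r i)"
      using q by (simp add: l_def algebra_simps cs_add_left cs_add_right cs.scale_left_diff_distrib cs.scale_right_diff_distrib)
    finally show ?thesis by simp
  qed
  have kr: "?k i * ?r i = \<mu> *\<^sub>C ?k i" for i
  proof -
    have "?k i * (\<mu> *\<^sub>C 1 - ?r i) = 0" unfolding k by (simp add: cubic mult.assoc[symmetric])
    then show ?thesis by (simp add: right_diff_distrib)
  qed
  have k_exp: "?k i = (inverse \<mu> * inverse l) *\<^sub>C (1 + l *\<^sub>C ?r i - ?r i * ?r i)" for i
    unfolding k using q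
    by (simp add: l_def algebra_simps cs_add_left cs_add_right cs.scale_left_diff_distrib cs.scale_right_diff_distrib)
  \<comment> \<open>By definition \<open>K\<close> is quadratic in \<open>R\<close>. Inserting
    \<open>R\<close> times its inverse and using \<open>K * R = \<mu> K\<close> trades one factor
    \<open>R\<close> for a scalar, which leaves an expression linear in \<open>R\<close> and its
    inverse.\<close>
  have k_eq: "?k i = 1 - inverse l *\<^sub>C (?r i - ?ri i)" for i
  proof -
    have rr: "?r i * ?ri i = 1" "?ri i * ?r i = 1" using m2_inv[OF inv] by auto
    have "?k i = inverse \<mu> *\<^sub>C (\<mu> *\<^sub>C ?k i)" using mu by simp
    also have "\<mu> *\<^sub>C ?k i = \<mu> *\<^sub>C ((?k i * ?r i) * ?ri i)" by (simp add: mult.assoc rr)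
    also have "\<dots> = \<mu> *\<^sub>C (\<mu> *\<^sub>C (?k i * ?ri i))" by (simp add: kr)
    also have "?k i * ?ri i = (inverse \<mu> * inverse l) *\<^sub>C (?ri i + l *\<^sub>C 1 - ?r i)"
      unfolding k_exp by (simp add: left_diff_distrib distrib_right mult.assoc rr)
    finally have "?k i = (inverse \<mu> * (\<mu> * (\<mu> * (inverse \<mu> * inverse l)))) *\<^sub>C (?ri i + l *\<^sub>C 1 - ?r i)"
      by (simp only: cs_cs)
    also have "inverse \<mu> * (\<mu> * (\<mu> * (inverse \<mu> * inverse l))) = inverse l"
      using mu by (simp flip: mult.assoc)
    finally have "?k i = inverse l *\<^sub>C (?ri i + l *\<^sub>C 1 - ?r i)" .
    then show ?thesis using l0 by (simp add: cs_add_right cs.scale_right_diff_distrib)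
  qed
  have K1: "?k (Suc i) * ?k i = ?r i * ?r (Suc i) * ?k i"
    and K2: "?k (Suc i) * ?k i = ?ri i * ?ri (Suc i) * ?k i"
    and K3: "?k i * ?k (Suc i) * ?k i = ?k i" for i
  proof -
    have *: "op_eq 3 (op_prod 3 [at2 (K_mat q \<mu> R) 2 3, at2 (K_mat q \<mu> R) 1 2])
        (op_prod 3 [at2 R 1 2, at2 R 2 3, at2 (K_mat q \<mu> R) 1 2])"
      "op_eq 3 (op_prod 3 [at2 (K_mat q \<mu> R) 2 3, at2 (K_mat q \<mu> R) 1 2])
        (op_prod 3 [at2 (matrix_inv R) 1 2, at2 (matrix_inv R) 2 3, at2 (K_mat q \<mu> R) 1 2])"
      "op_eq 3 (op_prod 3 [at2 (K_mat q \<mu> R) 1 2, at2 (K_mat q \<mu> R) 2 3, at2 (K_mat q \<mu> R) 1 2])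
        (at2 (K_mat q \<mu> R) 1 2)"
      using rel by blast+
    show "?k (Suc i) * ?k i = ?r i * ?r (Suc i) * ?k i" using m2_rel3[OF *(1), of i] by (simp add: sl3 mult.assoc)
    show "?k (Suc i) * ?k i = ?ri i * ?ri (Suc i) * ?k i" using m2_rel3[OF *(2), of i] by (simp add: sl3 mult.assoc)
    show "?k i * ?k (Suc i) * ?k i = ?k i"
      using sl_cong[OF *(3), of i] by (simp add: sl3 sl_op_prod mult.assoc)
  qed
  have br: "?r i * ?r (Suc i) * ?r i = ?r (Suc i) * ?r i * ?r (Suc i)" for i
  proof -
    have "op_eq 3 (op_prod 3 [at2 R 1 2, at2 R 2 3, at2 R 1 2]) (op_prod 3 [at2 R 2 3, at2 R 1 2, at2 R 2 3])"
      using Rm by (simp add: R_matrix_def)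
    from m2_rel3[OF this, of i] show ?thesis by (simp add: sl3 mult.assoc)
  qed
  show "bmw_algebra q \<mu> ?r ?ri ?k"
    by (rule bmw_algebra.intro)
      (rule q(1) qq mu(1) m2_inv[OF inv] br kr K1 K2 K3 k_eq[unfolded l_def] m2_far | assumption)+
  have e: "q - \<mu> \<noteq> 0" "inverse q + \<mu> \<noteq> 0" using mu by (auto simp: add_eq_0_iff)
  show "BMW_eta q \<mu> \<noteq> 0" using e mu l0 by (simp add: BMW_eta_def l_def)
  have "?k i * (?r i * ?r i) = ?k i * ?r i * ?r i" by (rule mult.assoc[symmetric])
  then have kr2: "?k i * (?r i * ?r i) = (\<mu> * \<mu>) *\<^sub>C ?k i" by (simp only: kr mult_cs_left cs_cs)
  have "?k i * ?k i = (inverse \<mu> * inverse l) *\<^sub>C (?k i * (1 + l *\<^sub>C ?r i - ?r i * ?r i))"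
    using arg_cong[OF k_exp[of i], of "\<lambda>z. ?k i * z"] by (simp only: mult_cs_right)
  also have "\<dots> = (inverse \<mu> * inverse l * (1 + l * \<mu> - \<mu> * \<mu>)) *\<^sub>C ?k i"
    by (simp add: distrib_left right_diff_distrib kr kr2 cs_add_left cs_add_right
        cs.scale_left_diff_distrib cs.scale_right_diff_distrib mult.assoc)
  also have "inverse \<mu> * inverse l * (1 + l * \<mu> - \<mu> * \<mu>) = BMW_eta q \<mu>"
  proof -
    have "(q - \<mu>) * (inverse q + \<mu>) = 1 + l * \<mu> - \<mu> * \<mu>" using q by (simp add: l_def algebra_simps)
    then show ?thesis by (simp add: BMW_eta_def l_def divide_inverse mult_ac)
  qed
  finally show "?k i * ?k i = BMW_eta q \<mu> *\<^sub>C ?k i" .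
qed

section \<open>Skew invertibility\<close>

lemma sum_words3: "(\<Sum>s\<in>basis_words 3. f s) = (\<Sum>c\<in>UNIV. \<Sum>d\<in>UNIV. \<Sum>e\<in>UNIV. f [c, d, e :: 'n::finite])"
proof -
  have "basis_words 3 = (\<lambda>(c, d, e :: 'n). [c, d, e]) ` (UNIV \<times> UNIV \<times> UNIV)"
    by (auto simp: basis_words_def length_Suc_conv numeral_3_eq_3 image_iff)
  then have "(\<Sum>s\<in>basis_words 3. f s) = (\<Sum>(c, d, e)\<in>UNIV \<times> UNIV \<times> UNIV. f [c, d, e])"
    by (simp add: sum.reindex inj_on_def split_def)
  then show ?thesis by (simp add: sum.cartesian_product)
qed

lemma sum_delta_UNIV: "(\<Sum>z\<in>UNIV. if c = (z :: 'n::finite) then f z else 0) = f c"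
  "(\<Sum>z\<in>UNIV. if z = c then f z else 0) = f c"
  by simp_all

lemma skew_trace_entry:
  fixes a b c d :: "'a::finite"
  shows "ptrace 2 (op_mult 3 (at2 X 1 2) (at2 Y 2 3)) [a, c] [b, d]
    = (\<Sum>e\<in>UNIV. \<Sum>y\<in>UNIV. X $ (a, e) $ (b, y) * Y $ (y, c) $ (e, d) :: complex)"
proof -
  have "at2 X 1 2 [a, e, c] [x, y, z] = (if c = z then X $ (a, e) $ (x, y) else 0)"
    "at2 Y 2 3 [x, y, z] [b, e, d] = (if x = b then Y $ (y, z) $ (e, d) else 0)" for e x y z
    by (auto simp: at2_def less_Suc_eq numeral_3_eq_3 numeral_2_eq_2)
  then have "at2 X 1 2 [a, e, c] [x, y, z] * at2 Y 2 3 [x, y, z] [b, e, d]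
      = (if x = b then if c = z then X $ (a, e) $ (x, y) * Y $ (y, z) $ (e, d) else 0 else 0)" for e x y z
    by simp
  note e1 = this
  have 1: "(\<Sum>z\<in>UNIV. if P then if c = z then h z else 0 else 0) = (if P then h c else 0)" for P and h :: "'a \<Rightarrow> complex"
    by simp
  have 2: "(\<Sum>x\<in>UNIV. \<Sum>y\<in>UNIV. if x = b then h x y else 0) = (\<Sum>y\<in>UNIV. h b y)" for h :: "'a \<Rightarrow> 'a \<Rightarrow> complex"
    by (subst sum.swap) simp
  have ins: "insert_at 2 e [p, r] = [p, e, r]" for e p r :: 'a by (simp add: insert_at_def)
  show ?thesis
    unfolding ptrace_def op_mult_def sum_words3 ins e1 1 2 ..
qed

lemma skew_inverseD:
  assumes "is_skew_inverse X Y"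
  shows "(\<Sum>e\<in>UNIV. \<Sum>y\<in>UNIV. X $ (a, e) $ (b, y) * Y $ (y, c) $ (e, d)) = (if a = d \<and> c = b then 1 else 0)"
    "(\<Sum>e\<in>UNIV. \<Sum>y\<in>UNIV. Y $ (a, e) $ (b, y) * X $ (y, c) $ (e, d)) = (if a = d \<and> c = b then 1 else 0)"
proof -
  have w: "[x, y] \<in> basis_words 2" for x y :: 'a by (simp add: basis_words_def)
  have f: "at2 flip 1 2 [a, c] [b, d] = (if a = d \<and> c = b then 1 else 0)" by (simp add: flip_def)
  have "ptrace 2 (op_mult 3 (at2 X 1 2) (at2 Y 2 3)) [a, c] [b, d] = at2 flip 1 2 [a, c] [b, d]"
    "ptrace 2 (op_mult 3 (at2 Y 1 2) (at2 X 2 3)) [a, c] [b, d] = at2 flip 1 2 [a, c] [b, d]"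
    using assms w unfolding is_skew_inverse_def op_eq_def by blast+
  then show "(\<Sum>e\<in>UNIV. \<Sum>y\<in>UNIV. X $ (a, e) $ (b, y) * Y $ (y, c) $ (e, d)) = (if a = d \<and> c = b then 1 else 0)"
    "(\<Sum>e\<in>UNIV. \<Sum>y\<in>UNIV. Y $ (a, e) $ (b, y) * X $ (y, c) $ (e, d)) = (if a = d \<and> c = b then 1 else 0)"
    by (simp_all only: skew_trace_entry f)
qed

lemma sum_swap_23:
  "(\<Sum>a\<in>A. \<Sum>b\<in>B. \<Sum>c\<in>C. \<Sum>d\<in>D. \<Sum>e\<in>E. f a b c d e :: 'z::comm_monoid_add)
    = (\<Sum>c\<in>C. \<Sum>d\<in>D. \<Sum>e\<in>E. \<Sum>a\<in>A. \<Sum>b\<in>B. f a b c d e)"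
  unfolding sum.cartesian_product
  by (rule sum.reindex_bij_witness[of _ "\<lambda>(c, d, e, a, b). (a, b, c, d, e)" "\<lambda>(a, b, c, d, e). (c, d, e, a, b)"]) auto

lemma sum_swap_22:
  "(\<Sum>a\<in>A. \<Sum>b\<in>B. \<Sum>c\<in>C. \<Sum>d\<in>D. f a b c d :: 'z::comm_monoid_add)
    = (\<Sum>c\<in>C. \<Sum>d\<in>D. \<Sum>a\<in>A. \<Sum>b\<in>B. f a b c d)"
  unfolding sum.cartesian_product
  by (rule sum.reindex_bij_witness[of _ "\<lambda>(c, d, a, b). (a, b, c, d)" "\<lambda>(a, b, c, d). (c, d, a, b)"]) auto

lemma sum_reorder5:
  "(\<Sum>c\<in>C. \<Sum>d\<in>D. \<Sum>e\<in>E. \<Sum>f\<in>F. \<Sum>g\<in>G. h c d e f g :: 'z::comm_monoid_add)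
    = (\<Sum>e\<in>E. \<Sum>g\<in>G. \<Sum>c\<in>C. \<Sum>d\<in>D. \<Sum>f\<in>F. h c d e f g)"
  unfolding sum.cartesian_product
  by (rule sum.reindex_bij_witness[of _ "\<lambda>(e, g, c, d, f). (c, d, e, f, g)" "\<lambda>(c, d, e, f, g). (e, g, c, d, f)"]) auto

lemma delta2:
  fixes a b :: "'n::finite" and h :: "'n \<Rightarrow> 'n \<Rightarrow> 'z::comm_monoid_add"
  shows "(\<Sum>x\<in>UNIV. \<Sum>y\<in>UNIV. if x = a \<and> y = b then h x y else 0) = h a b"
proof -
  have "(\<Sum>y\<in>UNIV. if x = a \<and> y = b then h x y else 0) = (if x = a then h a b else 0)" for x
    by (cases "x = a") simp_all
  then show ?thesis by simp
qed

section \<open>The R-trace on row-finite matrices\<close>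

definition Rtr :: "complex^'n^'n \<Rightarrow> nat \<Rightarrow> (nat \<Rightarrow> 'n::finite, 'a::calgebra) rfm \<Rightarrow> (nat \<Rightarrow> 'n, 'a) rfm" where
  "Rtr D n A = Tp n (m1 D n * A)"

lemma m1_Eset: "i < n \<Longrightarrow> m1 Y i \<in> Eset n"
  unfolding m1_def sl_def by (rule lemb_Eset) simp

lemma m2_Eset: "Suc i < n \<Longrightarrow> m2 X i \<in> Eset n"
  unfolding m2_def sl_def by (rule lemb_Eset) simp

lemma Eset_m1: "x \<in> Eset n \<Longrightarrow> x * m1 Y n = m1 Y n * x"
  unfolding m1_def Eset_def using sl_disjoint[of 0 n n 1] by auto

lemma Rtr_left: "x \<in> Eset n \<Longrightarrow> Rtr D n (x * y) = x * Rtr D n y"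
  unfolding Rtr_def Tp_left[symmetric] by (simp add: comm_left[OF Eset_m1])

lemma Rtr_right: "x \<in> Eset n \<Longrightarrow> Rtr D n (y * x) = Rtr D n y * x"
  unfolding Rtr_def Tp_right[symmetric] by (simp add: mult.assoc)

lemma Rtr_add: "Rtr D n (x + y) = Rtr D n x + Rtr D n y"
  by (simp add: Rtr_def distrib_left Tp_add)

lemma Rtr_cs: "Rtr D n (c *\<^sub>C x) = c *\<^sub>C Rtr D n x"
  by (simp add: Rtr_def Tp_cs)

lemma Rtr_Eset: "x \<in> Eset (Suc n) \<Longrightarrow> Rtr D n x \<in> Eset n"
  unfolding Rtr_def by (intro Tp_Eset Eset_mult m1_Eset) auto

lemma Tp_sl: "Tp (m + n) (sl m (Suc n) X) = sl m n (ptrace (Suc n) X)"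
  unfolding sl_def Tp_lemb
  by (rule lemb_cong) (simp add: op_eq_def ptrace_def scal_def cs.scale_sum_left)

lemma Rtr_m2:
  fixes D :: "complex^'n::finite^'n"
  shows "(Rtr D (Suc i) (m2 X i) :: (nat \<Rightarrow> 'n, 'a::calgebra) rfm) = m1 (\<chi> a b. \<Sum>c\<in>UNIV. \<Sum>d\<in>UNIV. D $ c $ d * X $ (a, d) $ (b, c)) i"
proof -
  have D: "(m1 D (Suc i) :: (nat \<Rightarrow> 'n, 'a) rfm) = sl i 2 (at1 D 2)" by (subst sl_at1) simp_all
  have e: "at1 D 2 [a, c] [x, y] = (if a = x then D $ c $ y else 0)" for a c x y
    by (simp add: at1_def less_Suc_eq numeral_2_eq_2)
  have "op_eq 1 (ptrace (Suc 1) (op_mult 2 (at1 D 2) (at2 X 1 2)))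
      (at1 (\<chi> a b. \<Sum>c\<in>UNIV. \<Sum>d\<in>UNIV. D $ c $ d * X $ (a, d) $ (b, c)) 1)"
  proof (rule op_eq_1I)
    fix a b
    have "(\<Sum>x\<in>UNIV. \<Sum>y\<in>UNIV. (if a = x then D $ c $ y else 0) * X $ (x, y) $ (b, c))
        = (\<Sum>y\<in>UNIV. D $ c $ y * X $ (a, y) $ (b, c))" for c
      by (subst sum.swap) (simp add: if_distrib[of "\<lambda>z. z * _"] cong: if_cong)
    then show "ptrace (Suc 1) (op_mult 2 (at1 D 2) (at2 X 1 2)) [a] [b]
        = at1 (\<chi> a b. \<Sum>c\<in>UNIV. \<Sum>d\<in>UNIV. D $ c $ d * X $ (a, d) $ (b, c)) 1 [a] [b]"
      by (simp add: ptrace_def insert_at_def op_mult_def sum_words2 e)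
  qed
  moreover have "(Rtr D (Suc i) (m2 X i) :: (nat \<Rightarrow> 'n, 'a) rfm) = Tp (i + 1) (sl i (Suc 1) (op_mult 2 (at1 D 2) (at2 X 1 2)))"
    unfolding Rtr_def D m2_def sl_mult by (simp add: numeral_2_eq_2)
  ultimately show ?thesis unfolding m1_def Tp_sl by (simp add: sl_cong)
qed

lemma ent_m1_times: "ent (m1 Y i * B) u v = (\<Sum>d\<in>UNIV. Y $ (u i) $ d *\<^sub>C ent B (u(i := d)) v)"
proof -
  have "put i u [d] = u(i := d)" for d by (auto simp: put_def)
  moreover have "win i 1 u = [u i]" by (simp add: win_def)
  ultimately show ?thesis
    unfolding m1_def sl_def ent_lemb_times by (simp add: sum_words1[unfolded One_nat_def] scal_def)
qed

lemma win2: "win i 2 u = [u i, u (Suc i)]"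
  by (simp add: win_def numeral_2_eq_2)

lemma ent_m2_times: "ent (m2 X i * B) u v
    = (\<Sum>e\<in>UNIV. \<Sum>f\<in>UNIV. X $ (u i, u (Suc i)) $ (e, f) *\<^sub>C ent B (u(i := e, Suc i := f)) v)"
  unfolding m2_def sl_def ent_lemb_times by (simp add: sum_words2 scal_def win2 put2)

lemma ent_times_m2: "ent (B * m2 X i) u v
    = (\<Sum>e\<in>UNIV. \<Sum>f\<in>UNIV. X $ (e, f) $ (v i, v (Suc i)) *\<^sub>C ent B u (v(i := e, Suc i := f)))"
  unfolding m2_def sl_def ent_times_lemb by (simp add: sum_words2 scal_def win2 put2)

lemma Eset_indep:
  assumes x: "x \<in> Eset n" and n: "n \<le> j" and uv: "u j = v j"
  shows "ent x (u(j := f)) (v(j := f')) = (if f = f' then ent x u v else 0)"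
proof -
  obtain X where X: "x = lemb 0 n X" using x by (auto simp: Eset_def)
  have w: "win 0 n (w(j := f)) = win 0 n w" for w f using n by (auto intro!: nth_equalityI)
  have "agree 0 n (u(j := f)) (v(j := f')) \<longleftrightarrow> f = f' \<and> agree 0 n u v"
    using n uv by (auto simp: agree_def)
  then show ?thesis by (simp add: X ent_lemb w)
qed

text \<open>The kernel of \<open>x \<mapsto> Rtr D (i + 1) (X x Y)\<close>, for \<open>x\<close> acting on the first factor of \<open>X\<close> and \<open>Y\<close>.\<close>

definition Gc :: "complex^'n^'n \<Rightarrow> complex^('n::finite \<times> 'n)^('n \<times> 'n) \<Rightarrow> complex^('n \<times> 'n)^('n \<times> 'n)
    \<Rightarrow> 'n \<Rightarrow> 'n \<Rightarrow> 'n \<Rightarrow> 'n \<Rightarrow> complex" where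
  "Gc D X Y a e e' b = (\<Sum>c\<in>UNIV. \<Sum>d\<in>UNIV. \<Sum>f\<in>UNIV. D $ c $ d * X $ (a, d) $ (e, f) * Y $ (e', f) $ (b, c))"

lemma ent_Rtr_conj:
  fixes x :: "(nat \<Rightarrow> 'n::finite, 'a::calgebra) rfm"
  assumes x: "x \<in> Eset (Suc i)" and uv: "u (Suc i) = v (Suc i)"
  shows "ent (Rtr D (Suc i) (m2 X i * x * m2 Y i)) u v
    = (\<Sum>e\<in>UNIV. \<Sum>e'\<in>UNIV. Gc D X Y (u i) e e' (v i) *\<^sub>C ent x (u(i := e)) (v(i := e')))"
proof -
  let ?S = "Suc i"
  define y where "y e e' = ent x (u(i := e)) (v(i := e'))" for e e'
  have y: "ent x (u(i := e, ?S := f)) (v(i := e', ?S := f')) = (if f = f' then y e e' else 0)" for e f e' f'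
    using Eset_indep[OF x order_refl, of "u(i := e)" "v(i := e')" f f'] uv by (simp add: y_def)
  have "ent (Rtr D ?S (m2 X i * x * m2 Y i)) u v
      = (\<Sum>c\<in>UNIV. \<Sum>d\<in>UNIV. D $ c $ d *\<^sub>C (\<Sum>e\<in>UNIV. \<Sum>f\<in>UNIV. X $ (u i, d) $ (e, f) *\<^sub>C
          (\<Sum>e'\<in>UNIV. \<Sum>f'\<in>UNIV. Y $ (e', f') $ (v i, c) *\<^sub>C (if f = f' then y e e' else 0))))"
    unfolding Rtr_def ent_Tp mult.assoc ent_m1_times ent_m2_times ent_times_m2 using uv
    by (simp add: y)
  also have "\<dots> = (\<Sum>c\<in>UNIV. \<Sum>d\<in>UNIV. \<Sum>e\<in>UNIV. \<Sum>f\<in>UNIV. \<Sum>e'\<in>UNIV.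
      (D $ c $ d * X $ (u i, d) $ (e, f) * Y $ (e', f) $ (v i, c)) *\<^sub>C y e e')"
  proof -
    have "(\<Sum>f'\<in>UNIV. Y $ (e', f') $ (v i, c) *\<^sub>C (if f = f' then y e e' else 0)) = Y $ (e', f) $ (v i, c) *\<^sub>C y e e'"
      for c e e' f
    proof -
      have "Y $ (e', f') $ (v i, c) *\<^sub>C (if f = f' then y e e' else 0)
          = (if f = f' then Y $ (e', f') $ (v i, c) *\<^sub>C y e e' else 0)" for f' by simp
      then show ?thesis by (simp only: sum_delta_UNIV)
    qed
    note * = this
    show ?thesis unfolding * cs.scale_sum_right cs_cs mult.assoc ..
  qed
  also have "\<dots> = (\<Sum>e\<in>UNIV. \<Sum>e'\<in>UNIV. Gc D X Y (u i) e e' (v i) *\<^sub>C y e e')"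
    by (subst sum_reorder5) (simp only: Gc_def cs.scale_sum_left)
  finally show ?thesis by (simp add: y_def)
qed

lemma D_mat_entry: "D_mat R $ p $ r = (\<Sum>c\<in>UNIV. skew_inv R $ (p, c) $ (r, c))"
  by (simp add: D_mat_def ptrace_def insert_at_def)

lemma C_mat_entry: "C_mat R $ p $ r = (\<Sum>c\<in>UNIV. skew_inv R $ (c, p) $ (c, r))"
  by (simp add: C_mat_def ptrace_def insert_at_def)

lemma skew_inv: "skew_invertible R \<Longrightarrow> is_skew_inverse R (skew_inv R)"
  unfolding skew_invertible_def skew_inv_def by (rule someI_ex)

text \<open>\<open>D_mat R\<close> is itself a partial trace of the skew inverse, so this is the
  skew inverse relation with one further pair of indices contracted.\<close>

lemma Rtr_R:
  assumes "skew_invertible R"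
  shows "Rtr (D_mat R) (Suc i) (m2 R i) = (1 :: (nat \<Rightarrow> 'n::finite, 'a::calgebra) rfm)"
proof -
  note sk = skew_inverseD[OF skew_inv[OF assms]]
  have "(\<Sum>c\<in>UNIV. \<Sum>d\<in>UNIV. D_mat R $ c $ d * R $ (a, d) $ (b, c)) = (if a = b then 1 else 0)" for a b
  proof -
    have "(\<Sum>c\<in>UNIV. \<Sum>d\<in>UNIV. D_mat R $ c $ d * R $ (a, d) $ (b, c))
        = (\<Sum>d\<in>UNIV. \<Sum>c\<in>UNIV. \<Sum>e\<in>UNIV. R $ (a, d) $ (b, c) * skew_inv R $ (c, e) $ (d, e))"
      by (subst sum.swap) (simp add: D_mat_entry sum_distrib_left sum_distrib_right mult_ac)
    also have "\<dots> = (\<Sum>d\<in>UNIV. \<Sum>e\<in>UNIV. \<Sum>c\<in>UNIV. R $ (a, d) $ (b, c) * skew_inv R $ (c, e) $ (d, e))"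
      by (intro sum.cong refl sum.swap)
    also have "\<dots> = (\<Sum>e\<in>UNIV. \<Sum>d\<in>UNIV. \<Sum>c\<in>UNIV. R $ (a, d) $ (b, c) * skew_inv R $ (c, e) $ (d, e))"
      by (rule sum.swap)
    also have "\<dots> = (\<Sum>e\<in>UNIV. if a = e \<and> e = b then 1 else 0)" by (simp only: sk(1))
    also have "\<dots> = (\<Sum>e\<in>UNIV. if e = a then (if a = b then 1 else 0) else 0)"
      by (intro sum.cong refl) auto
    also have "\<dots> = (if a = b then 1 else 0)" by simp
    finally show ?thesis .
  qed
  then have "(\<chi> a b. \<Sum>c\<in>UNIV. \<Sum>d\<in>UNIV. D_mat R $ c $ d * R $ (a, d) $ (b, c)) = mat 1"
    by (simp add: mat_def vec_eq_iff)
  then have "Rtr (D_mat R) (Suc i) (m2 R i) = (m1 (mat 1) i :: (nat \<Rightarrow> 'n, 'a) rfm)"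
    by (simp add: Rtr_m2)
  also have "\<dots> = sl i 1 op_id"
    unfolding m1_def by (rule sl_cong, rule op_eq_1I) (simp add: mat_def op_id_def)
  finally show ?thesis by (simp add: sl_one)
qed

text \<open>One test operator is enough. Skew invertibility makes pairing with the entries of
  \<open>R\<close> an invertible operation, and contraction with the skew inverse solves the
  resulting linear system for the kernel.\<close>

lemma Gc_eval:
  assumes sk: "skew_invertible R"
    and h: "Rtr (D_mat R) 2 (m2 X 1 * m2 R 0 * m2 Y 1) = (1 :: (nat \<Rightarrow> 'n::finite, complex) rfm)"
  shows "Gc (D_mat R) X Y a r p b = (if a = b then D_mat R $ p $ r else 0)"
proof -
  note sk = skew_inverseD[OF skew_inv[OF sk]]
  let ?G = "Gc (D_mat R) X Y"
  have rel: "(\<Sum>e\<in>UNIV. \<Sum>e'\<in>UNIV. ?G a e e' b * R $ (x, e) $ (y, e')) = (if x = y \<and> a = b then 1 else 0)" for x y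
  proof -
    define u where "u j = (if j = 0 then x else a)" for j :: nat
    define v where "v j = (if j = 0 then y else if j = 1 then b else a)" for j :: nat
    have "u = v \<longleftrightarrow> x = y \<and> a = b" by (auto simp: u_def v_def fun_eq_iff split: if_splits)
    moreover have "ent (m2 R 0 :: (nat \<Rightarrow> 'n, complex) rfm) (u(1 := e)) (v(1 := e')) = R $ (x, e) $ (y, e')" for e e'
      unfolding m2_def sl_def ent_lemb
      by (auto simp: win2 scal_def cs_complex_def agree_def u_def v_def)
    moreover have "(m2 R 0 :: (nat \<Rightarrow> 'n, complex) rfm) \<in> Eset (Suc 1)" by (rule m2_Eset) simp
    from ent_Rtr_conj[OF this, of u v "D_mat R" X Y]
    have "ent (1 :: (nat \<Rightarrow> 'n, complex) rfm) u v
        = (\<Sum>e\<in>UNIV. \<Sum>e'\<in>UNIV. ?G (u 1) e e' (v 1) *\<^sub>C ent (m2 R 0 :: (nat \<Rightarrow> 'n, complex) rfm) (u(1 := e)) (v(1 := e')))"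
      unfolding h[symmetric] by (simp add: u_def v_def numeral_2_eq_2)
    ultimately show ?thesis by (simp add: ent_one cs_complex_def u_def v_def)
  qed
  let ?P = "skew_inv R"
  have "(\<Sum>y\<in>UNIV. \<Sum>x\<in>UNIV. ?P $ (p, y) $ (r, x) * (\<Sum>e\<in>UNIV. \<Sum>e'\<in>UNIV. ?G a e e' b * R $ (x, e) $ (y, e')))
      = (\<Sum>e\<in>UNIV. \<Sum>e'\<in>UNIV. ?G a e e' b * (\<Sum>y\<in>UNIV. \<Sum>x\<in>UNIV. ?P $ (p, y) $ (r, x) * R $ (x, e) $ (y, e')))"
    by (simp add: sum_distrib_left) (subst sum_swap_22, simp add: mult_ac)
  also have "\<dots> = (\<Sum>e\<in>UNIV. \<Sum>e'\<in>UNIV. if e = r \<and> e' = p then ?G a e e' b else 0)"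
    unfolding sk(2) by (intro sum.cong refl) auto
  also have "\<dots> = ?G a r p b" by (rule delta2)
  finally have "?G a r p b = (\<Sum>y\<in>UNIV. \<Sum>x\<in>UNIV. ?P $ (p, y) $ (r, x) * (if x = y \<and> a = b then 1 else 0))"
    unfolding rel by simp
  also have "\<dots> = (\<Sum>y\<in>UNIV. if a = b then ?P $ (p, y) $ (r, y) else 0)"
  proof (intro sum.cong refl)
    fix y
    have "?P $ (p, y) $ (r, x) * (if x = y \<and> a = b then 1 else 0)
        = (if x = y then if a = b then ?P $ (p, y) $ (r, x) else 0 else 0)" for x by simp
    then show "(\<Sum>x\<in>UNIV. ?P $ (p, y) $ (r, x) * (if x = y \<and> a = b then 1 else 0))
        = (if a = b then ?P $ (p, y) $ (r, y) else 0)" by (simp only: sum_delta_UNIV)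
  qed
  finally show ?thesis by (simp add: D_mat_entry)
qed

lemma Rtr_conj:
  fixes x :: "(nat \<Rightarrow> 'n::finite, 'a::calgebra) rfm"
  assumes G: "\<And>a r p b. Gc D X Y a r p b = (if a = b then D $ p $ r else 0)" and x: "x \<in> Eset (Suc i)"
  shows "Rtr D (Suc i) (m2 X i * x * m2 Y i) = Rtr D i x"
proof (rule rfm_eqI)
  fix u v :: "nat \<Rightarrow> 'n"
  have R: "ent (Rtr D i x) u v
    = (if u i = v i then \<Sum>c\<in>UNIV. \<Sum>d\<in>UNIV. D $ c $ d *\<^sub>C ent x (u(i := d)) (v(i := c)) else 0)"
    by (simp add: Rtr_def ent_Tp ent_m1_times)
  show "ent (Rtr D (Suc i) (m2 X i * x * m2 Y i)) u v = ent (Rtr D i x) u v"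
  proof (cases "u (Suc i) = v (Suc i)")
    case True
    show ?thesis unfolding ent_Rtr_conj[of x i u v, OF x True] R G
      by (subst sum.swap) auto
  next
    case False
    obtain X' where X': "x = lemb 0 (Suc i) X'" using x by (auto simp: Eset_def)
    have "\<not> agree 0 (Suc i) (u(i := d)) (v(i := c))" for c d
      using False by (auto simp: agree_def intro!: exI[of _ "Suc i"])
    then show ?thesis unfolding R using False by (simp add: Rtr_def ent_Tp X' ent_lemb)
  qed
qed

lemma m1_diff: "(m1 (X - Y) i :: (nat \<Rightarrow> 'n::finite, 'a::calgebra) rfm) = m1 X i - m1 Y i"
proof -
  have "m1 (X - Y) i + m1 Y i = (m1 X i :: (nat \<Rightarrow> 'n, 'a) rfm)"
    unfolding m1_def sl_add[symmetric] by (rule sl_cong, rule op_eq_1I) simp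
  then show ?thesis by (simp add: eq_diff_eq)
qed

lemma m1_mat: "m1 (mat c) i = c *\<^sub>C 1"
  unfolding m1_def sl_one[of i 1, symmetric] sl_cs[symmetric]
  by (rule sl_cong, rule op_eq_1I) (simp add: mat_def op_id_def)

lemma m2_inj:
  assumes "(m2 X i :: (nat \<Rightarrow> 'n::finite, 'a::calgebra) rfm) = m2 Y i" shows "X = Y"
proof -
  have "op_eq 2 (at2 X 1 2) (at2 Y 1 2)" using sl_inj assms unfolding m2_def by blast
  then have "at2 X 1 2 [a, b] [c, d] = at2 Y 1 2 [a, b] [c, d]" for a b c d
  proof -
    have "[a, b] \<in> basis_words 2" "[c, d] \<in> basis_words 2" by (simp_all add: basis_words_def)
    then show ?thesis using \<open>op_eq 2 (at2 X 1 2) (at2 Y 1 2)\<close> unfolding op_eq_def by blast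
  qed
  then show ?thesis by (auto simp: vec_eq_iff)
qed

definition kron :: "complex^'n::finite^'n \<Rightarrow> complex^('n \<times> 'n)^('n \<times> 'n)" where
  "kron D = (\<chi> s t. D $ fst s $ fst t * D $ snd s $ snd t)"

lemma m1_split:
  "m1 Z i = sl i 2 (at1 Z 1)" "m1 Z (Suc i) = sl i 2 (at1 Z 2)"
  by (simp_all add: sl_at1)

lemma at1_2_entries: "at1 Z (Suc 0) [a, p] [x, d] = (if p = d then Z $ a $ x else 0)"
  "at1 Z 2 [a, p] [x, d] = (if a = x then Z $ p $ d else 0)"
  by (auto simp: at1_def less_Suc_eq numeral_2_eq_2)

lemma m1_m1: "m1 D i * m1 D (Suc i) = m2 (kron D) i"
  unfolding m1_split(2)[of D i] unfolding m1_split(1)[of D i] m2_def sl_mult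
proof (rule sl_cong, rule op_eq_2I)
  fix a p x d :: 'a
  have "(if p = z then D $ a $ y else 0) * (if y = x then D $ z $ d else 0)
      = (if y = x \<and> z = p then D $ a $ y * D $ z $ d else 0)" for y z by auto
  then show "op_mult 2 (at1 D 1) (at1 D 2) [a, p] [x, d] = at2 (kron D) 1 2 [a, p] [x, d]"
    by (simp add: op_mult_def sum_words2 at1_2_entries kron_def delta2)
qed

locale skew_bmw =
  fixes q \<mu> :: complex and R :: "complex^('n::finite \<times> 'n)^('n \<times> 'n)"
  assumes bmw: "BMW_type q \<mu> R" and skew: "skew_invertible R"
begin

abbreviation "Rinv \<equiv> matrix_inv R"
abbreviation "Km \<equiv> K_mat q \<mu> R"
abbreviation "D \<equiv> D_mat R"
abbreviation "Psi \<equiv> skew_inv R"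

lemmas sk = skew_inverseD[OF skew_inv[OF skew]]

lemma bmw_alg:
  "bmw_algebra q \<mu> (m2 R) (m2 Rinv) (m2 Km :: nat \<Rightarrow> (nat \<Rightarrow> 'n, 'a::calgebra) rfm)"
  by (rule BMW_bmw_algebra(1)[OF bmw])

text \<open>The relation moves \<open>R\<close> onto the traced strand, where its R-trace is 1; the
  outer factors do not touch that strand and cancel. This supplies the single test required by
  \<open>Gc_eval\<close>.\<close>

lemma Gc_conj:
  assumes e: "m2 X 1 * m2 R 0 * m2 Y 1 = (m2 A 0 * m2 R 1 * m2 B 0 :: (nat \<Rightarrow> 'n, complex) rfm)"
    and AB: "m2 A 0 * m2 B 0 = (1 :: (nat \<Rightarrow> 'n, complex) rfm)"
  shows "Gc D X Y a r p b = (if a = b then D $ p $ r else 0)"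
proof (rule Gc_eval[OF skew])
  have E: "(m2 A 0 :: (nat \<Rightarrow> 'n, complex) rfm) \<in> Eset 2" "(m2 B 0 :: (nat \<Rightarrow> 'n, complex) rfm) \<in> Eset 2"
    by (simp_all add: m2_Eset)
  have "Rtr D 2 (m2 X 1 * m2 R 0 * m2 Y 1) = m2 A 0 * (Rtr D 2 (m2 R 1) * (m2 B 0 :: (nat \<Rightarrow> 'n, complex) rfm))"
    unfolding e unfolding mult.assoc by (simp only: Rtr_left[OF E(1)] Rtr_right[OF E(2)])
  also have "Rtr D 2 (m2 R 1) = (1 :: (nat \<Rightarrow> 'n, complex) rfm)"
    using Rtr_R[OF skew, of 1] by (simp add: numeral_2_eq_2)
  finally show "Rtr D 2 (m2 X 1 * m2 R 0 * m2 Y 1) = (1 :: (nat \<Rightarrow> 'n, complex) rfm)" by (simp add: AB)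
qed

lemma Gc_R_Rinv: "Gc D R Rinv a r p b = (if a = b then D $ p $ r else 0)"
  and Gc_Rinv_R: "Gc D Rinv R a r p b = (if a = b then D $ p $ r else 0)"
proof -
  interpret bmw_algebra q \<mu> "m2 R" "m2 Rinv" "m2 Km :: nat \<Rightarrow> (nat \<Rightarrow> 'n, complex) rfm"
    by (rule bmw_alg)
  let ?R = "m2 R :: nat \<Rightarrow> (nat \<Rightarrow> 'n, complex) rfm"
  let ?Ri = "m2 Rinv :: nat \<Rightarrow> (nat \<Rightarrow> 'n, complex) rfm"
  have b: "?R 0 * (?R 1 * ?R 0) = ?R 1 * (?R 0 * ?R 1)" using braid_Suc[of 0] by (simp add: mult.assoc)
  have "?R 1 * ?R 0 * ?Ri 1 = ?Ri 0 * (?R 0 * (?R 1 * ?R 0)) * ?Ri 1" by (simp add: mult.assoc)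
  also have "\<dots> = ?Ri 0 * ?R 1 * ?R 0" unfolding b by (simp add: mult.assoc)
  finally have 1: "?R 1 * ?R 0 * ?Ri 1 = ?Ri 0 * ?R 1 * ?R 0" .
  have "?Ri 1 * ?R 0 * ?R 1 = ?Ri 1 * (?R 0 * (?R 1 * ?R 0)) * ?Ri 0" by (simp add: mult.assoc)
  also have "\<dots> = ?R 0 * ?R 1 * ?Ri 0" unfolding b by (simp add: mult.assoc)
  finally have 2: "?Ri 1 * ?R 0 * ?R 1 = ?R 0 * ?R 1 * ?Ri 0" .
  show "Gc D R Rinv a r p b = (if a = b then D $ p $ r else 0)" by (rule Gc_conj[OF 1]) simp
  show "Gc D Rinv R a r p b = (if a = b then D $ p $ r else 0)" by (rule Gc_conj[OF 2]) simp
qed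

text \<open>Contracting \<open>Gc_R_Rinv\<close> with the skew inverse removes the factor
  \<open>R\<close>. Together with \<open>D_Rinv\<close> this lets \<open>Psi\<close> mediate between
  the two orders of \<open>Rinv\<close> and \<open>D\<close>.\<close>

lemma Rinv_D: "(\<Sum>c\<in>UNIV. Rinv $ (s, p) $ (b, c) * D $ c $ r) = (\<Sum>e\<in>UNIV. D $ s $ e * Psi $ (p, e) $ (r, b))"
proof -
  have "(\<Sum>e\<in>UNIV. \<Sum>a\<in>UNIV. Psi $ (p, e) $ (r, a) * Gc D R Rinv a e s b)
      = (\<Sum>c\<in>UNIV. \<Sum>d\<in>UNIV. \<Sum>f\<in>UNIV. D $ c $ d * Rinv $ (s, f) $ (b, c) *
          (\<Sum>e\<in>UNIV. \<Sum>a\<in>UNIV. Psi $ (p, e) $ (r, a) * R $ (a, d) $ (e, f)))"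
    unfolding Gc_def sum_distrib_left by (subst sum_swap_23) (simp only: mult_ac)
  also have "\<dots> = (\<Sum>c\<in>UNIV. \<Sum>d\<in>UNIV. \<Sum>f\<in>UNIV. if d = r \<and> f = p then D $ c $ d * Rinv $ (s, f) $ (b, c) else 0)"
    unfolding sk(2) by (intro sum.cong refl) auto
  also have "\<dots> = (\<Sum>c\<in>UNIV. Rinv $ (s, p) $ (b, c) * D $ c $ r)" by (simp only: delta2 mult.commute)
  finally have "(\<Sum>c\<in>UNIV. Rinv $ (s, p) $ (b, c) * D $ c $ r)
      = (\<Sum>e\<in>UNIV. \<Sum>a\<in>UNIV. Psi $ (p, e) $ (r, a) * (if a = b then D $ s $ e else 0))"
    unfolding Gc_R_Rinv by simp
  also have "\<dots> = (\<Sum>e\<in>UNIV. D $ s $ e * Psi $ (p, e) $ (r, b))"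
  proof (intro sum.cong refl)
    fix e
    have "Psi $ (p, e) $ (r, a) * (if a = b then D $ s $ e else 0)
        = (if a = b then D $ s $ e * Psi $ (p, e) $ (r, a) else 0)" for a by simp
    then show "(\<Sum>a\<in>UNIV. Psi $ (p, e) $ (r, a) * (if a = b then D $ s $ e else 0)) = D $ s $ e * Psi $ (p, e) $ (r, b)"
      by (simp only: sum_delta_UNIV)
  qed
  finally show ?thesis .
qed

lemma D_Rinv: "(\<Sum>d\<in>UNIV. D $ p $ d * Rinv $ (a, d) $ (e, r)) = (\<Sum>x\<in>UNIV. Psi $ (p, a) $ (r, x) * D $ x $ e)"
proof -
  have "(\<Sum>b\<in>UNIV. \<Sum>x\<in>UNIV. Psi $ (p, b) $ (r, x) * Gc D Rinv R a e x b)
      = (\<Sum>c\<in>UNIV. \<Sum>d\<in>UNIV. \<Sum>f\<in>UNIV. D $ c $ d * Rinv $ (a, d) $ (e, f) *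
          (\<Sum>b\<in>UNIV. \<Sum>x\<in>UNIV. Psi $ (p, b) $ (r, x) * R $ (x, f) $ (b, c)))"
    unfolding Gc_def sum_distrib_left by (subst sum_swap_23) (simp only: mult_ac)
  also have "\<dots> = (\<Sum>c\<in>UNIV. \<Sum>d\<in>UNIV. \<Sum>f\<in>UNIV. if c = p \<and> f = r then D $ c $ d * Rinv $ (a, d) $ (e, f) else 0)"
    unfolding sk(2) by (intro sum.cong refl) auto
  also have "\<dots> = (\<Sum>d\<in>UNIV. \<Sum>c\<in>UNIV. \<Sum>f\<in>UNIV. if c = p \<and> f = r then D $ c $ d * Rinv $ (a, d) $ (e, f) else 0)"
    by (rule sum.swap)
  also have "\<dots> = (\<Sum>d\<in>UNIV. D $ p $ d * Rinv $ (a, d) $ (e, r))" by (simp only: delta2)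
  finally have "(\<Sum>d\<in>UNIV. D $ p $ d * Rinv $ (a, d) $ (e, r))
      = (\<Sum>b\<in>UNIV. \<Sum>x\<in>UNIV. Psi $ (p, b) $ (r, x) * (if a = b then D $ x $ e else 0))"
    unfolding Gc_Rinv_R by simp
  also have "\<dots> = (\<Sum>x\<in>UNIV. \<Sum>b\<in>UNIV. Psi $ (p, b) $ (r, x) * (if a = b then D $ x $ e else 0))"
    by (rule sum.swap)
  also have "\<dots> = (\<Sum>x\<in>UNIV. Psi $ (p, a) $ (r, x) * D $ x $ e)"
  proof (intro sum.cong refl)
    fix x
    have "Psi $ (p, b) $ (r, x) * (if a = b then D $ x $ e else 0)
        = (if a = b then Psi $ (p, b) $ (r, x) * D $ x $ e else 0)" for b by simp
    then show "(\<Sum>b\<in>UNIV. Psi $ (p, b) $ (r, x) * (if a = b then D $ x $ e else 0)) = Psi $ (p, a) $ (r, x) * D $ x $ e"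
      by (simp only: sum_delta_UNIV)
  qed
  finally show ?thesis .
qed

text \<open>One tensor factor of \<open>kron D\<close> is passed by \<open>D_Rinv\<close>, the other
  by \<open>Rinv_D\<close>, and both lead to the same expression in \<open>Psi\<close>. This
  commutation is what makes the R-trace over two strands cyclic for \<open>R\<close>.\<close>

lemma kron_Rinv: "kron D ** Rinv = Rinv ** kron D"
proof -
  have "(kron D ** Rinv) $ (a, p) $ (e, r) = (Rinv ** kron D) $ (a, p) $ (e, r)" for a p e r
  proof -
    have "(kron D ** Rinv) $ (a, p) $ (e, r) = (\<Sum>x\<in>UNIV. D $ a $ x * (\<Sum>d\<in>UNIV. D $ p $ d * Rinv $ (x, d) $ (e, r)))"
      by (simp add: matrix_matrix_mult_def sum_UNIV_pair kron_def sum_distrib_left mult.assoc)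
    also have "\<dots> = (\<Sum>x\<in>UNIV. \<Sum>y\<in>UNIV. D $ a $ x * (Psi $ (p, x) $ (r, y) * D $ y $ e))"
      unfolding D_Rinv sum_distrib_left ..
    also have "\<dots> = (\<Sum>y\<in>UNIV. D $ y $ e * (\<Sum>x\<in>UNIV. D $ a $ x * Psi $ (p, x) $ (r, y)))"
      by (subst sum.swap) (simp add: sum_distrib_left mult_ac)
    also have "\<dots> = (\<Sum>y\<in>UNIV. D $ y $ e * (\<Sum>c\<in>UNIV. Rinv $ (a, p) $ (y, c) * D $ c $ r))"
      unfolding Rinv_D ..
    also have "\<dots> = (Rinv ** kron D) $ (a, p) $ (e, r)"
      by (simp add: matrix_matrix_mult_def sum_UNIV_pair kron_def sum_distrib_left mult_ac)
    finally show ?thesis .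
  qed
  then show ?thesis by (simp add: vec_eq_iff)
qed

lemma Rtr_cyc:
  "Rtr D i (Rtr D (Suc i) (m2 R i * x)) = Rtr D i (Rtr D (Suc i) (x * m2 R i :: (nat \<Rightarrow> 'n, 'a::calgebra) rfm))"
proof -
  interpret bmw_algebra q \<mu> "m2 R" "m2 Rinv" "m2 Km :: nat \<Rightarrow> (nat \<Rightarrow> 'n, 'a) rfm" by (rule bmw_alg)
  let ?DD = "m2 (kron D) i :: (nat \<Rightarrow> 'n, 'a) rfm"
  have TT: "Rtr D i (Rtr D (Suc i) y) = Tp i (Tp (Suc i) (?DD * y))" for y :: "(nat \<Rightarrow> 'n, 'a) rfm"
    unfolding Rtr_def m1_m1[symmetric] mult.assoc by (subst Tp_left) (simp_all add: m1_Eset)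
  have "?DD * m2 Rinv i = m2 Rinv i * ?DD" by (simp only: m2_mult kron_Rinv)
  then have "m2 R i * (?DD * m2 Rinv i) * m2 R i = m2 R i * (m2 Rinv i * ?DD) * m2 R i" by simp
  then have c: "m2 R i * ?DD = ?DD * m2 R i" by (simp add: mult.assoc)
  have "Tp i (Tp (Suc i) (?DD * (m2 R i * x))) = Tp i (Tp (Suc i) (m2 R i * (?DD * x)))"
    by (simp only: c flip: mult.assoc)
  also have "\<dots> = Tp i (Tp (Suc i) ((?DD * x) * m2 R i))" unfolding m2_def[of R i] by (rule Tp_cyc)
  finally show ?thesis unfolding TT by (simp only: mult.assoc)
qed

section \<open>Nondegeneracy and rank of the contractor \<open>K\<close>\<close>

lemma Km_nonzero: "Km \<noteq> 0"
proof
  assume K0: "Km = 0"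
  define p where "p = [:q, -1:] * [:inverse q, 1:]"
  have q: "q \<noteq> 0" "q * q \<noteq> 1" and mu: "\<mu> \<noteq> 0"
    using bmw_algebra.q0[OF bmw_alg[where 'a = complex]] bmw_algebra.q_sq[OF bmw_alg[where 'a = complex]]
      bmw_algebra.mu0[OF bmw_alg[where 'a = complex]] by auto
  define l where "l = q - inverse q"
  have l0: "l \<noteq> 0" using q by (simp add: l_def field_simps)
  have p: "p = [:1, l, -1:]" using q by (simp add: p_def l_def)
  let ?r = "m2 R 0 :: (nat \<Rightarrow> 'n, complex) rfm"
  have "(inverse \<mu> * inverse l) *\<^sub>C ((q *\<^sub>C 1 - ?r) * (inverse q *\<^sub>C 1 + ?r)) = m2 Km 0"
    by (simp add: K_mat_def m2_mat m2_diff m2_add l_def flip: m2_mult)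
  then have "(q *\<^sub>C 1 - ?r) * (inverse q *\<^sub>C 1 + ?r) = 0"
    using cs_cancel[of "inverse \<mu> * inverse l" _ 0] mu l0 by (simp add: K0 m2_zero)
  moreover have "m2 (poly_mat p R) 0 = (q *\<^sub>C 1 - ?r) * (inverse q *\<^sub>C 1 + ?r)"
  proof -
    have "m2 (poly_mat p R) 0 = (\<Sum>j\<le>2. coeff p j *\<^sub>C ?r ^ j)"
      unfolding m2_poly_mat by (rule pe_aux) (simp add: p)
    also have "\<dots> = 1 + l *\<^sub>C ?r - ?r * ?r"
      by (simp add: p numeral_2_eq_2 sum.atMost_Suc)
    also have "\<dots> = (q *\<^sub>C 1 - ?r) * (inverse q *\<^sub>C 1 + ?r)"
      using q by (simp add: l_def algebra_simps cs_add_left cs_add_right cs.scale_left_diff_distrib cs.scale_right_diff_distrib)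
    finally show ?thesis .
  qed
  \<comment> \<open>If \<open>K\<close> vanished, a quadratic polynomial would annihilate
    \<open>R\<close>, against the minimality of the cubic one.\<close>
  ultimately have "poly_mat p R = 0" using m2_inj[of "poly_mat p R" 0 0, where 'a = complex] by (simp add: m2_zero)
  moreover have "p \<noteq> 0" "degree p = 2" by (simp_all add: p)
  moreover have "degree ([:q, -1:] * [:inverse q, 1:] * [:\<mu>, -1:]) = 3"
    unfolding p_def[symmetric] p by simp
  ultimately show False using bmw by (auto simp: BMW_type_def is_minimal_poly_def)
qed

lemma Km_entry: obtains a b c d where "Km $ (a, b) $ (c, d) \<noteq> 0"
  using Km_nonzero by (auto simp: vec_eq_iff)

text \<open>The relation is moved one strand to the right. Inserting
  \<open>K 0 = K 0 * K 1 * K 0\<close> shows that \<open>K 0\<close> times \<open>Z\<close> on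
  strand 2 vanishes as well. These operators act on disjoint strands, so one nonzero entry of
  \<open>K\<close> forces every entry of \<open>Z\<close> to be zero.\<close>

lemma nondegenerate_right:
  assumes "m2 Km 0 * m1 Z 1 = (0 :: (nat \<Rightarrow> 'n, complex) rfm)"
  shows "Z = 0"
proof -
  interpret bmw_algebra q \<mu> "m2 R" "m2 Rinv" "m2 Km :: nat \<Rightarrow> (nat \<Rightarrow> 'n, complex) rfm" by (rule bmw_alg)
  have e: "m2 Km i * m1 Z (Suc i) = (sl i 2 (op_mult 2 (at2 Km 1 2) (at1 Z 2)) :: (nat \<Rightarrow> 'n, complex) rfm)" for i
    unfolding m1_split(2) m2_def sl_mult ..
  have z: "(sl i 2 op_zero :: (nat \<Rightarrow> 'n, complex) rfm) = 0" for i
    unfolding sl_def using lemb_zero by (simp add: scal_def[abs_def] op_zero_def[abs_def])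
  have "(sl 0 2 (op_mult 2 (at2 Km 1 2) (at1 Z 2)) :: (nat \<Rightarrow> 'n, complex) rfm) = sl 0 2 op_zero"
    unfolding e[symmetric] z using assms by simp
  then have o: "op_eq 2 (op_mult 2 (at2 Km 1 2) (at1 Z 2)) op_zero" by (rule sl_inj)
  have 1: "m2 Km 1 * m1 Z (Suc 1) = (0 :: (nat \<Rightarrow> 'n, complex) rfm)"
    unfolding e z[of 1, symmetric] by (rule sl_cong[OF o])
  have c: "m2 Km 0 * m1 Z 2 = m1 Z 2 * (m2 Km 0 :: (nat \<Rightarrow> 'n, complex) rfm)"
    by (rule Eset_m1) (simp add: m2_Eset)
  have "m2 Km 0 * m1 Z 2 = m2 Km 0 * (m2 Km 1 * (m2 Km 0 * (m1 Z 2 :: (nat \<Rightarrow> 'n, complex) rfm)))"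
    using KKK_Suc[of 0] by (simp flip: mult.assoc)
  also have "\<dots> = m2 Km 0 * ((m2 Km 1 * m1 Z (Suc 1)) * m2 Km 0)"
    unfolding c by (simp only: mult.assoc Suc_1)
  finally have 2: "m2 Km 0 * m1 Z 2 = (0 :: (nat \<Rightarrow> 'n, complex) rfm)" unfolding 1 by simp
  obtain a b c d where k: "Km $ (a, b) $ (c, d) \<noteq> 0" by (rule Km_entry)
  have "Z $ e $ f = 0" for e f
  proof -
    define u where "u j = (if j = 0 then a else if j = 1 then b else e)" for j :: nat
    define v where "v j = (if j = 0 then c else if j = 1 then d else if j = 2 then f else e)" for j :: nat
    have kz: "ent (m1 Z 2 :: (nat \<Rightarrow> 'n, complex) rfm) (u(0 := e', 1 := f')) v
        = (if e' = c \<and> f' = d then Z $ e $ f else 0)" for e' f'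
    proof -
      have "agree 2 1 (u(0 := e', 1 := f')) v \<longleftrightarrow> e' = c \<and> f' = d"
      proof
        assume "agree 2 1 (u(0 := e', 1 := f')) v"
        then have "(u(0 := e', 1 := f')) 0 = v 0" "(u(0 := e', 1 := f')) 1 = v 1"
          unfolding agree_def by (metis zero_less_numeral one_less_numeral_iff semiring_norm(76))+
        then show "e' = c \<and> f' = d" by (simp add: v_def)
      qed (auto simp: agree_def u_def v_def)
      moreover have "win 2 1 (u(0 := x, 1 := y)) = [e]" "win 2 1 v = [f]" for x y
        by (simp_all add: win_def u_def v_def)
      ultimately show ?thesis unfolding m1_def sl_def ent_lemb by (simp add: scal_def cs_complex_def)
    qed
    have "ent (m2 Km 0 * m1 Z 2 :: (nat \<Rightarrow> 'n, complex) rfm) u v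
        = (\<Sum>e'\<in>UNIV. \<Sum>f'\<in>UNIV. Km $ (a, b) $ (e', f') * ent (m1 Z 2 :: (nat \<Rightarrow> 'n, complex) rfm) (u(0 := e', 1 := f')) v)"
      unfolding ent_m2_times by (simp add: u_def cs_complex_def)
    also have "\<dots> = (\<Sum>e'\<in>UNIV. \<Sum>f'\<in>UNIV. if e' = c \<and> f' = d then Km $ (a, b) $ (e', f') * Z $ e $ f else 0)"
      unfolding kz by (intro sum.cong refl) auto
    finally show ?thesis unfolding 2 delta2 using k by (simp add: ent_zero)
  qed
  then show ?thesis by (simp add: vec_eq_iff)
qed

text \<open>Mirror image of \<open>nondegenerate_right\<close>: \<open>Z\<close> stays on strand 0
  and \<open>K 1 = K 1 * K 0 * K 1\<close> separates it from the contractor.\<close>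

lemma nondegenerate_left:
  assumes 1: "m1 Z 0 * m2 Km 0 = (0 :: (nat \<Rightarrow> 'n, complex) rfm)"
  shows "Z = 0"
proof -
  interpret bmw_algebra q \<mu> "m2 R" "m2 Rinv" "m2 Km :: nat \<Rightarrow> (nat \<Rightarrow> 'n, complex) rfm" by (rule bmw_alg)
  have c: "m1 Z 0 * m2 Km 1 = m2 Km 1 * (m1 Z 0 :: (nat \<Rightarrow> 'n, complex) rfm)"
    unfolding m1_def m2_def using sl_disjoint[of 0 1 1 2 "scal (at1 Z 1)" "at2 Km 1 2"] by (simp add: sl_def)
  have "m1 Z 0 * m2 Km 1 = m1 Z 0 * (m2 Km 1 * (m2 Km 0 * (m2 Km 1 :: (nat \<Rightarrow> 'n, complex) rfm)))"
    using KKK[of 1 0] by (simp add: adj_def)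
  also have "\<dots> = m2 Km 1 * ((m1 Z 0 * m2 Km 0) * m2 Km 1)" using comm_left[OF c] by (simp add: mult.assoc)
  finally have 2: "m1 Z 0 * m2 Km 1 = (0 :: (nat \<Rightarrow> 'n, complex) rfm)" unfolding 1 by simp
  obtain a b c d where k: "Km $ (a, b) $ (c, d) \<noteq> 0" by (rule Km_entry)
  have "Z $ e $ f = 0" for e f
  proof -
    define u where "u j = (if j = 0 then e else if j = 1 then a else b)" for j :: nat
    define v where "v j = (if j = 0 then f else if j = 1 then c else if j = 2 then d else b)" for j :: nat
    have kz: "ent (m2 Km 1 :: (nat \<Rightarrow> 'n, complex) rfm) (u(0 := e')) v
        = (if e' = f then Km $ (a, b) $ (c, d) else 0)" for e'
    proof -
      have "agree 1 2 (u(0 := e')) v \<longleftrightarrow> e' = f"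
        by (auto simp: agree_def u_def v_def split: if_splits)
      moreover have "win 1 2 (u(0 := x)) = [a, b]" "win 1 2 v = [c, d]" for x
        by (simp_all add: win_def u_def v_def numeral_2_eq_2)
      ultimately show ?thesis unfolding m2_def sl_def ent_lemb by (simp add: scal_def cs_complex_def)
    qed
    have "ent (m1 Z 0 * m2 Km 1 :: (nat \<Rightarrow> 'n, complex) rfm) u v
        = (\<Sum>e'\<in>UNIV. Z $ e $ e' * ent (m2 Km 1 :: (nat \<Rightarrow> 'n, complex) rfm) (u(0 := e')) v)"
      unfolding ent_m1_times by (simp add: u_def cs_complex_def)
    also have "\<dots> = (\<Sum>e'\<in>UNIV. if e' = f then Z $ e $ e' * Km $ (a, b) $ (c, d) else 0)"
      unfolding kz by (intro sum.cong refl) auto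
    finally show ?thesis unfolding 2 using k by (simp add: ent_zero)
  qed
  then show ?thesis by (simp add: vec_eq_iff)
qed

text \<open>The trace is a matrix \<open>Y\<close> on one strand. Multiplied by \<open>K 0\<close>
  it is computed from \<open>K 0 * K 1 = K 0 * R 1 * R 0\<close> and \<open>Rtr_R\<close>, and
  nondegeneracy removes the factor \<open>K 0\<close> again.\<close>

lemma Rtr_K: "Rtr D (Suc i) (m2 Km i) = (\<mu> *\<^sub>C 1 :: (nat \<Rightarrow> 'n, 'a::calgebra) rfm)"
proof -
  interpret bmw_algebra q \<mu> "m2 R" "m2 Rinv" "m2 Km :: nat \<Rightarrow> (nat \<Rightarrow> 'n, complex) rfm" by (rule bmw_alg)
  define Y where "Y = (\<chi> a b. \<Sum>c\<in>UNIV. \<Sum>d\<in>UNIV. D $ c $ d * Km $ (a, d) $ (b, c))"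
  let ?K = "m2 Km :: nat \<Rightarrow> (nat \<Rightarrow> 'n, complex) rfm"
  let ?R = "m2 R :: nat \<Rightarrow> (nat \<Rightarrow> 'n, complex) rfm"
  have E: "?K 0 \<in> Eset 2" "?R 0 \<in> Eset 2" by (simp_all add: m2_Eset)
  have "?K 0 * m1 Y 1 = ?K 0 * Rtr D 2 (?K 1)"
    using Rtr_m2[of D 1 Km, where 'a = complex] by (simp add: Y_def numeral_2_eq_2)
  also have "\<dots> = Rtr D 2 (?K 0 * ?K 1)" by (simp only: Rtr_left[OF E(1)])
  also have "?K 0 * ?K 1 = ?K 0 * (?R 1 * ?R 0)" by (rule KK_KRR) (simp add: adj_def)
  also have "Rtr D 2 \<dots> = ?K 0 * (Rtr D 2 (?R 1) * ?R 0)"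
    by (simp only: Rtr_left[OF E(1)] Rtr_right[OF E(2)])
  also have "\<dots> = \<mu> *\<^sub>C ?K 0" using Rtr_R[OF skew, of 1, where 'a = complex] K_R[of 0] by (simp add: numeral_2_eq_2)
  finally have "?K 0 * m1 (Y - mat \<mu>) 1 = 0" by (simp add: m1_diff m1_mat right_diff_distrib)
  then have "Y = mat \<mu>" using nondegenerate_right by fastforce
  then show ?thesis by (simp add: Rtr_m2 Y_def m1_mat)
qed

text \<open>The trace \<open>t\<close> of \<open>D\<close> is found by closing strand 2 in
  \<open>K 0 = \<mu> K 0 * R 1 * K 0\<close>, which gives \<open>\<mu>\<close> times the square of
  \<open>K 0\<close>, a multiple of \<open>K 0\<close>.\<close>

lemma Rtr_one: "Rtr D i 1 = ((\<mu> * BMW_eta q \<mu>) *\<^sub>C 1 :: (nat \<Rightarrow> 'n, 'a::calgebra) rfm)"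
proof -
  interpret bmw_algebra q \<mu> "m2 R" "m2 Rinv" "m2 Km :: nat \<Rightarrow> (nat \<Rightarrow> 'n, complex) rfm" by (rule bmw_alg)
  define t where "t = (\<Sum>c\<in>UNIV. D $ c $ c)"
  have tr: "Rtr D i 1 = (t *\<^sub>C 1 :: (nat \<Rightarrow> 'n, 'b::calgebra) rfm)" for i
  proof (rule rfm_eqI)
    fix u v :: "nat \<Rightarrow> 'n"
    have e: "ent (m1 D i :: (nat \<Rightarrow> 'n, 'b) rfm) (u(i := c)) (v(i := c)) = (if u = v then D $ c $ c *\<^sub>C 1 else 0)"
      if "u i = v i" for c
    proof -
      have "agree i 1 (u(i := c)) (v(i := c)) \<longleftrightarrow> u = v"
        using that by (auto simp: agree_def fun_eq_iff) (metis Suc_leI linorder_neqE_nat)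
      then show ?thesis by (simp add: m1_def sl_def ent_lemb win_def scal_def)
    qed
    have "ent (Rtr D i (1 :: (nat \<Rightarrow> 'n, 'b) rfm)) u v = (if u = v then t *\<^sub>C 1 else 0)"
      unfolding Rtr_def ent_Tp using e by (cases "u = v") (auto simp: t_def cs.scale_sum_left)
    then show "ent (Rtr D i 1) u v = ent (t *\<^sub>C 1 :: (nat \<Rightarrow> 'n, 'b) rfm) u v"
      by (simp add: ent_cs ent_one)
  qed
  let ?K = "m2 Km :: nat \<Rightarrow> (nat \<Rightarrow> 'n, complex) rfm"
  let ?R = "m2 R :: nat \<Rightarrow> (nat \<Rightarrow> 'n, complex) rfm"
  have E: "?K 0 \<in> Eset 2" by (simp add: m2_Eset)
  have "?K 1 * ?K 0 = ?R 0 * (?R 1 * ?K 0)" by (rule KK_RRK) (simp add: adj_def)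
  then have "?K 0 = ?K 0 * (?R 0 * (?R 1 * ?K 0))" using KKK_Suc[of 0] by (simp add: mult.assoc)
  also have "\<dots> = \<mu> *\<^sub>C (?K 0 * (?R 1 * ?K 0))" using K_R[of 0] by (simp flip: mult.assoc)
  finally have k: "?K 0 = \<mu> *\<^sub>C (?K 0 * (?R 1 * ?K 0))" .
  have "t *\<^sub>C ?K 0 = Rtr D 2 (?K 0 * 1)" unfolding Rtr_left[OF E] tr by simp
  also have "\<dots> = Rtr D 2 (\<mu> *\<^sub>C (?K 0 * (?R 1 * ?K 0)))" using k by simp
  also have "\<dots> = \<mu> *\<^sub>C (?K 0 * (Rtr D 2 (?R 1) * ?K 0))"
    by (simp only: Rtr_cs Rtr_left[OF E] Rtr_right[OF E])
  also have "\<dots> = (\<mu> * BMW_eta q \<mu>) *\<^sub>C ?K 0"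
    using Rtr_R[OF skew, of 1, where 'a = complex] BMW_bmw_algebra(3)[OF bmw, of 0, where 'a = complex] by (simp add: numeral_2_eq_2)
  finally have "(t - \<mu> * BMW_eta q \<mu>) *\<^sub>C ?K 0 = 0" by (simp add: cs.scale_left_diff_distrib)
  moreover have "?K 0 \<noteq> 0" using m2_inj[of Km 0 0] Km_nonzero by (auto simp: m2_zero)
  ultimately have "t = \<mu> * BMW_eta q \<mu>" using cs_cancel[of "t - \<mu> * BMW_eta q \<mu>" "?K 0" 0] by auto
  then show ?thesis by (simp add: tr)
qed

text \<open>Contracting the relation \<open>K 0 = \<mu> (K 0) (R 1) (K 0)\<close> with the skew inverse.\<close>

lemma K_contraction:
  "Km $ (a, b) $ (d, e) * C_mat R $ p $ r = \<mu> * (\<Sum>x\<in>UNIV. Km $ (a, b) $ (x, r) * Km $ (x, p) $ (d, e))"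
proof -
  interpret bmw_algebra q \<mu> "m2 R" "m2 Rinv" "m2 Km :: nat \<Rightarrow> (nat \<Rightarrow> 'n, complex) rfm" by (rule bmw_alg)
  let ?K = "m2 Km :: nat \<Rightarrow> (nat \<Rightarrow> 'n, complex) rfm"
  let ?R = "m2 R :: nat \<Rightarrow> (nat \<Rightarrow> 'n, complex) rfm"
  have "?K 1 * ?K 0 = ?R 0 * (?R 1 * ?K 0)" by (rule KK_RRK) (simp add: adj_def)
  then have "?K 0 = ?K 0 * (?R 0 * (?R 1 * ?K 0))" using KKK_Suc[of 0] by (simp add: mult.assoc)
  also have "\<dots> = \<mu> *\<^sub>C (?K 0 * (?R 1 * ?K 0))" using K_R[of 0] by (simp flip: mult.assoc)
  finally have k: "?K 0 = \<mu> *\<^sub>C (?K 0 * (?R 1 * ?K 0))" .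
  have rel: "(if c = f then Km $ (a, b) $ (d, e) else 0)
      = \<mu> * (\<Sum>x\<in>UNIV. \<Sum>y\<in>UNIV. \<Sum>z\<in>UNIV. Km $ (a, b) $ (x, y) * R $ (y, c) $ (z, f) * Km $ (x, z) $ (d, e))"
    for c f
  proof -
    define u where "u j = (if j = 0 then a else if j = 1 then b else c)" for j :: nat
    define v where "v j = (if j = 0 then d else if j = 1 then e else if j = 2 then f else c)" for j :: nat
    have kv: "ent (?K 0) w v = (if w 2 = f \<and> (\<forall>j>2. w j = c) then Km $ (w 0, w 1) $ (d, e) else 0)" for w
    proof -
      have a: "agree 0 2 w v \<longleftrightarrow> w 2 = f \<and> (\<forall>j>2. w j = c)"
        by (auto simp: agree_def v_def le_less numeral_2_eq_2 split: if_splits)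
      show ?thesis
        unfolding m2_def sl_def ent_lemb a win2
        by (rule if_cong) (simp_all add: scal_def cs_complex_def v_def)
    qed
    have kv': "ent (?K 0) (u(0 := x, Suc 0 := y, 1 := z, Suc 1 := w)) v
        = (if w = f then Km $ (x, z) $ (d, e) else 0)" for x y z w
      unfolding kv by (rule if_cong) (auto simp: u_def numeral_2_eq_2)
    have "ent (?K 0) u v = \<mu> * ent (?K 0 * (?R 1 * ?K 0)) u v" by (subst k) (simp add: ent_cs cs_complex_def)
    moreover have "ent (?K 0) u v = (if c = f then Km $ (a, b) $ (d, e) else 0)"
      unfolding kv by (simp add: u_def)
    moreover have "ent (?K 0 * (?R 1 * ?K 0)) u v = (\<Sum>x\<in>UNIV. \<Sum>y\<in>UNIV. \<Sum>z\<in>UNIV. \<Sum>w\<in>UNIV.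
        Km $ (a, b) $ (x, y) * (R $ (y, c) $ (z, w) * (if w = f then Km $ (x, z) $ (d, e) else 0)))"
      unfolding ent_m2_times kv'
      by (simp add: u_def cs_complex_def sum_distrib_left)
    moreover have "(\<Sum>w\<in>UNIV. Km $ (a, b) $ (x, y) * (R $ (y, c) $ (z, w) * (if w = f then Km $ (x, z) $ (d, e) else 0)))
        = Km $ (a, b) $ (x, y) * R $ (y, c) $ (z, f) * Km $ (x, z) $ (d, e)" for x y z
    proof -
      have "Km $ (a, b) $ (x, y) * (R $ (y, c) $ (z, w) * (if w = f then Km $ (x, z) $ (d, e) else 0))
        = (if w = f then Km $ (a, b) $ (x, y) * R $ (y, c) $ (z, w) * Km $ (x, z) $ (d, e) else 0)" for w by simp
      then show ?thesis by (simp only: sum_delta_UNIV)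
    qed
    ultimately show ?thesis by simp
  qed
  have "Km $ (a, b) $ (d, e) * C_mat R $ p $ r
      = (\<Sum>c\<in>UNIV. \<Sum>f\<in>UNIV. Psi $ (f, p) $ (c, r) * (if c = f then Km $ (a, b) $ (d, e) else 0))"
  proof -
    have "Psi $ (f, p) $ (c, r) * (if c = f then Km $ (a, b) $ (d, e) else 0)
        = (if c = f then Psi $ (f, p) $ (c, r) * Km $ (a, b) $ (d, e) else 0)" for c f by simp
    then show ?thesis by (simp only: sum_delta_UNIV) (simp add: C_mat_entry sum_distrib_left mult.commute)
  qed
  also have "\<dots> = (\<Sum>c\<in>UNIV. \<Sum>f\<in>UNIV. \<Sum>x\<in>UNIV. \<Sum>y\<in>UNIV. \<Sum>z\<in>UNIV.
      \<mu> * (Km $ (a, b) $ (x, y) * Km $ (x, z) $ (d, e) * (R $ (y, c) $ (z, f) * Psi $ (f, p) $ (c, r))))"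
    unfolding rel sum_distrib_left by (simp only: mult_ac)
  also have "\<dots> = \<mu> * (\<Sum>x\<in>UNIV. \<Sum>y\<in>UNIV. \<Sum>z\<in>UNIV. Km $ (a, b) $ (x, y) * Km $ (x, z) $ (d, e) *
      (\<Sum>c\<in>UNIV. \<Sum>f\<in>UNIV. R $ (y, c) $ (z, f) * Psi $ (f, p) $ (c, r)))"
    by (subst sum_swap_23) (simp only: sum_distrib_left)
  also have "\<dots> = \<mu> * (\<Sum>x\<in>UNIV. \<Sum>y\<in>UNIV. \<Sum>z\<in>UNIV. if y = r \<and> z = p then Km $ (a, b) $ (x, y) * Km $ (x, z) $ (d, e) else 0)"
    unfolding sk(1) by (intro arg_cong[of _ _ "(*) \<mu>"] sum.cong refl) auto
  finally show ?thesis by (simp only: delta2)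
qed

text \<open>For a vector killed by \<open>C_mat R\<close> the contraction identity makes a product
  of two copies of \<open>K\<close> vanish. Nondegeneracy on the left removes one copy and
  nondegeneracy on the right the other, so the vector is zero.\<close>

lemma C_invertible: "invertible (C_mat R)"
proof -
  have "v = 0" if v: "C_mat R *v v = 0" for v :: "complex^'n"
  proof -
    have mu: "\<mu> \<noteq> 0" using bmw_algebra.mu0[OF bmw_alg[where 'a = complex]] .
    define l where "l a b x = (\<Sum>r\<in>UNIV. Km $ (a, b) $ (x, r) * v $ r)" for a b x
    have l: "(\<Sum>x\<in>UNIV. l a b x * Km $ (x, p) $ (d, e)) = 0" for a b p d e
    proof -
      have "\<mu> * (\<Sum>x\<in>UNIV. l a b x * Km $ (x, p) $ (d, e))
          = (\<Sum>r\<in>UNIV. (\<mu> * (\<Sum>x\<in>UNIV. Km $ (a, b) $ (x, r) * Km $ (x, p) $ (d, e))) * v $ r)"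
        unfolding l_def sum_distrib_left sum_distrib_right by (subst sum.swap) (simp only: mult_ac)
      also have "\<dots> = Km $ (a, b) $ (d, e) * (C_mat R *v v) $ p"
        unfolding K_contraction[symmetric] by (simp add: matrix_vector_mult_def sum_distrib_left mult.assoc)
      finally show ?thesis using v mu by simp
    qed
    have l0: "l a b x = 0" for a b x
    proof -
      \<comment> \<open>The covector is repeated in every row, which turns the vanishing contraction
        into a matrix relation of the form required for nondegeneracy. The vector \<open>v\<close>
        is repeated in every column below for the same purpose.\<close>
      define Z :: "complex^'n^'n" where "Z = (\<chi> y x. l a b x)"
      have "m1 Z 0 * m2 Km 0 = (sl 0 2 (op_mult 2 (at1 Z 1) (at2 Km 1 2)) :: (nat \<Rightarrow> 'n, complex) rfm)"
        unfolding m1_split m2_def sl_mult ..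
      also have "\<dots> = sl 0 2 op_zero"
      proof (rule sl_cong, rule op_eq_2I)
        fix y p d e
        have "at1 Z (Suc 0) [y, p] [x, s] * at2 Km (Suc 0) 2 [x, s] [d, e]
            = (if s = p then l a b x * Km $ (x, s) $ (d, e) else 0)" for x s
          by (simp add: at1_2_entries Z_def)
        then show "op_mult 2 (at1 Z 1) (at2 Km 1 2) [y, p] [d, e] = op_zero [y, p] [d, e]"
          using l by (simp add: op_mult_def sum_words2 op_zero_def)
      qed
      also have "\<dots> = 0"
        unfolding sl_def using lemb_zero by (simp add: scal_def[abs_def] op_zero_def[abs_def])
      finally have "Z = 0" by (rule nondegenerate_left)
      then have "Z $ x $ x = 0" by simp
      then show ?thesis by (simp add: Z_def)
    qed
    define Z :: "complex^'n^'n" where "Z = (\<chi> r y. v $ r)"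
    have "m2 Km 0 * m1 Z 1 = (sl 0 2 (op_mult 2 (at2 Km 1 2) (at1 Z 2)) :: (nat \<Rightarrow> 'n, complex) rfm)"
    proof -
      have "(m1 Z 1 :: (nat \<Rightarrow> 'n, complex) rfm) = sl 0 2 (at1 Z 2)" using m1_split(2)[of Z 0] by simp
      then show ?thesis by (simp only: m2_def sl_mult)
    qed
    also have "\<dots> = sl 0 2 op_zero"
    proof (rule sl_cong, rule op_eq_2I)
      fix a b x y
      have "at2 Km (Suc 0) 2 [a, b] [s, r] * at1 Z 2 [s, r] [x, y]
          = (if s = x then Km $ (a, b) $ (s, r) * v $ r else 0)" for s r
        by (simp add: at1_2_entries Z_def)
      moreover have "(\<Sum>s\<in>UNIV. \<Sum>r\<in>UNIV. if s = x then Km $ (a, b) $ (s, r) * v $ r else 0) = l a b x"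
        unfolding l_def by (subst sum.swap) simp
      ultimately show "op_mult 2 (at2 Km 1 2) (at1 Z 2) [a, b] [x, y] = op_zero [a, b] [x, y]"
        using l0 by (simp add: op_mult_def sum_words2 op_zero_def)
    qed
    also have "\<dots> = 0"
      unfolding sl_def using lemb_zero by (simp add: scal_def[abs_def] op_zero_def[abs_def])
    finally have "Z = 0" by (rule nondegenerate_right)
    then have "Z $ r $ r = 0" for r by simp
    then show ?thesis by (simp add: Z_def vec_eq_iff)
  qed
  then show ?thesis
    unfolding invertible_left_inverse matrix_left_invertible_ker by blast
qed

lemma mat_times:
  "(mat c ** A) $ i $ j = c * (A :: complex^'m::finite^'m) $ i $ j" "(A ** mat c) $ i $ j = A $ i $ j * c"
proof -
  have "(if i = k then c else 0) * A $ k $ j = (if i = k then c * A $ k $ j else 0)"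
    "A $ i $ k * (if k = j then c else 0) = (if k = j then A $ i $ k * c else 0)" for k by simp_all
  then show "(mat c ** A) $ i $ j = c * A $ i $ j" "(A ** mat c) $ i $ j = A $ i $ j * c"
    by (simp_all add: matrix_matrix_mult_def mat_def)
qed

text \<open>With the last index pair fixed, \<open>K_contraction\<close> says that
  \<open>N ** L a b\<close> is a scalar multiple of the invertible matrix \<open>C\<close>. A
  nonzero scalar occurs, so \<open>N\<close> is invertible, and every slice \<open>L a b\<close> of
  \<open>K\<close> is a multiple of one fixed matrix.\<close>

lemma K_rank_one: "\<exists>U W. \<forall>s t. Km $ s $ t = U s * W t"
proof -
  have mu: "\<mu> \<noteq> 0" using bmw_algebra.mu0[OF bmw_alg[where 'a = complex]] .
  obtain a0 b0 d0 e0 where k: "Km $ (a0, b0) $ (d0, e0) \<noteq> 0" by (rule Km_entry)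
  define C where "C = C_mat R"
  define N where "N = (\<chi> p x. Km $ (x, p) $ (d0, e0))"
  define L where "L a b = (\<chi> x r. Km $ (a, b) $ (x, r))" for a b
  have NL: "(N ** L a b) $ p $ r = inverse \<mu> * Km $ (a, b) $ (d0, e0) * C $ p $ r" for a b p r
  proof -
    have "(N ** L a b) $ p $ r = (\<Sum>x\<in>UNIV. Km $ (a, b) $ (x, r) * Km $ (x, p) $ (d0, e0))"
      by (simp add: N_def L_def matrix_matrix_mult_def mult.commute)
    then show ?thesis using K_contraction[of a b d0 e0 p r] mu by (simp add: C_def mult.assoc)
  qed
  obtain C' where C': "C ** C' = mat 1" using C_invertible by (auto simp: C_def invertible_def)
  define c where "c = \<mu> / Km $ (a0, b0) $ (d0, e0)"
  have "N ** (L a0 b0 ** (mat c ** C')) = mat 1"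
  proof -
    have "N ** L a0 b0 = mat (inverse c) ** C"
      by (simp add: vec_eq_iff c_def mat_times NL divide_inverse mult_ac)
    then have "N ** (L a0 b0 ** (mat c ** C')) = mat (inverse c) ** C ** (mat c ** C')"
      by (simp add: matrix_mul_assoc)
    also have "C ** mat c = mat c ** C"
      by (simp add: vec_eq_iff mat_times)
    then have "mat (inverse c) ** C ** (mat c ** C') = (mat (inverse c) ** mat c) ** (C ** C')"
      by (metis matrix_mul_assoc)
    also have "mat (inverse c) ** mat c = (mat 1 :: complex^'n^'n)"
      using k mu by (auto simp: vec_eq_iff mat_times) (auto simp: mat_def c_def)
    finally show ?thesis by (simp add: C')
  qed
  then have "invertible N" unfolding invertible_right_inverse by blast
  then obtain N' where N': "N' ** N = mat 1" by (auto simp: invertible_def)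
  define W where "W t = inverse \<mu> * (N' ** C) $ fst t $ snd t" for t
  have "Km $ (a, b) $ (x, r) = Km $ (a, b) $ (d0, e0) * W (x, r)" for a b x r
  proof -
    have "Km $ (a, b) $ (x, r) = (N' ** (N ** L a b)) $ x $ r" by (simp add: matrix_mul_assoc N' L_def)
    also have "\<dots> = (\<Sum>p\<in>UNIV. N' $ x $ p * (N ** L a b) $ p $ r)" by (simp add: matrix_matrix_mult_def)
    also have "\<dots> = Km $ (a, b) $ (d0, e0) * W (x, r)"
      unfolding NL W_def by (simp add: matrix_matrix_mult_def sum_distrib_left mult_ac)
    finally show ?thesis .
  qed
  then have "Km $ s $ t = Km $ s $ (d0, e0) * W t" for s t by (metis surj_pair)
  then show ?thesis by (intro exI[of _ "\<lambda>s. Km $ s $ (d0, e0)"] exI[of _ W] allI)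
qed

text \<open>Between two copies of a rank-one \<open>K\<close> only one linear combination
  \<open>\<gamma>\<close> of the entries of \<open>A\<close> survives. It is carried by an operator
  on the empty window, hence lies in \<open>Eset 0\<close>.\<close>

lemma K_sandwich:
  fixes A :: "(nat \<Rightarrow> 'n, 'a::calgebra) rfm"
  assumes "A \<in> Eset 2"
  shows "\<exists>z\<in>Eset 0. m2 Km 0 * (A * m2 Km 0) = m2 Km 0 * z"
proof -
  obtain A' where A: "A = lemb 0 2 A'" using assms by (auto simp: Eset_def)
  obtain U W where K: "Km $ s $ t = U s * W t" for s t using K_rank_one by blast
  define \<gamma> where "\<gamma> = (\<Sum>a\<in>UNIV. \<Sum>b\<in>UNIV. \<Sum>c\<in>UNIV. \<Sum>d\<in>UNIV. (W (a, b) * U (c, d)) *\<^sub>C A' [a, b] [c, d])"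
  define z where "z = (lemb 0 0 (\<lambda>_ _. \<gamma>) :: (nat \<Rightarrow> 'n, 'a) rfm)"
  have "m2 Km 0 * (A * m2 Km 0) = m2 Km 0 * z"
  proof (rule rfm_eqI)
    fix u v :: "nat \<Rightarrow> 'n"
    have a: "agree 0 2 (u(0 := x, Suc 0 := y)) v = agree 0 2 u v" for x y
      by (auto simp: agree_def)
    have b: "agree 0 0 (u(0 := x, Suc 0 := y)) v \<longleftrightarrow> agree 0 2 u v \<and> x = v 0 \<and> y = v (Suc 0)" for x y
      by (auto simp: agree_def fun_eq_iff numeral_2_eq_2)
    have "ent (m2 Km 0 * (A * m2 Km 0)) u v
        = (if agree 0 2 u v then (U (u 0, u (Suc 0)) * W (v 0, v (Suc 0))) *\<^sub>C \<gamma> else 0)"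
    proof -
      have "m2 Km 0 * (A * m2 Km 0) = lemb 0 2 (op_mult 2 (scal (at2 Km 1 2)) (op_mult 2 A' (scal (at2 Km 1 2))))"
        unfolding A m2_def sl_def lemb_mult ..
      moreover have "op_mult 2 (scal (at2 Km 1 2)) (op_mult 2 A' (scal (at2 Km 1 2))) [p, p'] [r, r']
          = (U (p, p') * W (r, r')) *\<^sub>C \<gamma>" for p p' r r'
        by (simp add: op_mult_def sum_words2 scal_def K \<gamma>_def cs.scale_sum_right mult_ac)
      ultimately show ?thesis by (simp add: ent_lemb win2)
    qed
    moreover have "ent (m2 Km 0 * z) u v
        = (if agree 0 2 u v then (U (u 0, u (Suc 0)) * W (v 0, v (Suc 0))) *\<^sub>C \<gamma> else 0)"
    proof -
      have "Km $ (u 0, u (Suc 0)) $ (x, y) *\<^sub>C ent z (u(0 := x, Suc 0 := y)) v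
          = (if x = v 0 \<and> y = v (Suc 0) then if agree 0 2 u v then (U (u 0, u (Suc 0)) * W (x, y)) *\<^sub>C \<gamma> else 0 else 0)"
        for x y by (auto simp: z_def ent_lemb b K)
      then show ?thesis unfolding ent_m2_times by (simp only: delta2)
    qed
    ultimately show "ent (m2 Km 0 * (A * m2 Km 0)) u v = ent (m2 Km 0 * z) u v" by simp
  qed
  moreover have "z \<in> Eset 0" by (simp add: z_def lemb_Eset)
  ultimately show ?thesis by blast
qed

end

section \<open>Matrix representations of the quantum matrix algebra\<close>

lemma Sp_type_qpow:
  assumes "Sp_type q \<mu> k R" "1 \<le> j" "j \<le> k"
  shows "q ^ (2 * j) \<noteq> 1"
proof -
  have q: "q \<noteq> 0" "q * q \<noteq> 1" and n: "\<And>i. i \<in> {2..k} \<Longrightarrow> qnum q i \<noteq> 0"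
    using assms(1) by (auto simp: Sp_type_def BMW_type_def square_eq_1_iff)
  show ?thesis
  proof (cases "j = 1")
    case False
    then have "q ^ j \<noteq> inverse q ^ j" using n[of j] assms by (auto simp: qnum_def)
    moreover have "q ^ j * q ^ j \<noteq> 1 \<or> q ^ j = inverse q ^ j"
      using q by (auto simp: power_inverse field_simps)
    ultimately show ?thesis by (simp add: mult_2 power_add)
  qed (use q in \<open>simp add: power2_eq_square\<close>)
qed

lemma Sp_type_mu:
  assumes "Sp_type q \<mu> k R"
  shows "\<mu> = - (inverse q ^ (2 * k + 1))"
proof -
  have e: "- 1 - 2 * int k = - int (2 * k + 1)" by simp
  have "\<mu> = - (q powi (- 1 - 2 * int k))" using assms by (simp add: Sp_type_def)
  then show ?thesis unfolding e power_int_minus power_int_of_nat power_inverse by simp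
qed

locale symplectic_rep = skew_bmw q \<mu> R
  for q \<mu> :: complex and R :: "complex^('n::finite \<times> 'n)^('n \<times> 'n)" +
  fixes F :: "complex^('n \<times> 'n)^('n \<times> 'n)" and k :: nat and Mg :: "'a::calgebra^'n^'n"
  assumes F: "R_matrix F" and RF: "compatible_pair R F" and sp: "Sp_type q \<mu> k R"
    and rel: "m2 R 0 * (lemb 0 1 (at1 Mg 1) * (m2 F 0 * lemb 0 1 (at1 Mg 1) * m2 (matrix_inv F) 0))
      = lemb 0 1 (at1 Mg 1) * (m2 F 0 * lemb 0 1 (at1 Mg 1) * m2 (matrix_inv F) 0) * m2 R 0"
begin

definition M0 :: "(nat \<Rightarrow> 'n, 'a) rfm" where "M0 = lemb 0 1 (at1 Mg 1)"

abbreviation M01 :: "(nat \<Rightarrow> 'n, 'a) rfm" where "M01 \<equiv> M0 * (m2 F 0 * M0 * m2 (matrix_inv F) 0)"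

lemma rel0: "m2 R 0 * M01 = M01 * m2 R 0" using rel by (simp only: M0_def)

lemma M0_Eset: "1 \<le> n \<Longrightarrow> M0 \<in> Eset n" by (simp add: M0_def lemb_Eset)

lemma F_inv:
  "m2 F i * m2 (matrix_inv F) i = (1 :: (nat \<Rightarrow> 'n, 'b::calgebra) rfm)"
  "m2 (matrix_inv F) i * m2 F i = (1 :: (nat \<Rightarrow> 'n, 'b) rfm)"
  using F by (simp_all add: R_matrix_def m2_inv)

lemma compat:
  "m2 R i * m2 F (Suc i) * m2 F i = (m2 F (Suc i) * m2 F i * m2 R (Suc i) :: (nat \<Rightarrow> 'n, 'b::calgebra) rfm)"
  "m2 R (Suc i) * m2 F i * m2 F (Suc i) = (m2 F i * m2 F (Suc i) * m2 R i :: (nat \<Rightarrow> 'n, 'b) rfm)"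
  "m2 F i * m2 F (Suc i) * m2 F i = (m2 F (Suc i) * m2 F i * m2 F (Suc i) :: (nat \<Rightarrow> 'n, 'b) rfm)"
  using m2_rel3[OF conjunct1[OF RF[unfolded compatible_pair_def]], of i, where 'b = 'b]
    m2_rel3[OF conjunct2[OF RF[unfolded compatible_pair_def]], of i, where 'b = 'b]
    m2_rel3[OF conjunct2[OF F[unfolded R_matrix_def]], of i, where 'b = 'b]
  by (simp_all add: sl3 mult.assoc)

text \<open>Compatibility rewrites the conjugate of \<open>R 0\<close> by \<open>F 1\<close> as a
  conjugate of \<open>R 1\<close> by the inverse of \<open>F 0\<close>, which is the form that
  \<open>Gc_conj\<close> accepts.\<close>

lemma Gc_F: "Gc D F (matrix_inv F) a r p b = (if a = b then D $ p $ r else 0)"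
proof (rule Gc_conj[of _ _ "matrix_inv F" F])
  show "m2 (matrix_inv F) 0 * m2 F 0 = (1 :: (nat \<Rightarrow> 'n, complex) rfm)" by (rule F_inv)
  have "m2 F 1 * m2 R 0 * m2 (matrix_inv F) 1
      = (m2 (matrix_inv F) 0 * m2 F 0) * m2 F 1 * m2 R 0 * (m2 (matrix_inv F) 1 :: (nat \<Rightarrow> 'n, complex) rfm)"
    by (simp add: F_inv)
  also have "\<dots> = m2 (matrix_inv F) 0 * (m2 F 0 * m2 F (Suc 0) * m2 R 0) * m2 (matrix_inv F) 1"
    by (simp add: mult.assoc)
  also have "\<dots> = m2 (matrix_inv F) 0 * m2 R 1 * m2 F 0 * (m2 F 1 * m2 (matrix_inv F) 1)"
    unfolding compat(2)[symmetric] by (simp only: mult.assoc One_nat_def)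
  finally show "m2 F 1 * m2 R 0 * m2 (matrix_inv F) 1
      = (m2 (matrix_inv F) 0 * m2 R 1 * m2 F 0 :: (nat \<Rightarrow> 'n, complex) rfm)"
    by (simp only: F_inv mult_1_right)
qed

lemma bmw_antisym_rep:
  "bmw_antisym q \<mu> (m2 R) (m2 Rinv) (m2 Km :: nat \<Rightarrow> (nat \<Rightarrow> 'n, 'b::calgebra) rfm) k"
proof -
  interpret bmw_algebra q \<mu> "m2 R" "m2 Rinv" "m2 Km :: nat \<Rightarrow> (nat \<Rightarrow> 'n, 'b) rfm" by (rule bmw_alg)
  show ?thesis
  proof
    show "qnum q i \<noteq> 0" if "2 \<le> i" "i \<le> k" for i using sp that by (simp add: Sp_type_def)
    show "q * inverse \<mu> * xq i + 1 \<noteq> 0" if "1 \<le> i" "i \<le> k" for i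
    proof -
      have "q ^ (2 * Suc k) = q ^ (2 * (Suc k - i)) * q ^ (2 * i)"
        using that by (simp flip: power_add add: algebra_simps)
      then have "q * inverse \<mu> * xq i = - (q ^ (2 * (Suc k - i)))"
        using q0 unfolding Sp_type_mu[OF sp] xq_def by (simp add: power_inverse field_simps)
      then show ?thesis using Sp_type_qpow[OF sp, of "Suc k - i"] that by simp
    qed
  qed
qed

text \<open>The element left by the sandwich identity, scaled so that \<open>M01 * K\<close> equals
  \<open>\<mu>\<close> to the power -2 times \<open>K * gc\<close>. That it is the 2-contraction is
  the content of \<open>TR_MP_K\<close>.\<close>

definition gc :: "(nat \<Rightarrow> 'n, 'a) rfm" where
  "gc = (\<mu> * \<mu> * inverse (BMW_eta q \<mu>)) *\<^sub>C (SOME z. z \<in> Eset 0 \<and> m2 Km 0 * (M01 * m2 Km 0) = m2 Km 0 * z)"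

lemma M01_Eset: "M01 \<in> Eset 2"
  by (intro Eset_mult) (simp_all add: M0_Eset m2_Eset)

lemma gc: "gc \<in> Eset 0" "M01 * m2 Km 0 = (inverse \<mu> * inverse \<mu>) *\<^sub>C (m2 Km 0 * gc)"
proof -
  interpret bmw_algebra q \<mu> "m2 R" "m2 Rinv" "m2 Km :: nat \<Rightarrow> (nat \<Rightarrow> 'n, 'a) rfm" by (rule bmw_alg)
  define z where "z = (SOME z. z \<in> Eset 0 \<and> m2 Km 0 * (M01 * m2 Km 0) = m2 Km 0 * z)"
  have z: "z \<in> Eset 0" "m2 Km 0 * (M01 * m2 Km 0) = m2 Km 0 * z"
    unfolding z_def using someI_ex[OF K_sandwich[OF M01_Eset, unfolded Bex_def]] by auto
  have gz: "gc = (\<mu> * \<mu> * inverse (BMW_eta q \<mu>)) *\<^sub>C z" unfolding gc_def z_def ..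
  show "gc \<in> Eset 0" unfolding gz by (rule Eset_cs[OF z(1)])
  note BMW = BMW_bmw_algebra(2)[OF bmw] BMW_bmw_algebra(3)[OF bmw, of 0, where 'a = 'a]
  \<comment> \<open>The square of \<open>K\<close> is \<open>BMW_eta q \<mu>\<close> times
    \<open>K\<close>; of the two copies so obtained one passes \<open>M01\<close>, which commutes
    with \<open>R\<close> and therefore with \<open>K\<close>.\<close>
  have "BMW_eta q \<mu> *\<^sub>C (M01 * m2 Km 0) = M01 * (m2 Km 0 * m2 Km 0)" unfolding BMW(2) by simp
  also have "\<dots> = m2 Km 0 * M01 * m2 Km 0"
    by (simp only: intertwine_K[OF rel0[symmetric]] flip: mult.assoc[of M01])
  also have "\<dots> = m2 Km 0 * (M01 * m2 Km 0)" by (rule mult.assoc)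
  also have "\<dots> = m2 Km 0 * z" by (rule z)
  finally have "inverse (BMW_eta q \<mu>) *\<^sub>C BMW_eta q \<mu> *\<^sub>C (M01 * m2 Km 0) = inverse (BMW_eta q \<mu>) *\<^sub>C (m2 Km 0 * z)"
    by simp
  then show "M01 * m2 Km 0 = (inverse \<mu> * inverse \<mu>) *\<^sub>C (m2 Km 0 * gc)"
    using BMW(1) mu0 by (simp add: gz field_simps)
qed

sublocale quantum_matrix q \<mu> "m2 R" "m2 Rinv" "m2 Km" k "m2 F" "m2 (matrix_inv F)" Eset "Rtr D" M0 gc
proof -
  interpret bmw_antisym q \<mu> "m2 R" "m2 Rinv" "m2 Km :: nat \<Rightarrow> (nat \<Rightarrow> 'n, 'a) rfm" k by (rule bmw_antisym_rep)
  have far: "X * m2 Y i = m2 Y i * X" if "X \<in> Eset i" for X :: "(nat \<Rightarrow> 'n, 'a) rfm" and Y i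
    using that sl_disjoint[of 0 i i 2 _ "at2 Y 1 2"] unfolding Eset_def m2_def by auto
  show "quantum_matrix q \<mu> (m2 R) (m2 Rinv) (m2 Km) k (m2 F) (m2 (matrix_inv F)) Eset (Rtr D) M0 gc"
  proof
    show "m2 F i * m2 F j = m2 F j * (m2 F i :: (nat \<Rightarrow> 'n, 'a) rfm)" if "Suc i < j" for i j
      using that by (rule m2_far)
    show "m2 F i * m2 R j = m2 R j * (m2 F i :: (nat \<Rightarrow> 'n, 'a) rfm)" if "Suc i < j \<or> Suc j < i" for i j
      using that m2_far by metis
    show "m2 R (Suc i) * M0 = M0 * m2 R (Suc i)" "m2 F (Suc i) * M0 = M0 * m2 F (Suc i)" for i
      by (simp_all add: far M0_Eset)
    show "m2 R i * z = z * m2 R i" "m2 F i * z = z * m2 F i" if "z \<in> Eset 0" for z :: "(nat \<Rightarrow> 'n, 'a) rfm" and i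
      using that far[of z] Eset_Suc by (metis (full_types) Eset_def lemb_Eset le0 plus_nat.add_0 rangeE)+
    show "Rtr D (Suc i) (m2 F i * x * m2 (matrix_inv F) i) = Rtr D i x" if "x \<in> Eset (Suc i)" for x i
      using Gc_F that by (rule Rtr_conj)
    show "m2 R 0 * M01 = M01 * m2 R 0" by (rule rel0)
    show "M01 * m2 Km 0 = (inverse \<mu> * inverse \<mu>) *\<^sub>C (m2 Km 0 * gc)" by (rule gc)
    show "Rtr D i (Rtr D (Suc i) (m2 R i * x)) = Rtr D i (Rtr D (Suc i) (x * m2 R i))" for x i by (rule Rtr_cyc)
  qed (simp_all add: Eset_one Eset_add Eset_mult Eset_cs Eset_Suc Rtr_Eset Rtr_add Rtr_cs Rtr_left Rtr_right
      m2_Eset M0_Eset gc F_inv compat Rtr_R[OF skew] Rtr_K)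
qed

text \<open>Closing strand 1 through \<open>K\<close> gives \<open>\<mu>\<close>, and closing the
  free strand 0 gives \<open>\<mu> * BMW_eta q \<mu>\<close>; the factor
  \<open>inverse \<mu> * inverse \<mu>\<close> from the contraction cancels both powers of
  \<open>\<mu>\<close>.\<close>

lemma TR_MP_K: "TR 0 2 (MP 0 2 * m2 Km 0) = BMW_eta q \<mu> *\<^sub>C gc"
proof -
  have "MP 0 2 * m2 Km 0 = (inverse \<mu> * inverse \<mu>) *\<^sub>C (m2 Km 0 * gc)"
    using gc(2) by (simp add: numeral_2_eq_2 mult.assoc)
  moreover have "gc \<in> Eset 1" using Eset_Suc[OF gc(1)] by simp
  ultimately have "TR 0 2 (MP 0 2 * m2 Km 0)
      = (inverse \<mu> * inverse \<mu>) *\<^sub>C Rtr D 0 (Rtr D (Suc 0) (m2 Km 0) * gc)"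
    by (simp add: numeral_2_eq_2 Rtr_cs Rtr_right)
  also have "\<dots> = BMW_eta q \<mu> *\<^sub>C gc"
    using mu0 Rtr_right[OF gc(1), of D 1]
    by (simp add: Rtr_K Rtr_cs Rtr_one divide_inverse[symmetric] field_simps)
  finally show ?thesis .
qed

end

section \<open>Evaluation of noncommutative polynomials\<close>

text \<open>The unital algebra homomorphism from the free algebra that extends
  \<open>f\<close>.\<close>

definition ev :: "('g \<Rightarrow> 'a) \<Rightarrow> 'g free_alg \<Rightarrow> 'a::calgebra" where
  "ev f \<alpha> = (\<Sum>w\<in>Poly_Mapping.keys \<alpha>. Poly_Mapping.lookup \<alpha> w *\<^sub>C prod_list (map f (letters w)))"

lemma ev_on:
  assumes "finite S" "Poly_Mapping.keys \<alpha> \<subseteq> S"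
  shows "ev f \<alpha> = (\<Sum>w\<in>S. Poly_Mapping.lookup \<alpha> w *\<^sub>C prod_list (map f (letters w)))"
  unfolding ev_def by (rule sum.mono_neutral_left) (use assms in \<open>auto simp: in_keys_iff\<close>)

lemma ev_add: "ev f (\<alpha> + \<beta>) = ev f \<alpha> + ev f \<beta>"
proof -
  let ?S = "Poly_Mapping.keys \<alpha> \<union> Poly_Mapping.keys \<beta>"
  show ?thesis
    using Poly_Mapping.keys_add[of \<alpha> \<beta>]
    by (simp add: ev_on[of ?S] lookup_add cs_add_left sum.distrib)
qed

lemma ev_zero [simp]: "ev f 0 = 0" by (simp add: ev_def)

lemma ev_single: "ev f (Poly_Mapping.single w c) = c *\<^sub>C prod_list (map f (letters w))"
  using ev_on[of "{w}" "Poly_Mapping.single w c" f] by simp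

lemma ev_sum: "ev f (sum h A) = (\<Sum>x\<in>A. ev f (h x))"
  by (induction A rule: infinite_finite_induct) (simp_all add: ev_add)

lemma free_alg_expand: "(\<alpha> :: 'g free_alg) = (\<Sum>w\<in>Poly_Mapping.keys \<alpha>. Poly_Mapping.single w (Poly_Mapping.lookup \<alpha> w))"
  by (rule poly_mapping_eqI) (simp add: lookup_sum lookup_single when_def in_keys_iff)

lemma ev_mult: "ev f (\<alpha> * \<beta>) = ev f \<alpha> * ev f \<beta>"
proof -
  have s: "ev f (Poly_Mapping.single w c * Poly_Mapping.single w' c')
      = ev f (Poly_Mapping.single w c) * ev f (Poly_Mapping.single w' c')" for w w' c c'
    by (simp add: mult_single ev_single plus_word_def mult.commute)
  show ?thesis
    by (subst free_alg_expand[of \<alpha>], subst free_alg_expand[of \<beta>], subst free_alg_expand[of \<alpha>], subst (3) free_alg_expand[of \<beta>])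
      (simp only: sum_distrib_left sum_distrib_right ev_sum s)
qed

lemma ev_scalar: "ev f (scalar c) = c *\<^sub>C 1"
  by (simp add: scalar_def ev_single zero_word_def)

lemma ev_gen: "ev f (gen x) = f x"
  by (simp add: gen_def ev_single)

lemma ev_one: "ev f 1 = 1"
  using ev_scalar[of f 1] by (simp add: scalar_def single_one)

lemma ev_diff: "ev f (\<alpha> - \<beta>) = ev f \<alpha> - ev f \<beta>"
  using ev_add[of f "\<alpha> - \<beta>" \<beta>] by simp

lemma ev_shift: "ev f (braid_shift m \<alpha>) = ev (\<lambda>l. f (shift_letter m l)) \<alpha>"
  unfolding braid_shift_def ev_sum ev_single by (simp add: ev_def comp_def)

lemma sl_sum: "sl m n (\<lambda>u v. \<Sum>x\<in>A. X x u v) = (\<Sum>x\<in>A. sl m n (X x))"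
proof (induction A rule: infinite_finite_induct)
  case (insert x A)
  show ?case unfolding sum.insert[OF insert(1,2)] sl_add insert(3) ..
qed (use sl_cs[of m n 0] in simp_all)

lemma sl_rho: "sl m n (rho R n \<alpha>) = ev (\<lambda>l. sl m n (rho_letter R l)) \<alpha>"
  unfolding rho_def[abs_def] sl_sum sl_cs sl_op_prod ev_def by (simp add: comp_def)

context bmw_algebra
begin

lemma K_factored: "K i = inverse (\<mu> * lam) *\<^sub>C ((q *\<^sub>C 1 - R i) * (inverse q *\<^sub>C 1 + R i))"
proof -
  have "(q *\<^sub>C 1 - R i) * (inverse q *\<^sub>C 1 + R i) = 1 + lam *\<^sub>C R i - R i * R i"
    using q0 by (simp add: algebra_simps lam_def cs.scale_left_diff_distrib)
  also have "\<dots> = (\<mu> * lam) *\<^sub>C K i" by (simp add: R_sq mult.commute)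
  finally have "inverse (\<mu> * lam) *\<^sub>C ((q *\<^sub>C 1 - R i) * (inverse q *\<^sub>C 1 + R i))
      = inverse (\<mu> * lam) *\<^sub>C (\<mu> * lam) *\<^sub>C K i" by (rule arg_cong)
  moreover have "inverse (\<mu> * lam) * (\<mu> * lam) = 1" using mu0 lam0 by (simp add: field_simps)
  ultimately show ?thesis by (simp only: cs_cs cs_one)
qed

lemma ev_kappa: "f (Sigma i) = R j \<Longrightarrow> ev f (kappa q \<mu> i) = K j"
  by (simp add: kappa_def sigma_def ev_mult ev_scalar ev_add ev_diff ev_gen K_factored[of j] lam_def inverse_eq_divide)

lemma ev_sigma_minus: "f (Sigma i) = R j \<Longrightarrow> ev f (sigma_minus q \<mu> i x) = Sm j x"
  using ev_kappa[of f i j]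
  by (simp add: sigma_minus_def sigma_def ev_add ev_mult ev_scalar ev_one ev_gen Sm_def lam_def)

lemma xq_powi: "q powi (- 2 * int i) = xq i"
proof -
  have e: "- 2 * int i = - int (2 * i)" by simp
  show ?thesis unfolding e power_int_minus power_int_of_nat xq_def by (simp add: power_inverse)
qed

text \<open>Braid letters are numbered from 1 and strands from 0, hence \<open>Suc j\<close> against
  \<open>m + j\<close>; the offset \<open>m\<close> also covers shifted braids.\<close>

lemma ev_antisym:
  assumes "\<And>j. Suc j < i \<Longrightarrow> f (Sigma (Suc j)) = R (m + j)"
  shows "ev f (antisym q \<mu> i) = asym m i"
  using assms
proof (induction m i rule: asym.induct)
  case (3 m j)
  then have "ev f (sigma_minus q \<mu> (Suc j) x) = Sm (m + j) x" for x by (intro ev_sigma_minus) simp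
  then show ?case using 3
    by (simp add: Let_def ev_mult ev_scalar xq_powi cq_def mult.assoc del: mult_minus_left)
qed (simp_all add: ev_one)

end

section \<open>Quotients of free algebras\<close>

lemma ideal_uminus: "x \<in> two_sided_ideal S \<Longrightarrow> - x \<in> two_sided_ideal S"
proof (induction rule: two_sided_ideal.induct)
  case (generator s a b)
  then have "(- a) * s * b \<in> two_sided_ideal S" by (rule two_sided_ideal.generator)
  then show ?case by simp
next
  case (add x y)
  then have "- x + - y \<in> two_sided_ideal S" by (intro two_sided_ideal.add)
  then show ?case by simp
qed (simp add: two_sided_ideal.zero)

lemma ideal_mult: "x \<in> two_sided_ideal S \<Longrightarrow> c * x * d \<in> two_sided_ideal S"
proof (induction rule: two_sided_ideal.induct)
  case (generator s a b)
  then have "(c * a) * s * (b * d) \<in> two_sided_ideal S" by (rule two_sided_ideal.generator)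
  then show ?case by (simp add: mult.assoc)
qed (simp_all add: two_sided_ideal.zero distrib_left distrib_right two_sided_ideal.add)

lemma ideal_left: "x \<in> two_sided_ideal S \<Longrightarrow> c * x \<in> two_sided_ideal S"
  and ideal_right: "x \<in> two_sided_ideal S \<Longrightarrow> x * c \<in> two_sided_ideal S"
  using ideal_mult[of x S c 1] ideal_mult[of x S 1 c] by simp_all

lemma ideal_diff: "x \<in> two_sided_ideal S \<Longrightarrow> y \<in> two_sided_ideal S \<Longrightarrow> x - y \<in> two_sided_ideal S"
  using two_sided_ideal.add[OF _ ideal_uminus, of x S y] by simp

lemma ideal_empty: "x \<in> two_sided_ideal {} \<Longrightarrow> x = 0"
  by (induction rule: two_sided_ideal.induct) auto

lemma scalar_ring:
  "scalar (c + d) = scalar c + scalar d" "scalar (c * d) = scalar c * scalar d" "scalar 1 = 1" "scalar 0 = 0"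
  by (simp_all add: scalar_def single_add mult_single)

lemma scalar_central: "scalar c * x = x * scalar (c :: complex)" for x :: "'g free_alg"
proof -
  have c: "scalar c * Poly_Mapping.single w d = Poly_Mapping.single w d * scalar c" for w :: "'g word" and d
    by (simp add: scalar_def mult_single mult.commute)
  then show ?thesis
    by (subst (1 2) free_alg_expand[of x]) (simp only: sum_distrib_left sum_distrib_right c)
qed

definition quot_rel :: "('g free_alg set \<Rightarrow> 'g free_alg) \<Rightarrow> ('g free_alg set \<Rightarrow> 'g free_alg) \<Rightarrow> bool" where
  "quot_rel f h \<longleftrightarrow> (\<forall>S. f S - h S \<in> two_sided_ideal S)"

lemma equivp_quot_rel: "equivp quot_rel"
proof (rule equivpI)
  show "reflp quot_rel" by (simp add: reflp_def quot_rel_def two_sided_ideal.zero)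
  show "symp quot_rel"
  proof (rule sympI)
    fix f h :: "'g free_alg set \<Rightarrow> 'g free_alg"
    assume "quot_rel f h"
    then show "quot_rel h f" using ideal_uminus[of "f S - h S" S for S] by (simp add: quot_rel_def)
  qed
  show "transp quot_rel"
  proof (rule transpI)
    fix f h l :: "'g free_alg set \<Rightarrow> 'g free_alg"
    assume "quot_rel f h" "quot_rel h l"
    then show "quot_rel f l"
      using two_sided_ideal.add[of "f S - h S" S "h S - l S" for S] by (simp add: quot_rel_def)
  qed
qed

text \<open>
  The product of the quotients of the free algebra by all its ideals: a type cannot depend on the
  relations of one particular quotient.
\<close>

quotient_type 'g quot_alg = "'g free_alg set \<Rightarrow> 'g free_alg" / quot_rel
  by (rule equivp_quot_rel)

text \<open>A relation and not a function, because elements of a quotient have no canonical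
  representatives that would be compatible with the operations.\<close>

definition represents :: "'g free_alg set \<Rightarrow> 'g quot_alg \<Rightarrow> 'g free_alg \<Rightarrow> bool" where
  "represents S a x \<longleftrightarrow> rep_quot_alg a S - x \<in> two_sided_ideal S"

lemma represents_rep: "represents S a (rep_quot_alg a S)"
  by (simp add: represents_def two_sided_ideal.zero)

lemma represents_abs: "represents S (abs_quot_alg f) (f S)"
  using Quotient3_rep_abs[OF Quotient3_quot_alg, of f]
  by (simp add: represents_def quot_rel_def two_sided_ideal.zero)

lemma represents_unique: "represents S a x \<Longrightarrow> represents S a y \<Longrightarrow> x - y \<in> two_sided_ideal S"
  unfolding represents_def using ideal_diff[of "rep_quot_alg a S - y" S "rep_quot_alg a S - x"] by simp

lemma represents_trans: "represents S a x \<Longrightarrow> x - y \<in> two_sided_ideal S \<Longrightarrow> represents S a y"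
  unfolding represents_def using two_sided_ideal.add[of "rep_quot_alg a S - x" S "x - y"] by simp

lemma quot_alg_eqI:
  assumes "\<And>S. represents S a (x S)" "\<And>S. represents S b (y S)" "\<And>S. x S - y S \<in> two_sided_ideal S"
  shows "a = b"
proof -
  have "represents S b (rep_quot_alg a S)" for S
  proof (rule represents_trans[OF assms(2)])
    have "y S - x S \<in> two_sided_ideal S" using ideal_uminus[OF assms(3)] by simp
    moreover have "x S - rep_quot_alg a S \<in> two_sided_ideal S" using represents_unique[OF assms(1) represents_rep] .
    ultimately show "y S - rep_quot_alg a S \<in> two_sided_ideal S"
      using two_sided_ideal.add[of "y S - x S" S "x S - rep_quot_alg a S"] by simp
  qed
  then have "quot_rel (rep_quot_alg b) (rep_quot_alg a)" by (simp add: represents_def quot_rel_def)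
  then show ?thesis using Quotient3_rel_rep[OF Quotient3_quot_alg] by metis
qed

instantiation quot_alg :: (type) "{zero, one, plus, minus, uminus, times}"
begin

definition zero_quot_alg :: "'a quot_alg" where "0 = abs_quot_alg (\<lambda>S. 0)"
definition one_quot_alg :: "'a quot_alg" where "1 = abs_quot_alg (\<lambda>S. 1)"
definition plus_quot_alg :: "'a quot_alg \<Rightarrow> 'a quot_alg \<Rightarrow> 'a quot_alg"
  where "a + b = abs_quot_alg (\<lambda>S. rep_quot_alg a S + rep_quot_alg b S)"
definition minus_quot_alg :: "'a quot_alg \<Rightarrow> 'a quot_alg \<Rightarrow> 'a quot_alg"
  where "a - b = abs_quot_alg (\<lambda>S. rep_quot_alg a S - rep_quot_alg b S)"
definition uminus_quot_alg :: "'a quot_alg \<Rightarrow> 'a quot_alg"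
  where "- a = abs_quot_alg (\<lambda>S. - rep_quot_alg a S)"
definition times_quot_alg :: "'a quot_alg \<Rightarrow> 'a quot_alg \<Rightarrow> 'a quot_alg"
  where "a * b = abs_quot_alg (\<lambda>S. rep_quot_alg a S * rep_quot_alg b S)"

instance ..

end

definition cs_quot :: "complex \<Rightarrow> 'g quot_alg \<Rightarrow> 'g quot_alg" where
  "cs_quot c a = abs_quot_alg (\<lambda>S. scalar c * rep_quot_alg a S)"

lemma represents_0: "represents S 0 0" and represents_1: "represents S 1 1"
  unfolding zero_quot_alg_def one_quot_alg_def using represents_abs by blast+

lemma represents_add: "represents S a x \<Longrightarrow> represents S b y \<Longrightarrow> represents S (a + b) (x + y)"
proof -
  assume "represents S a x" "represents S b y"
  then have "(rep_quot_alg a S - x) + (rep_quot_alg b S - y) \<in> two_sided_ideal S"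
    unfolding represents_def by (rule two_sided_ideal.add)
  then show ?thesis unfolding plus_quot_alg_def
    by (intro represents_trans[OF represents_abs]) (simp add: algebra_simps)
qed

lemma represents_diff: "represents S a x \<Longrightarrow> represents S b y \<Longrightarrow> represents S (a - b) (x - y)"
proof -
  assume "represents S a x" "represents S b y"
  then have "(rep_quot_alg a S - x) - (rep_quot_alg b S - y) \<in> two_sided_ideal S"
    unfolding represents_def by (rule ideal_diff)
  then show ?thesis unfolding minus_quot_alg_def
    by (intro represents_trans[OF represents_abs]) (simp add: algebra_simps)
qed

lemma represents_uminus: "represents S a x \<Longrightarrow> represents S (- a) (- x)"
proof -
  assume "represents S a x"
  then have "- (rep_quot_alg a S - x) \<in> two_sided_ideal S" unfolding represents_def by (rule ideal_uminus)
  then show ?thesis unfolding uminus_quot_alg_def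
    by (intro represents_trans[OF represents_abs]) (simp add: algebra_simps)
qed

lemma represents_mult: "represents S a x \<Longrightarrow> represents S b y \<Longrightarrow> represents S (a * b) (x * y)"
proof -
  assume "represents S a x" "represents S b y"
  then have "(rep_quot_alg a S - x) * rep_quot_alg b S + x * (rep_quot_alg b S - y) \<in> two_sided_ideal S"
    unfolding represents_def by (intro two_sided_ideal.add ideal_left ideal_right)
  then show ?thesis unfolding times_quot_alg_def
    by (intro represents_trans[OF represents_abs]) (simp add: algebra_simps)
qed

lemma represents_cs_quot: "represents S a x \<Longrightarrow> represents S (cs_quot c a) (scalar c * x)"
proof -
  assume "represents S a x"
  then have "scalar c * (rep_quot_alg a S - x) \<in> two_sided_ideal S" unfolding represents_def by (rule ideal_left)
  then show ?thesis unfolding cs_quot_def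
    by (intro represents_trans[OF represents_abs]) (simp add: algebra_simps)
qed

lemmas represents_ops = represents_0 represents_1 represents_add represents_diff represents_uminus
  represents_mult represents_cs_quot

instance quot_alg :: (type) ring_1
proof
  show "(0 :: 'a quot_alg) \<noteq> 1"
  proof
    assume "(0 :: 'a quot_alg) = 1"
    \<comment> \<open>Many components are trivial rings. The component at the empty set of relations
      is the free algebra itself and separates 0 from 1.\<close>
    then have "(0 :: 'a free_alg) - 1 \<in> two_sided_ideal {}"
      by (metis represents_0 represents_1 represents_unique)
    then show False using ideal_empty by fastforce
  qed
qed (rule quot_alg_eqI, (rule represents_ops represents_rep)+, simp add: algebra_simps two_sided_ideal.zero)+

instantiation quot_alg :: (type) calgebra
begin

definition cs_quot_alg :: "complex \<Rightarrow> 'a quot_alg \<Rightarrow> 'a quot_alg" where "cs_quot_alg = cs_quot"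

instance
proof
  fix c d :: complex and x y :: "'a quot_alg"
  have "cs_quot c (x + y) = cs_quot c x + cs_quot c y" "cs_quot (c + d) x = cs_quot c x + cs_quot d x"
    "cs_quot c (cs_quot d x) = cs_quot (c * d) x" "cs_quot 1 x = x" "cs_quot c x * y = cs_quot c (x * y)"
    by (rule quot_alg_eqI, (rule represents_ops represents_rep)+,
        simp add: scalar_ring algebra_simps two_sided_ideal.zero)+
  moreover have "x * cs_quot c y = cs_quot c (x * y)"
    by (rule quot_alg_eqI, (rule represents_ops represents_rep)+)
      (simp add: scalar_central[of c] mult.assoc two_sided_ideal.zero)
  ultimately show "c *\<^sub>C (x + y) = c *\<^sub>C x + c *\<^sub>C y" "(c + d) *\<^sub>C x = c *\<^sub>C x + d *\<^sub>C x"
    "c *\<^sub>C d *\<^sub>C x = (c * d) *\<^sub>C x" "1 *\<^sub>C x = x" "(c *\<^sub>C x) * y = c *\<^sub>C (x * y)" "x * (c *\<^sub>C y) = c *\<^sub>C (x * y)"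
    by (simp_all add: cs_quot_alg_def)
qed

end

lemma represents_cs: "represents S a x \<Longrightarrow> represents S (c *\<^sub>C a) (scalar c * x)"
  unfolding cs_quot_alg_def by (rule represents_cs_quot)

lemma represents_zero_iff: "represents S 0 x \<longleftrightarrow> x \<in> two_sided_ideal S"
  using represents_unique[of S 0 x 0] represents_trans[of S 0 0 x] represents_0[of S] ideal_uminus[of x S]
  by auto

lemma represents_sum: "(\<And>i. i \<in> I \<Longrightarrow> represents S (a i) (x i)) \<Longrightarrow> represents S (sum a I) (sum x I)"
  by (induction I rule: infinite_finite_induct) (simp_all add: represents_0 represents_add)

section \<open>Operators over a quotient algebra\<close>

definition op_represents ::
  "'g free_alg set \<Rightarrow> nat \<Rightarrow> (nat \<Rightarrow> 'n::finite, 'g quot_alg) rfm \<Rightarrow> ('n, 'g free_alg) op \<Rightarrow> bool" where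
  "op_represents S n A X \<longleftrightarrow> A \<in> Eset n \<and>
     (\<forall>u v. agree 0 n u v \<longrightarrow> represents S (ent A u v) (X (win 0 n u) (win 0 n v)))"

lemma op_represents_lemb:
  fixes Y :: "('n::finite, 'g quot_alg) op"
  shows "op_represents S n (lemb 0 n Y) X
    \<longleftrightarrow> (\<forall>s\<in>basis_words n. \<forall>t\<in>basis_words n. represents S (Y s t) (X s t))"
proof
  assume r: "op_represents S n (lemb 0 n Y) X"
  show "\<forall>s\<in>basis_words n. \<forall>t\<in>basis_words n. represents S (Y s t) (X s t)"
  proof (intro ballI)
    fix s t :: "'n list"
    assume st: "s \<in> basis_words n" "t \<in> basis_words n"
    define u v :: "nat \<Rightarrow> 'n" where "u = put 0 undefined s" and "v = put 0 undefined t"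
    have uv: "agree 0 n u v" "win 0 n u = s" "win 0 n v = t"
      using st by (auto simp: u_def v_def basis_words_def) (auto simp: agree_def put_def)
    then have "represents S (ent (lemb 0 n Y) u v) (X s t)" using r by (auto simp: op_represents_def)
    then show "represents S (Y s t) (X s t)" by (simp add: ent_lemb uv)
  qed
qed (auto simp: op_represents_def ent_lemb lemb_Eset basis_words_def)

lemma op_represents_cong:
  assumes "op_represents S n A X" "op_eq n X Y" shows "op_represents S n A Y"
  using assms by (auto simp: op_represents_def op_eq_def basis_words_def)

lemma op_represents_mult:
  assumes "op_represents S n A X" "op_represents S n B Y" shows "op_represents S n (A * B) (op_mult n X Y)"
proof -
  obtain X' Y' where AB: "A = lemb 0 n X'" "B = lemb 0 n Y'"
    using assms by (auto simp: op_represents_def Eset_def)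
  show ?thesis using assms unfolding AB lemb_mult op_represents_lemb
    by (auto simp: op_mult_def intro!: represents_sum represents_mult)
qed

lemma op_represents_one: "op_represents S n 1 op_id"
  unfolding lemb_one[of 0 n, symmetric] op_represents_lemb
  by (simp add: op_id_def represents_0 represents_1)

lemma op_represents_sl: "op_represents S n (sl 0 n Z) (scalar_op Z)"
  unfolding sl_def op_represents_lemb
  using represents_cs[OF represents_1, of S] by (simp add: scal_def scalar_op_def)

lemma op_represents_prod:
  "list_all2 (op_represents S n) As Xs \<Longrightarrow> op_represents S n (prod_list As) (op_prod n Xs)"
  by (induction rule: list_all2_induct) (simp_all add: op_prod_def op_represents_one op_represents_mult)

lemma op_represents_Tp:
  assumes "op_represents S (Suc n) A X" shows "op_represents S n (Tp n A) (ptrace (Suc n) X)"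
proof -
  obtain X' where A: "A = lemb 0 (Suc n) X'" using assms by (auto simp: op_represents_def Eset_def)
  have e: "Tp n A = lemb 0 n (ptrace (Suc n) X')" using Tp_lemb[of 0 n X'] by (simp add: A)
  show ?thesis using assms unfolding e unfolding A op_represents_lemb
    by (auto simp: ptrace_def insert_at_def basis_words_def intro!: represents_sum)
qed

lemma op_represents_eqI:
  assumes "\<And>S. \<exists>X Y. op_represents S n A X \<and> op_represents S n B Y
      \<and> (\<forall>u\<in>basis_words n. \<forall>v\<in>basis_words n. X u v - Y u v \<in> two_sided_ideal S)"
  shows "A = B"
proof -
  obtain X' Y' where AB: "A = lemb 0 n X'" "B = lemb 0 n Y'"
    using assms by (fastforce simp: op_represents_def Eset_def)
  have "op_eq n X' Y'"
    unfolding op_eq_def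
  proof (intro ballI)
    fix u v :: "'b list"
    assume "u \<in> basis_words n" "v \<in> basis_words n"
    then have "\<exists>x y. represents S (X' u v) x \<and> represents S (Y' u v) y \<and> x - y \<in> two_sided_ideal S" for S
      using assms[of S] unfolding AB op_represents_lemb by blast
    then obtain x y where "represents S (X' u v) (x S)" "represents S (Y' u v) (y S)" "x S - y S \<in> two_sided_ideal S" for S
      by metis
    then show "X' u v = Y' u v" by (rule quot_alg_eqI)
  qed
  then show ?thesis unfolding AB by (rule lemb_cong)
qed

lemma op_represents_add:
  "op_represents S n A X \<Longrightarrow> op_represents S n B Y \<Longrightarrow> op_represents S n (A + B) (\<lambda>u v. X u v + Y u v)"
  by (simp add: op_represents_def Eset_add ent_add represents_add)

lemma op_represents_cs:
  "op_represents S n A X \<Longrightarrow> op_represents S n (c *\<^sub>C A) (\<lambda>u v. scalar c * X u v)"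
  by (simp add: op_represents_def Eset_cs ent_cs represents_cs)

lemma op_represents_0: "op_represents S n 0 (\<lambda>u v. 0)"
  unfolding lemb_zero[of 0 n, symmetric] op_represents_lemb by (simp add: op_zero_def represents_0)

lemma op_represents_sum:
  "(\<And>i. i \<in> I \<Longrightarrow> op_represents S n (A i) (X i)) \<Longrightarrow> op_represents S n (sum A I) (\<lambda>u v. \<Sum>i\<in>I. X i u v)"
  by (induction I rule: infinite_finite_induct) (simp_all add: op_represents_0 op_represents_add)

abbreviation scalar_represents :: "'g free_alg set \<Rightarrow> (nat \<Rightarrow> 'n::finite, 'g quot_alg) rfm \<Rightarrow> 'g free_alg \<Rightarrow> bool" where
  "scalar_represents S z x \<equiv> op_represents S 0 z (\<lambda>u v. x)"

lemma basis_words_0: "basis_words 0 = {[]}"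
  by (auto simp: basis_words_def)

lemma op_represents_mult_scalar:
  assumes "op_represents S n A X" "scalar_represents S z x"
  shows "op_represents S n (A * z) (\<lambda>u v. X u v * x)"
proof -
  obtain z' where z: "z = lemb 0 0 z'" using assms(2) by (auto simp: op_represents_def Eset_def)
  have "z \<in> Eset n" by (simp add: z lemb_Eset)
  moreover have "ent (A * z) u v = ent A u v * z' [] []" for u v
    unfolding z ent_times_lemb by (simp add: basis_words_0 win_def put_def)
  moreover have "represents S (z' [] []) x"
    using assms(2) unfolding z op_represents_lemb by (simp add: basis_words_0)
  ultimately show ?thesis using assms(1) by (auto simp: op_represents_def Eset_mult intro: represents_mult)
qed

lemma scalar_represents_one: "scalar_represents S 1 1"
  using op_represents_one by (rule op_represents_cong) (simp add: op_eq_def op_id_def basis_words_def)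

lemma scalar_represents_power: "scalar_represents S z x \<Longrightarrow> scalar_represents S (z ^ n) (x ^ n)"
proof (induction n)
  case (Suc n)
  have "scalar_represents S (z * z ^ n) (x * x ^ n)" using Suc op_represents_mult_scalar by blast
  then show ?case by simp
qed (simp add: scalar_represents_one)

lemma sum_words_Suc:
  "(\<Sum>w\<in>basis_words (Suc n). f w) = (\<Sum>c\<in>UNIV. \<Sum>w\<in>basis_words n. f (w @ [c :: 'n::finite]))"
proof -
  have "basis_words (Suc n) = (\<lambda>(c, w). w @ [c :: 'n]) ` (UNIV \<times> basis_words n)"
  proof (intro set_eqI iffI)
    fix w :: "'n list"
    assume "w \<in> basis_words (Suc n)"
    then have "w = butlast w @ [last w]" "butlast w \<in> basis_words n"
      by (auto simp: basis_words_def intro!: append_butlast_last_id[symmetric])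
    then show "w \<in> (\<lambda>(c, w). w @ [c]) ` (UNIV \<times> basis_words n)" by (auto intro!: image_eqI[of _ _ "(last w, butlast w)"])
  qed (auto simp: basis_words_def)
  moreover have "inj_on (\<lambda>(c, w). w @ [c :: 'n]) (UNIV \<times> basis_words n)" by (auto simp: inj_on_def)
  ultimately show ?thesis by (simp add: sum.reindex sum.cartesian_product split_def comp_def)
qed

lemma ptrace_funpow_entry:
  assumes "length u = m" "length v = m"
  shows "(ptrace (Suc m) ^^ s) X (u @ x) (v @ y) = (\<Sum>c\<in>basis_words s. X (u @ c @ x) (v @ c @ y))"
proof (induction s arbitrary: x y)
  case 0
  show ?case by (simp add: basis_words_0)
next
  case (Suc s)
  have "(ptrace (Suc m) ^^ Suc s) X (u @ x) (v @ y) = (\<Sum>c\<in>UNIV. (ptrace (Suc m) ^^ s) X (u @ (c # x)) (v @ (c # y)))"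
    by (simp add: ptrace_def insert_at_def assms)
  then show ?case unfolding Suc.IH sum_words_Suc by simp
qed

primrec Tps :: "nat \<Rightarrow> nat \<Rightarrow> (nat \<Rightarrow> 'n::finite, 'a::ring_1) rfm \<Rightarrow> (nat \<Rightarrow> 'n, 'a) rfm" where
  "Tps m 0 A = A"
| "Tps m (Suc s) A = Tps m s (Tp (m + s) A)"

text \<open>\<open>Tps\<close> closes the strands from the last to the first, whereas iterating
  \<open>ptrace (Suc m)\<close> removes the first of them each time. Both are the sum over all words
  on the closed strands.\<close>

lemma op_represents_Tps:
  "op_represents S (m + s) A X \<Longrightarrow> op_represents S m (Tps m s A) ((ptrace (Suc m) ^^ s) X)"
proof -
  assume "op_represents S (m + s) A X"
  then have "op_represents S m (Tps m s A) (\<lambda>u v. \<Sum>c\<in>basis_words s. X (u @ c) (v @ c))"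
  proof (induction s arbitrary: A X)
    case 0
    then show ?case by (simp add: basis_words_0)
  next
    case (Suc s)
    have "op_represents S m (Tps m s (Tp (m + s) A)) (\<lambda>u v. \<Sum>c\<in>basis_words s. ptrace (Suc (m + s)) X (u @ c) (v @ c))"
      using Suc.prems by (intro Suc.IH op_represents_Tp) simp
    moreover have "op_eq m (\<lambda>u v. \<Sum>c\<in>basis_words s. ptrace (Suc (m + s)) X (u @ c) (v @ c))
        (\<lambda>u v. \<Sum>c\<in>basis_words (Suc s). X (u @ c) (v @ c))"
      unfolding op_eq_def sum_words_Suc
      by (subst sum.swap) (auto simp: ptrace_def insert_at_def basis_words_def intro!: sum.cong)
    ultimately show ?case by (simp add: op_represents_cong)
  qed
  moreover have "op_eq m (\<lambda>u v. \<Sum>c\<in>basis_words s. X (u @ c) (v @ c)) ((ptrace (Suc m) ^^ s) X)"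
    using ptrace_funpow_entry[of _ m _ s X "[]" "[]"] by (simp add: op_eq_def basis_words_def)
  ultimately show ?thesis by (rule op_represents_cong)
qed

section \<open>The Cayley--Hamilton identity\<close>

locale symplectic_qma = skew_bmw q \<mu> R
  for q \<mu> :: complex and R :: "complex^('n::finite \<times> 'n)^('n \<times> 'n)" +
  fixes F :: "complex^('n \<times> 'n)^('n \<times> 'n)" and k :: nat
  assumes F: "R_matrix F" and RF: "compatible_pair R F" and sp: "Sp_type q \<mu> k R"
begin

abbreviation J :: "'n qma_free set" where "J \<equiv> qma_relations R F"

text \<open>The component of the generic matrix is 0 in all quotients other than the one by \<open>J\<close>.\<close>

definition gen_comp :: "'n qma_free set \<Rightarrow> 'n qma_free^'n^'n" where
  "gen_comp S = (if S = J then gen_mat else 0)"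

definition Mq :: "('n \<times> 'n) quot_alg^'n^'n" where
  "Mq = (\<chi> a b. abs_quot_alg (\<lambda>S. gen_comp S $ a $ b))"

lemma Mq_represents: "1 \<le> n \<Longrightarrow> op_represents S n (lemb 0 1 (at1 Mq 1)) (at1 (gen_comp S) 1)"
proof -
  assume "1 \<le> n"
  then have e: "lemb 0 1 (at1 Mq 1) = lemb 0 n (at1 Mq 1)" using lemb_at1[of 1 n 0 Mq] by simp
  have "represents S (Mq $ a $ b) (gen_comp S $ a $ b)" for a b
    using represents_abs[of S "\<lambda>S. gen_comp S $ a $ b"] by (simp add: Mq_def)
  then show ?thesis unfolding e op_represents_lemb by (auto simp: at1_def represents_0)
qed

lemma m2_represents:
  fixes X :: "complex^('b::finite \<times> 'b)^('b \<times> 'b)" and S :: "'a free_alg set"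
  shows "1 \<le> i \<Longrightarrow> Suc i \<le> n \<Longrightarrow> op_represents S n (m2 X (i - 1)) (scalar_op (at2 X i (Suc i)))"
proof -
  assume "1 \<le> i" "Suc i \<le> n"
  then have e: "m2 X (i - 1) = (sl 0 n (at2 X i (Suc i)) :: (nat \<Rightarrow> 'b, 'a quot_alg) rfm)"
    by (simp add: sl_at2)
  show ?thesis unfolding e by (rule op_represents_sl)
qed

text \<open>Checked in every component separately: at \<open>J\<close> it is a defining relation,
  and elsewhere both sides vanish together with the generic matrix.\<close>

lemma Mq_relation:
  "m2 R 0 * (lemb 0 1 (at1 Mq 1) * (m2 F 0 * lemb 0 1 (at1 Mq 1) * m2 (matrix_inv F) 0))
    = lemb 0 1 (at1 Mq 1) * (m2 F 0 * lemb 0 1 (at1 Mq 1) * m2 (matrix_inv F) 0) * m2 R 0"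
proof (rule op_represents_eqI[of 2])
  fix S
  let ?M = "at1 (gen_comp S) 1" and ?s = "\<lambda>X. scalar_op (at2 X 1 2) :: ('n, 'n qma_free) op"
  let ?M2 = "op_prod 2 [?s F, ?M, ?s (matrix_inv F)]"
  let ?X = "op_prod 2 [?s R, ?M, ?M2]" and ?Y = "op_prod 2 [?M, ?M2, ?s R]"
  let ?A = "lemb 0 1 (at1 Mq 1)" and ?m = "\<lambda>X. m2 X 0 :: (nat \<Rightarrow> 'n, ('n \<times> 'n) quot_alg) rfm"
  have s: "op_represents S 2 (?m X) (?s X)" for X using m2_represents[of 1 2 S X] by (simp add: numeral_2_eq_2)
  have M: "op_represents S 2 ?A ?M" by (rule Mq_represents) simp
  have M2: "op_represents S 2 (?m F * ?A * ?m (matrix_inv F)) ?M2"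
    using op_represents_prod[of S 2 "[?m F, ?A, ?m (matrix_inv F)]"] s M by (simp add: mult.assoc)
  have "op_represents S 2 (?m R * (?A * (?m F * ?A * ?m (matrix_inv F)))) ?X"
    using op_represents_prod[of S 2 "[?m R, ?A, ?m F * ?A * ?m (matrix_inv F)]"] s M M2 by (simp add: mult.assoc)
  moreover have "op_represents S 2 (?A * (?m F * ?A * ?m (matrix_inv F)) * ?m R) ?Y"
    using op_represents_prod[of S 2 "[?A, ?m F * ?A * ?m (matrix_inv F), ?m R]"] s M M2 by (simp add: mult.assoc)
  moreover have "?X u v - ?Y u v \<in> two_sided_ideal S" if uv: "u \<in> basis_words 2" "v \<in> basis_words 2" for u v
  proof (cases "S = J")
    case True
    then have "?X u v - ?Y u v = op_prod 2 [?s R, Mbar F 2 1, Mbar F 2 2] u v - op_prod 2 [Mbar F 2 1, Mbar F 2 2, ?s R] u v"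
      by (simp add: gen_comp_def numeral_2_eq_2)
    then have "?X u v - ?Y u v \<in> J" unfolding qma_relations_def using uv by blast
    then show ?thesis using two_sided_ideal.generator[of _ J 1 1] True by simp
  next
    case False
    then have "?M = op_zero" by (simp add: gen_comp_def fun_eq_iff at1_def op_zero_def)
    then have "?X u v = 0" "?Y u v = 0" by (simp_all add: op_prod_def op_mult_def op_zero_def)
    then show ?thesis by (simp add: two_sided_ideal.zero)
  qed
  ultimately show "\<exists>X Y. op_represents S 2 (?m R * (?A * (?m F * ?A * ?m (matrix_inv F)))) X
      \<and> op_represents S 2 (?A * (?m F * ?A * ?m (matrix_inv F)) * ?m R) Y
      \<and> (\<forall>u\<in>basis_words 2. \<forall>v\<in>basis_words 2. X u v - Y u v \<in> two_sided_ideal S)"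
    by blast
qed

sublocale symplectic_rep q \<mu> R F k Mq
  using F RF sp Mq_relation by unfold_locales

lemma ev_letters:
  "Suc j < n \<Longrightarrow> sl 0 n (rho_letter R (Sigma (Suc j))) = (m2 R j :: (nat \<Rightarrow> 'n, 'a::calgebra) rfm)"
  using sl_at2[of "Suc j" n 0 R] by simp

sublocale symplectic_quantum_matrix q \<mu> "m2 R" "m2 Rinv" "m2 Km" k "m2 F" "m2 (matrix_inv F)" Eset "Rtr D" M0 gc
proof
  let ?f = "\<lambda>l. sl 0 (k + 1) (rho_letter R l) :: (nat \<Rightarrow> 'n, ('n \<times> 'n) quot_alg) rfm"
  show "\<mu> = - (inverse q ^ (2 * k + 1))" by (rule Sp_type_mu[OF sp])
  show k: "1 \<le> k" using sp by (simp add: Sp_type_def)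
  have "ev ?f (braid_shift 1 (antisym q \<mu> k)) = asym 1 k"
    unfolding ev_shift
  proof (rule ev_antisym)
    show "?f (shift_letter 1 (Sigma (Suc j))) = m2 R (1 + j)" if "Suc j < k" for j
      using ev_letters[of "Suc j" "k + 1", where 'a = "('n \<times> 'n) quot_alg"] that by simp
  qed
  moreover have "ev ?f (sigma_minus q \<mu> 1 x) = Sm 0 x" for x
    using ev_letters[of 0 "k + 1"] k by (intro ev_sigma_minus) simp
  ultimately have "asym 1 k * (Sm 0 (xq k) * asym 1 k)
      = ev ?f (braid_shift 1 (antisym q \<mu> k) * sigma_minus q \<mu> 1 (q powi (- 2 * int k)) * braid_shift 1 (antisym q \<mu> k))"
    by (simp only: ev_mult xq_powi mult.assoc)
  also have "\<dots> = sl 0 (k + 1) op_zero"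
    unfolding sl_rho[symmetric] by (rule sl_cong) (use sp in \<open>unfold Sp_type_def, blast\<close>)
  also have "\<dots> = 0"
    unfolding sl_def using lemb_zero by (simp add: scal_def[abs_def] op_zero_def[abs_def])
  finally show "asym 1 k * (Sm 0 (xq k) * asym 1 k) = 0" .
qed

lemma M_represents: "i < n \<Longrightarrow> op_represents J n (M i) (Mbar F n (Suc i))"
proof (induction i)
  case 0
  then show ?case using Mq_represents[of n J, folded M0_def] by (simp add: gen_comp_def)
next
  case (Suc i)
  have "op_represents J n (m2 X i) (scalar_op (at2 X (Suc i) (Suc (Suc i))))" for X :: "complex^('n \<times> 'n)^('n \<times> 'n)"
    using m2_represents[of "Suc i" n J X] Suc.prems by simp
  with Suc have "list_all2 (op_represents J n) [m2 F i, M i, m2 (matrix_inv F) i]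
      [scalar_op (at2 F (Suc i) (Suc (Suc i))), Mbar F n (Suc i), scalar_op (at2 (matrix_inv F) (Suc i) (Suc (Suc i)))]"
    by simp
  from op_represents_prod[OF this] show ?case by simp
qed

lemma MP_list: "MP 0 n = prod_list (map M [0..<n])"
  by (induction n) simp_all

lemma Mbar_list: "list_all2 (op_represents J n) (map M [0..<n]) (map (Mbar F n) [1..<n + 1])"
  by (simp add: list_all2_conv_all_nth M_represents del: upt_Suc)

text \<open>\<open>TR\<close> inserts \<open>D\<close> strand by strand, whereas
  \<open>Rtrace\<close> multiplies by all copies before any trace is taken. The copies on earlier
  strands do not touch the strand being closed, so they may be moved under its trace.\<close>

lemma TR_Tps: "TR m s A = Tps m s (prod_list (map (m1 D) [m..<m + s]) * A)"
proof (induction s arbitrary: A)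
  case (Suc s)
  have E: "prod_list (map (m1 D) [m..<m + t]) \<in> Eset (m + t)" for t
    by (induction t) (simp_all add: Eset_one Eset_mult Eset_Suc m1_Eset)
  have "TR m (Suc s) A = Tps m s (prod_list (map (m1 D) [m..<m + s]) * Tp (m + s) (m1 D (m + s) * A))"
    by (simp add: Suc.IH Rtr_def)
  then show ?case by (simp add: Tp_left[OF E, symmetric] mult.assoc)
qed simp

lemma TR_represents:
  assumes "op_represents S (m + s) A X"
  shows "op_represents S m (TR m s A) (Rtrace R (m + s) (Suc m) s X)"
proof -
  have "op_represents S (m + s) (m1 D j) (scalar_op (at1 D (Suc j)))" if "j < m + s" for j
  proof -
    have e: "m1 D j = (sl 0 (m + s) (at1 D (Suc j)) :: (nat \<Rightarrow> 'n, ('n \<times> 'n) quot_alg) rfm)"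
      using that by (simp add: sl_at1)
    show ?thesis unfolding e by (rule op_represents_sl)
  qed
  then have "list_all2 (op_represents S (m + s)) (map (m1 D) [m..<m + s])
      (map (\<lambda>j. scalar_op (at1 D j)) [Suc m..<Suc m + s])"
    by (simp add: list_all2_conv_all_nth del: upt_Suc)
  then have "list_all2 (op_represents S (m + s)) (map (m1 D) [m..<m + s] @ [A])
      (map (\<lambda>j. scalar_op (at1 D j)) [Suc m..<Suc m + s] @ [X])"
    using assms by (intro list_all2_appendI) simp_all
  from op_represents_Tps[OF op_represents_prod[OF this]] show ?thesis
    by (simp add: TR_Tps Rtrace_def del: upt_Suc)
qed

lemma ch_represents:
  "scalar_represents J (TR 0 n (MP 0 n * ev (\<lambda>l. sl 0 n (rho_letter R l)) \<alpha>)) (ch R F n \<alpha>)"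
proof -
  have "list_all2 (op_represents J n) (map M [0..<n] @ [sl 0 n (rho R n \<alpha>)])
      (map (Mbar F n) [1..<n + 1] @ [scalar_op (rho R n \<alpha>)])"
    using Mbar_list op_represents_sl by (intro list_all2_appendI) simp_all
  from op_represents_prod[OF this]
  have "op_represents J (0 + n) (MP 0 n * sl 0 n (rho R n \<alpha>)) (op_prod n (map (Mbar F n) [1..<n + 1] @ [scalar_op (rho R n \<alpha>)]))"
    by (simp add: MP_list del: upt_Suc)
  from TR_represents[OF this] show ?thesis
    unfolding sl_rho by (rule op_represents_cong) (simp add: op_eq_def basis_words_0 ch_def del: upt_Suc)
qed

lemma ach_represents: "scalar_represents J (ach i) (a_elem R F q \<mu> i)"
proof (cases "i = 0")
  case True
  then show ?thesis by (simp add: a_elem_def ach_def scalar_represents_one)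
next
  case False
  have "ev (\<lambda>l. sl 0 i (rho_letter R l)) (antisym q \<mu> i) = asym 0 i"
    by (rule ev_antisym) (use ev_letters in simp)
  then show ?thesis using False ch_represents[of i "antisym q \<mu> i"] by (simp add: a_elem_def ach_def)
qed

lemma gc_represents: "scalar_represents J gc (contraction R F q \<mu>)"
proof -
  have "ev (\<lambda>l. sl 0 2 (rho_letter R l)) (kappa q \<mu> 1) = (m2 Km 0 :: (nat \<Rightarrow> 'n, ('n \<times> 'n) quot_alg) rfm)"
    by (rule ev_kappa) (use ev_letters[of 0 2] in simp)
  then have "scalar_represents J (BMW_eta q \<mu> *\<^sub>C gc) (ch R F 2 (kappa q \<mu> 1))"
    using ch_represents[of 2 "kappa q \<mu> 1"] by (simp only: TR_MP_K)
  from op_represents_cs[OF this, of "inverse (BMW_eta q \<mu>)"] show ?thesis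
    using BMW_bmw_algebra(2)[OF bmw] by (simp add: contraction_def)
qed

lemma ep_represents: "scalar_represents J (ep i) (eps_low R F q \<mu> i)"
proof -
  have "scalar_represents J (ep i) (\<Sum>j\<le>i div 2. a_elem R F q \<mu> (i - 2 * j) * contraction R F q \<mu> ^ j)"
    unfolding ep_def
    by (intro op_represents_sum op_represents_mult_scalar[where X = "\<lambda>u v. _"] ach_represents
        scalar_represents_power gc_represents)
  then show ?thesis by (cases "i = 0") (simp_all add: eps_low_def a_elem_def)
qed

lemma pw_represents: "op_represents J 1 (pw n) (\<lambda>u v. M_power R F n $ hd u $ hd v)"
proof (cases n)
  case 0
  have "op_eq 1 op_id (\<lambda>u v. mat 1 $ hd u $ hd v :: 'n qma_free)"
    by (rule op_eq_1I) (simp add: op_id_def mat_def)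
  then show ?thesis using op_represents_cong[OF op_represents_one] by (simp add: 0 M_power_def)
next
  case (Suc m)
  have "desc 0 m = prod_list (map (m2 R) (rev [0..<m]))" by (induction m) simp_all
  moreover have "list_all2 (op_represents J n) (map (m2 R) (rev [0..<m]))
      (map (\<lambda>i. scalar_op (at2 R i (i + 1))) (rev [1..<n]))"
    using m2_represents[of "Suc _" n J R]
    by (simp add: list_all2_conv_all_nth rev_nth Suc del: upt_Suc)
  then have "list_all2 (op_represents J n) (map M [0..<n] @ map (m2 R) (rev [0..<m]))
      (map (Mbar F n) [1..<n + 1] @ map (\<lambda>i. scalar_op (at2 R i (i + 1))) (rev [1..<n]))"
    using Mbar_list by (intro list_all2_appendI)
  from op_represents_prod[OF this]
  have "op_represents J (1 + m) (MP 0 n * desc 0 m)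
      (op_prod n (map (Mbar F n) [1..<n + 1] @ map (\<lambda>i. scalar_op (at2 R i (i + 1))) (rev [1..<n])))"
    by (simp only: MP_list calculation prod_list.append) (simp add: Suc del: upt_Suc)
  from TR_represents[OF this] have "op_represents J 1 (pw n)
      (Rtrace R n 2 (n - 1) (op_prod n (map (Mbar F n) [1..<n + 1] @ map (\<lambda>i. scalar_op (at2 R i (i + 1))) (rev [1..<n]))))"
    by (simp add: Suc numeral_2_eq_2 del: upt_Suc)
  then show ?thesis
    by (rule op_represents_cong) (rule op_eq_1I, simp add: M_power_def Suc del: upt_Suc)
qed

lemma cayley_hamilton_ideal:
  "(\<Sum>i\<le>2 * k. scalar ((- q) ^ i) * (M_power R F (2 * k - i) $ a $ b * eps R F q \<mu> k i)) \<in> two_sided_ideal J"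
proof -
  let ?c = "\<lambda>i. if i \<le> k then ep i else ep (2 * k - i) * gc ^ (i - k)"
  have c: "scalar_represents J (?c i) (eps R F q \<mu> k i)" for i
    unfolding eps_def
    using ep_represents op_represents_mult_scalar[OF ep_represents scalar_represents_power[OF gc_represents]]
    by simp
  have "op_represents J 1 (\<Sum>i\<le>2 * k. (- q) ^ i *\<^sub>C (pw (2 * k - i) * ?c i))
      (\<lambda>u v. \<Sum>i\<le>2 * k. scalar ((- q) ^ i) * (M_power R F (2 * k - i) $ hd u $ hd v * eps R F q \<mu> k i))"
    by (intro op_represents_sum op_represents_cs op_represents_mult_scalar pw_represents c)
  then have "represents J 0 (\<Sum>i\<le>2 * k. scalar ((- q) ^ i) * (M_power R F (2 * k - i) $ a $ b * eps R F q \<mu> k i))"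
    unfolding cayley_hamilton lemb_zero[of 0 1, symmetric] op_represents_lemb
    by (drule_tac bspec[of _ _ "[a]"], simp add: basis_words_def, drule_tac bspec[of _ _ "[b]"])
      (simp_all add: basis_words_def op_zero_def)
  then show ?thesis by (simp only: represents_zero_iff)
qed

end

theorem theorem5p4:
  fixes R F :: "complex^('n::finite \<times> 'n)^('n \<times> 'n)"
    and q \<mu> :: complex and k :: nat
  assumes "k \<ge> 2"
    and "R_matrix R" and "strict_skew_invertible R"
    and "R_matrix F" and "strict_skew_invertible F"
    and "compatible_pair R F"
    and "Sp_type q \<mu> k R"
  shows "\<forall>a b. qma_eq R F
    (\<Sum>i\<le>2 * k. scalar ((- q) ^ i) * (M_power R F (2 * k - i) $ a $ b * eps R F q \<mu> k i)) 0"
proof -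
  interpret symplectic_qma q \<mu> R F k
    by unfold_locales (use assms in \<open>auto simp: Sp_type_def\<close>)
  show ?thesis using cayley_hamilton_ideal by (simp add: qma_eq_def)
qed

end
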